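(* Let $\lambda\ge0$, $p_0=\frac{2\lambda}{2\lambda+1}$, and $p_0<p<\infty$. Then the set of $\lambda$-analytic polynomials is dense in the $\lambda$-Bergman space $A^p_\lambda(\mathbb{D})$; and in particular, the system $$\left\{\left(\frac{n+\lambda+1}{\lambda+1}\right)^{1/2}\phi_n(z):\ n\in\mathbb{N}_0\right\}$$ is an orthonormal basis of the Hilbert space $A^2_\lambda(\mathbb{D})$.
   Context: Fix $\lambda\ge0$; $\mathbb{D}$ is the open unit disk in $\mathbb{C}$. For a complex-valued function $f$ put $D_{\bar z}f(z)=\partial_{\bar z}f(z)-\lambda\frac{f(z)-f(\bar z)}{z-\bar z}$, $z=x+iy$ (at real points the quotient is read as its limit $-i\,\partial_y f$). A $C^2$ (real sense) function $f:\mathbb{D}\to\mathbb{C}$ is $\lambda$-analytic if $D_{\bar z}f=0$ in $\mathbb{D}$. $d\sigma_\lambda(z)=c_\lambda|y|^{2\lambda}dx\,dy$, $z=x+iy$, with $c_\lambda=\frac{\Gamma(\lambda+2)}{\Gamma(\lambda+1/2)\Gamma(1/2)}$. For $0<p<\infty$, $A^p_\lambda(\mathbb{D})$ is the set of $\lambda$-analytic functions $f$ on $\mathbb{D}$ with $\|f\|_{A^p_\lambda}=\left(\int_{\mathbb{D}}|f|^pd\sigma_\lambda\right)^{1/p}<\infty$; density is with respect to this norm if $p\ge1$, and the metric $\|f-g\|_{A^p_\lambda}^p$ if $p<1$. The inner product of $A^2_\lambda(\mathbb{D})$ is $\int_{\mathbb{D}}f\bar g\,d\sigma_\lambda$. For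 $n\in\mathbb{N}_0=\{0,1,2,\dots\}$, $$\phi_n(z)=\epsilon_n\sum_{j=0}^n\frac{(\lambda)_j(\lambda+1)_{n-j}}{j!(n-j)!}\bar z^jz^{n-j},\qquad \epsilon_n=\sqrt{\frac{n!}{(2\lambda+1)_n}},$$ with $(a)_j=a(a+1)\cdots(a+j-1)$, $(a)_0=1$. A $\lambda$-analytic polynomial is a finite (complex) linear combination of the $\phi_n$. *)

theory Defs
  imports "HOL-Analysis.Analysis"
begin

text \<open>
  Functions on the unit disk are represented by total functions on the complex plane whose
  values outside the disk are irrelevant: every notion below depends only on the restriction
  to the disk.
\<close>

abbreviation unit_disk :: "complex set" where
  "unit_disk \<equiv> ball 0 1"

text \<open>Twice continuously (Frechet) differentiable in the real sense; meant for open \<open>S\<close>.\<close>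

definition C2_on :: "('a::real_normed_vector \<Rightarrow> 'b::real_normed_vector) \<Rightarrow> 'a set \<Rightarrow> bool" where
  "C2_on f S \<longleftrightarrow>
     (\<exists>(f' :: 'a \<Rightarrow> ('a \<Rightarrow>\<^sub>L 'b)) (f'' :: 'a \<Rightarrow> ('a \<Rightarrow>\<^sub>L ('a \<Rightarrow>\<^sub>L 'b))).
        (\<forall>x\<in>S. (f has_derivative blinfun_apply (f' x)) (at x)) \<and>
        (\<forall>x\<in>S. (f' has_derivative blinfun_apply (f'' x)) (at x)) \<and>
        continuous_on S f'')"

definition partial_x :: "(complex \<Rightarrow> complex) \<Rightarrow> complex \<Rightarrow> complex" where
  "partial_x f z = vector_derivative (\<lambda>t::real. f (z + of_real t)) (at 0)"

definition partial_y :: "(complex \<Rightarrow> complex) \<Rightarrow> complex \<Rightarrow> complex" where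
  "partial_y f z = vector_derivative (\<lambda>t::real. f (z + \<i> * of_real t)) (at 0)"

definition partial_zbar :: "(complex \<Rightarrow> complex) \<Rightarrow> complex \<Rightarrow> complex" where
  "partial_zbar f z = (partial_x f z + \<i> * partial_y f z) / 2"

text \<open>
  At real points the difference quotient is replaced by its limit: for \<open>z = x + iy\<close> it is
  \<open>(f (x + iy) - f (x - iy)) / (2iy)\<close>, which tends to \<open>- i \<partial>f/\<partial>y (x)\<close> as \<open>y\<close> tends to 0.
\<close>

definition D_zbar :: "real \<Rightarrow> (complex \<Rightarrow> complex) \<Rightarrow> complex \<Rightarrow> complex" where
  "D_zbar lam f z = partial_zbar f z -
     of_real lam * (if Im z = 0 then - \<i> * partial_y f z
                    else (f z - f (cnj z)) / (z - cnj z))"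

definition lambda_analytic :: "real \<Rightarrow> (complex \<Rightarrow> complex) \<Rightarrow> bool" where
  "lambda_analytic lam f \<longleftrightarrow>
     C2_on f unit_disk \<and> (\<forall>z\<in>unit_disk. D_zbar lam f z = 0)"

definition c_lambda :: "real \<Rightarrow> real" where
  "c_lambda lam = Gamma (lam + 2) / (Gamma (lam + 1/2) * Gamma (1/2))"

text \<open>
  Since \<open>0 powr 0 = 0\<close>, for \<open>lam = 0\<close> the density vanishes on the real axis instead of being
  constant there; the real axis is a null set, so the measure is not affected.
\<close>

definition sigma_lambda :: "real \<Rightarrow> complex measure" where
  "sigma_lambda lam = density (restrict_space lborel unit_disk)
     (\<lambda>z. ennreal (c_lambda lam * \<bar>Im z\<bar> powr (2 * lam)))"

definition bergman_space :: "real \<Rightarrow> real \<Rightarrow> (complex \<Rightarrow> complex) set" where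
  "bergman_space lam p = {f. lambda_analytic lam f \<and>
     integrable (sigma_lambda lam) (\<lambda>z. norm (f z) powr p)}"

definition bergman_norm :: "real \<Rightarrow> real \<Rightarrow> (complex \<Rightarrow> complex) \<Rightarrow> real" where
  "bergman_norm lam p f = (LINT z|sigma_lambda lam. norm (f z) powr p) powr (1 / p)"

definition bergman_dist ::
    "real \<Rightarrow> real \<Rightarrow> (complex \<Rightarrow> complex) \<Rightarrow> (complex \<Rightarrow> complex) \<Rightarrow> real" where
  "bergman_dist lam p f g =
     (if p \<ge> 1 then bergman_norm lam p (\<lambda>z. f z - g z)
      else bergman_norm lam p (\<lambda>z. f z - g z) powr p)"

definition dense_in_bergman :: "real \<Rightarrow> real \<Rightarrow> (complex \<Rightarrow> complex) set \<Rightarrow> bool" where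
  "dense_in_bergman lam p S \<longleftrightarrow> S \<subseteq> bergman_space lam p \<and>
     (\<forall>f\<in>bergman_space lam p. \<forall>e>0. \<exists>g\<in>S. bergman_dist lam p f g < e)"

definition complete_bergman :: "real \<Rightarrow> real \<Rightarrow> bool" where
  "complete_bergman lam p \<longleftrightarrow>
     (\<forall>u :: nat \<Rightarrow> complex \<Rightarrow> complex.
        (\<forall>k. u k \<in> bergman_space lam p) \<and>
        (\<forall>e>0. \<exists>K. \<forall>k\<ge>K. \<forall>l\<ge>K. bergman_dist lam p (u k) (u l) < e) \<longrightarrow>
        (\<exists>f\<in>bergman_space lam p. (\<lambda>k. bergman_dist lam p (u k) f) \<longlonglongrightarrow> 0))"

definition bergman_inner ::
    "real \<Rightarrow> (complex \<Rightarrow> complex) \<Rightarrow> (complex \<Rightarrow> complex) \<Rightarrow> complex" where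
  "bergman_inner lam f g = (LINT z|sigma_lambda lam. f z * cnj (g z))"

definition linear_combinations ::
    "(nat \<Rightarrow> complex \<Rightarrow> complex) \<Rightarrow> (complex \<Rightarrow> complex) set" where
  "linear_combinations e = {\<lambda>z. \<Sum>n<N. a n * e n z | (N::nat) (a :: nat \<Rightarrow> complex). True}"

text \<open>
  An orthonormal basis of the space with exponent 2: an orthonormal system of elements of the
  space whose linear span is dense with respect to the norm induced by the inner product.
\<close>

definition bergman_orthonormal_basis :: "real \<Rightarrow> (nat \<Rightarrow> complex \<Rightarrow> complex) \<Rightarrow> bool" where
  "bergman_orthonormal_basis lam e \<longleftrightarrow>
     (\<forall>n. e n \<in> bergman_space lam 2) \<and>
     (\<forall>m n. bergman_inner lam (e m) (e n) = (if m = n then 1 else 0)) \<and>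
     dense_in_bergman lam 2 (linear_combinations e)"

definition eps_lambda :: "real \<Rightarrow> nat \<Rightarrow> real" where
  "eps_lambda lam n = sqrt (fact n / pochhammer (2 * lam + 1) n)"

definition phi :: "real \<Rightarrow> nat \<Rightarrow> complex \<Rightarrow> complex" where
  "phi lam n z = of_real (eps_lambda lam n) *
     (\<Sum>j\<le>n. of_real (pochhammer lam j * pochhammer (lam + 1) (n - j)
                        / (fact j * fact (n - j))) * cnj z ^ j * z ^ (n - j))"

definition lambda_polynomials :: "real \<Rightarrow> (complex \<Rightarrow> complex) set" where
  "lambda_polynomials lam = linear_combinations (phi lam)"

end

theory Submission
  imports Defs "HOL-Real_Asymp.Real_Asymp"
begin

text \<open>
  Fix \<open>\<lambda> \<ge> 0\<close>. A \<open>\<lambda>\<close>-analytic \<open>f\<close> is approximated in two steps: its dilations \<open>f(r\<cdot>)\<close>, \<open>r < 1\<close>,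
  tend to \<open>f\<close> in \<open>L\<^sup>p\<close>, and each dilation is a uniform limit of \<open>\<lambda>\<close>-analytic polynomials on the
  disk.

  The first step (\<open>dilation_approximates\<close>) rests on the fact that the density \<open>|y|\<close> to the power \<open>2 \<lambda>\<close> is
  homogeneous. A change of variables bounds the \<open>L\<^sup>p\<close> integral of \<open>f(r\<cdot>)\<close> by a factor that tends to 1
  times that of \<open>f\<close>; since \<open>f(r\<cdot>)\<close> also tends to \<open>f\<close> pointwise, Fatou's lemma, applied to
  \<open>2\<^sup>p (|f(r\<cdot>)|\<^sup>p + |f|\<^sup>p) - |f(r\<cdot>) - f|\<^sup>p\<close>, gives convergence in \<open>L\<^sup>p\<close>.

  For the second step one splits \<open>f\<close> into two functions \<open>g = u + i v\<close> with
  \<open>g(cnj z) = cnj (g z)\<close>. For these, \<open>D_zbar g = 0\<close> becomes the generalized Cauchy-Riemann system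
  \<open>u\<^sub>x = v\<^sub>y + 2 \<lambda> v / y\<close>, \<open>u\<^sub>y = - v\<^sub>x\<close>, so that \<open>u\<close> solves a singular elliptic equation, without zeroth
  order term, and obeys the maximum principle (\<open>max_principle\<close>). On the unit circle \<open>u\<close> is a
  continuous function of \<open>x\<close>, hence a uniform limit of polynomials in \<open>x\<close>, and every polynomial in
  \<open>x\<close> is on the circle a combination of real parts of the \<open>\<phi>\<^sub>n\<close> (\<open>boundary_approximation\<close>). By the
  maximum principle, real parts of \<open>\<lambda>\<close>-analytic polynomials converge to \<open>u\<close> uniformly on the closed disk.
  The real parts of the \<open>\<phi>\<^sub>n\<close> are orthogonal, so the coefficients form Cauchy sequences with good
  bounds; therefore the polynomials themselves converge locally uniformly to a \<open>\<lambda>\<close>-analytic function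
  (\<open>phat_polynomials_limit\<close>). It has the same real part as \<open>g\<close>, and the system then forces it to be
  \<open>g\<close> (\<open>zero_real_part\<close>).

  Orthogonality and norms of the \<open>\<phi>\<^sub>n\<close> come from a divergence theorem for homogeneous polynomials
  (\<open>hpoly_divergence\<close>), applied to two vector fields whose weighted divergences are dictated by the
  Cauchy-Riemann system; together with the Euler relation they determine all inner products.
  That theorem reduces to a recursion between the moments of the measure, which are Beta integrals.

  Completeness of \<open>A\<^sup>2\<close> follows from density: approximate a Cauchy sequence by polynomials; orthogonality
  makes their coefficients converge, \<open>phat_polynomials_limit\<close> produces a \<open>\<lambda>\<close>-analytic pointwise limit,
  and Fatou's lemma shows that it is the limit in \<open>L\<^sup>2\<close>.
\<close>

section \<open>Directional derivatives and \<open>\<lambda>\<close>-analyticity\<close>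

lemma has_vector_derivative_along:
  fixes f :: "complex \<Rightarrow> complex"
  assumes "(f has_derivative f') (at z)"
  shows "((\<lambda>t::real. f (z + d * of_real t)) has_vector_derivative f' d) (at 0)"
proof -
  have lin: "linear f'"
    using assms by (rule has_derivative_linear)
  have "((\<lambda>t::real. z + d * of_real t) has_derivative (\<lambda>t. d * of_real t)) (at 0)"
    by (auto intro!: derivative_eq_intros)
  moreover have "(f has_derivative f') (at (z + d * of_real 0))"
    using assms by simp
  ultimately have "((\<lambda>t::real. f (z + d * of_real t)) has_derivative (\<lambda>t. f' (d * of_real t))) (at 0)"
    by (rule has_derivative_compose)
  moreover have "f' (d * of_real t) = t *\<^sub>R f' d" for t
    by (metis lin linear_scale mult.commute scaleR_conv_of_real)
  ultimately show ?thesis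
    by (simp add: has_vector_derivative_def)
qed

lemma has_real_derivative_along:
  fixes f :: "complex \<Rightarrow> complex"
  assumes "(f has_derivative f') (at z)"
  shows "((\<lambda>t. Re (f (z + d * of_real t))) has_real_derivative Re (f' d)) (at 0)"
    and "((\<lambda>t. Im (f (z + d * of_real t))) has_real_derivative Im (f' d)) (at 0)"
  using bounded_linear.has_vector_derivative[OF bounded_linear_Re has_vector_derivative_along[OF assms]]
    bounded_linear.has_vector_derivative[OF bounded_linear_Im has_vector_derivative_along[OF assms]]
  by (simp_all add: has_real_derivative_iff_has_vector_derivative)

lemma partial_derivatives_of_has_derivative:
  assumes "(f has_derivative f') (at z)"
  shows "partial_x f z = f' 1" "partial_y f z = f' \<i>"
proof -
  show "partial_x f z = f' 1"
    using vector_derivative_at[OF has_vector_derivative_along[OF assms, of 1]] by (simp add: partial_x_def)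
  show "partial_y f z = f' \<i>"
    using vector_derivative_at[OF has_vector_derivative_along[OF assms, of \<i>]] by (simp add: partial_y_def)
qed

lemma D_zbar_of_has_derivative:
  assumes "(f has_derivative f') (at z)"
  shows "D_zbar lam f z = (f' 1 + \<i> * f' \<i>) / 2 -
           of_real lam * (if Im z = 0 then - \<i> * f' \<i> else (f z - f (cnj z)) / (z - cnj z))"
  unfolding D_zbar_def partial_zbar_def partial_derivatives_of_has_derivative[OF assms] by simp

lemma minus_cnj_eq_0_iff: "z - cnj z = 0 \<longleftrightarrow> Im z = 0"
  by (auto simp: complex_eq_iff)

lemma D_zbar_eq_0_iff:
  assumes "(f has_derivative f') (at z)" "Im z \<noteq> 0"
  shows "D_zbar lam f z = 0 \<longleftrightarrow>
    (z - cnj z) * (f' 1 + \<i> * f' \<i>) = 2 * of_real lam * (f z - f (cnj z))"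
proof -
  have ne: "z - cnj z \<noteq> 0"
    using assms by (simp only: minus_cnj_eq_0_iff) simp
  have "D_zbar lam f z = (f' 1 + \<i> * f' \<i>) / 2 - of_real lam * ((f z - f (cnj z)) / (z - cnj z))"
    using assms(2) by (simp add: D_zbar_of_has_derivative[OF assms(1)])
  then have "D_zbar lam f z * (2 * (z - cnj z)) =
      (z - cnj z) * (f' 1 + \<i> * f' \<i>) - 2 * of_real lam * (f z - f (cnj z))"
    using ne by (simp add: ring_distribs field_simps)
  then show ?thesis
    using ne by (metis eq_iff_diff_eq_0 mult_eq_0_iff zero_neq_numeral)
qed

lemma has_vector_derivative_quotient_tendsto:
  fixes g :: "real \<Rightarrow> complex"
  assumes "(g has_vector_derivative l) (at 0)"
  shows "((\<lambda>t. (g t - g 0) / of_real t) \<longlongrightarrow> l) (at 0)"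
proof -
  have "(\<lambda>t. norm (g (0 + t) - g 0 - t *\<^sub>R l) / norm t) \<midarrow>0\<rightarrow> 0"
    using assms by (simp add: has_vector_derivative_def has_derivative_at)
  then have "((\<lambda>t. norm ((g t - g 0) / of_real t - l)) \<longlongrightarrow> 0) (at 0)"
  proof (rule Lim_transform_eventually)
    show "\<forall>\<^sub>F t in at 0. norm (g (0 + t) - g 0 - t *\<^sub>R l) / norm t = norm ((g t - g 0) / of_real t - l)"
      unfolding eventually_at_filter
    proof (intro always_eventually allI impI)
      fix t :: real assume "t \<noteq> 0"
      then have "(g t - g 0) / of_real t - l = (g t - g 0 - of_real t * l) / of_real t"
        by (simp add: diff_divide_distrib)
      then have "norm ((g t - g 0) / of_real t - l) = norm (g t - g 0 - of_real t * l) / norm t"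
        by (simp only: norm_divide norm_of_real real_norm_def)
      then show "norm (g (0 + t) - g 0 - t *\<^sub>R l) / norm t = norm ((g t - g 0) / of_real t - l)"
        by (simp only: scaleR_conv_of_real add_0)
    qed
  qed
  then show ?thesis
    by (rule LIM_zero_cancel[OF tendsto_norm_zero_cancel])
qed

text \<open>
  Both sides of the equation are continuous up to the real axis, where the difference quotient tends to
  \<open>- i\<close> times the \<open>y\<close>-derivative. Hence it suffices to check \<open>D_zbar f = 0\<close> off the real axis, and the
  case distinction in \<open>D_zbar\<close> disappears from all closure proofs.
\<close>

lemma lambda_analytic_off_real_axisI:
  assumes C2: "C2_on f unit_disk"
    and off: "\<And>z. z \<in> unit_disk \<Longrightarrow> Im z \<noteq> 0 \<Longrightarrow> D_zbar lam f z = 0"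
  shows "lambda_analytic lam f"
proof -
  obtain f' :: "complex \<Rightarrow> complex \<Rightarrow>\<^sub>L complex" and f'' where
    f': "\<And>z. z \<in> unit_disk \<Longrightarrow> (f has_derivative blinfun_apply (f' z)) (at z)"
    and f'': "\<And>z. z \<in> unit_disk \<Longrightarrow> (f' has_derivative blinfun_apply (f'' z)) (at z)"
    using C2 unfolding C2_on_def by blast
  have "D_zbar lam f z = 0" if z: "z \<in> unit_disk" "Im z = 0" for z
  proof -
    have cz: "cnj z = z"
      using z by (simp add: complex_eq_iff)
    have cont: "isCont f' z"
      using f''[OF z(1)] has_derivative_continuous by blast
    have lim: "((\<lambda>t::real. z + \<i> * of_real t) \<longlongrightarrow> z) (at 0)"
      by (rule tendsto_eq_intros refl | simp)+
    then have lim': "((\<lambda>t::real. f' (z + \<i> * of_real t)) \<longlongrightarrow> f' z) (at 0)"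
      using cont isCont_tendsto_compose by blast
    have lhs: "((\<lambda>t::real. (f' (z + \<i> * of_real t) 1 + \<i> * f' (z + \<i> * of_real t) \<i>) / 2)
        \<longlongrightarrow> (f' z 1 + \<i> * f' z \<i>) / 2) (at 0)"
      by (intro tendsto_intros lim') auto
    have "((\<lambda>t::real. f (z + 1 * \<i> * of_real t) - f (z + (-1) * \<i> * of_real t))
       has_vector_derivative f' z (1 * \<i>) - f' z ((-1) * \<i>)) (at 0)"
      by (intro has_vector_derivative_diff has_vector_derivative_along[OF f'[OF z(1)]])
    then have "((\<lambda>t::real. f (z + \<i> * of_real t) - f (z - \<i> * of_real t))
       has_vector_derivative 2 * f' z \<i>) (at 0)"
      by (simp add: blinfun.minus_right)
    from has_vector_derivative_quotient_tendsto[OF this]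
    have "((\<lambda>t::real. (f (z + \<i> * of_real t) - f (z - \<i> * of_real t)) / of_real t)
       \<longlongrightarrow> 2 * f' z \<i>) (at 0)"
      by simp
    then have "((\<lambda>t::real. of_real lam / (2 * \<i>) * ((f (z + \<i> * of_real t) - f (z - \<i> * of_real t)) / of_real t))
       \<longlongrightarrow> of_real lam / (2 * \<i>) * (2 * f' z \<i>)) (at 0)"
      by (intro tendsto_intros)
    moreover have "\<forall>\<^sub>F t::real in at 0.
       of_real lam / (2 * \<i>) * ((f (z + \<i> * of_real t) - f (z - \<i> * of_real t)) / of_real t) =
       (f' (z + \<i> * of_real t) 1 + \<i> * f' (z + \<i> * of_real t) \<i>) / 2"
    proof -
      have "\<forall>\<^sub>F t::real in at 0. z + \<i> * of_real t \<in> unit_disk"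
        using lim z(1) by (intro topological_tendstoD) auto
      moreover have "\<forall>\<^sub>F t::real in at 0. t \<noteq> 0"
        by (simp add: eventually_at_filter)
      ultimately show ?thesis
      proof eventually_elim
        case (elim t)
        let ?w = "z + \<i> * of_real t"
        have Im: "Im ?w \<noteq> 0"
          using elim z by simp
        have "(?w - cnj ?w) = 2 * \<i> * of_real t"
          using cz by simp
        moreover have "cnj ?w = z - \<i> * of_real t"
          using cz by simp
        moreover have "(?w - cnj ?w) * (f' ?w 1 + \<i> * f' ?w \<i>) = 2 * of_real lam * (f ?w - f (cnj ?w))"
          using D_zbar_eq_0_iff[OF f'[OF elim(1)] Im] off[OF elim(1) Im] by simp
        ultimately have "2 * \<i> * of_real t * (f' ?w 1 + \<i> * f' ?w \<i>)
            = 2 * of_real lam * (f ?w - f (z - \<i> * of_real t))"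
          by (simp add: mult_ac)
        then have "f' ?w 1 + \<i> * f' ?w \<i>
            = 2 * of_real lam * (f ?w - f (z - \<i> * of_real t)) / (2 * \<i> * of_real t)"
          using elim by (simp add: nonzero_eq_divide_eq mult_ac)
        then show ?case
          using elim by (simp add: field_simps)
      qed
    qed
    ultimately have "((\<lambda>t::real. (f' (z + \<i> * of_real t) 1 + \<i> * f' (z + \<i> * of_real t) \<i>) / 2)
        \<longlongrightarrow> of_real lam / (2 * \<i>) * (2 * f' z \<i>)) (at 0)"
      by (rule Lim_transform_eventually)
    with lhs have "(f' z 1 + \<i> * f' z \<i>) / 2 = of_real lam / (2 * \<i>) * (2 * f' z \<i>)"
      by (rule tendsto_unique[rotated]) simp
    then show ?thesis
      using z by (simp add: D_zbar_of_has_derivative[OF f'[OF z(1)]] field_simps)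
  qed
  then show ?thesis
    using C2 off unfolding lambda_analytic_def by blast
qed

lemma lambda_analyticI:
  assumes "C2_on f unit_disk"
    and "\<And>z. z \<in> unit_disk \<Longrightarrow> Im z \<noteq> 0 \<Longrightarrow> \<exists>f'. (f has_derivative f') (at z) \<and>
      (z - cnj z) * (f' 1 + \<i> * f' \<i>) = 2 * of_real lam * (f z - f (cnj z))"
  shows "lambda_analytic lam f"
  using assms D_zbar_eq_0_iff by (intro lambda_analytic_off_real_axisI) blast+

lemma lambda_analyticD:
  assumes "lambda_analytic lam f" "z \<in> unit_disk" "Im z \<noteq> 0"
  shows "\<exists>f'. (f has_derivative f') (at z) \<and>
      (z - cnj z) * (f' 1 + \<i> * f' \<i>) = 2 * of_real lam * (f z - f (cnj z))"
  using assms D_zbar_eq_0_iff unfolding lambda_analytic_def C2_on_def by blast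

lemma C2_on_add:
  assumes "C2_on f S" "C2_on g S"
  shows "C2_on (\<lambda>x. f x + g x) S"
proof -
  obtain f' f'' where f: "\<forall>x\<in>S. (f has_derivative blinfun_apply (f' x)) (at x)"
    "\<forall>x\<in>S. (f' has_derivative blinfun_apply (f'' x)) (at x)" "continuous_on S f''"
    using assms(1) unfolding C2_on_def by blast
  obtain g' g'' where g: "\<forall>x\<in>S. (g has_derivative blinfun_apply (g' x)) (at x)"
    "\<forall>x\<in>S. (g' has_derivative blinfun_apply (g'' x)) (at x)" "continuous_on S g''"
    using assms(2) unfolding C2_on_def by blast
  show ?thesis
    unfolding C2_on_def
  proof (intro exI[of _ "\<lambda>x. f' x + g' x"] exI[of _ "\<lambda>x. f'' x + g'' x"] conjI ballI)
    fix x assume "x \<in> S"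
    then show "((\<lambda>x. f x + g x) has_derivative blinfun_apply (f' x + g' x)) (at x)"
      using f(1) g(1) has_derivative_add[of f "f' x" "at x" g "g' x"]
      by (simp add: plus_blinfun.rep_eq)
    show "((\<lambda>x. f' x + g' x) has_derivative blinfun_apply (f'' x + g'' x)) (at x)"
      using f(2) g(2) \<open>x \<in> S\<close> has_derivative_add[of f' "f'' x" "at x" g' "g'' x"]
      by (simp add: plus_blinfun.rep_eq)
  qed (intro continuous_intros f g)
qed

text \<open>
  One rule covers scalar multiples, dilations and the reflection \<open>z \<mapsto> cnj (f (cnj z))\<close>.
\<close>

lemma C2_on_linear_conjugate:
  fixes f :: "'a::real_normed_vector \<Rightarrow> 'b::real_normed_vector"
    and T :: "'b \<Rightarrow>\<^sub>L 'c::real_normed_vector" and A :: "'a \<Rightarrow>\<^sub>L 'a"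
  assumes "C2_on f S" and AS: "\<And>x. x \<in> S \<Longrightarrow> blinfun_apply A x \<in> S"
  shows "C2_on (\<lambda>x. T (f (A x))) S"
proof -
  obtain f' f'' where f: "\<And>x. x \<in> S \<Longrightarrow> (f has_derivative blinfun_apply (f' x)) (at x)"
    "\<And>x. x \<in> S \<Longrightarrow> (f' has_derivative blinfun_apply (f'' x)) (at x)" "continuous_on S f''"
    using assms(1) unfolding C2_on_def by blast
  have bl: "bounded_linear (\<lambda>X :: 'a \<Rightarrow>\<^sub>L 'b. T o\<^sub>L X o\<^sub>L A)"
    by (intro bounded_linear_intros)
  define L where "L = Blinfun (\<lambda>X :: 'a \<Rightarrow>\<^sub>L 'b. T o\<^sub>L X o\<^sub>L A)"
  have L: "blinfun_apply L X = T o\<^sub>L X o\<^sub>L A" for X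
    unfolding L_def using bl by (simp add: bounded_linear_Blinfun_apply)
  have dA: "(blinfun_apply A has_derivative blinfun_apply A) (at x)" for x
    by (rule bounded_linear_imp_has_derivative) (rule blinfun.bounded_linear_right)
  show ?thesis
    unfolding C2_on_def
  proof (intro exI[of _ "\<lambda>x. L (f' (A x))"] exI[of _ "\<lambda>x. L o\<^sub>L f'' (A x) o\<^sub>L A"] conjI ballI)
    fix x assume x: "x \<in> S"
    have 1: "((\<lambda>x. f (A x)) has_derivative (\<lambda>h. f' (A x) (A h))) (at x)"
      using has_derivative_compose[OF dA f(1)[OF AS[OF x]]] .
    show "((\<lambda>x. T (f (A x))) has_derivative blinfun_apply (L (f' (A x)))) (at x)"
      using bounded_linear.has_derivative[OF blinfun.bounded_linear_right[of T] 1]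
      by (rule has_derivative_eq_rhs) (simp add: L fun_eq_iff)
    have 2: "((\<lambda>x. f' (A x)) has_derivative (\<lambda>h. f'' (A x) (A h))) (at x)"
      using has_derivative_compose[OF dA f(2)[OF AS[OF x]]] .
    show "((\<lambda>x. L (f' (A x))) has_derivative blinfun_apply (L o\<^sub>L f'' (A x) o\<^sub>L A)) (at x)"
      using bounded_linear.has_derivative[OF blinfun.bounded_linear_right[of L] 2]
      by (rule has_derivative_eq_rhs) (simp add: fun_eq_iff)
  next
    have "continuous_on S (\<lambda>x. f'' (A x))"
      using f(3) AS by (intro continuous_on_compose2[OF f(3)]) (auto intro!: continuous_intros)
    then show "continuous_on S (\<lambda>x. L o\<^sub>L f'' (A x) o\<^sub>L A)"
      by (intro continuous_intros)
  qed
qed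

lemma lambda_analytic_add:
  assumes "lambda_analytic lam f" "lambda_analytic lam g"
  shows "lambda_analytic lam (\<lambda>z. f z + g z)"
proof (rule lambda_analyticI)
  show "C2_on (\<lambda>z. f z + g z) unit_disk"
    using assms unfolding lambda_analytic_def by (intro C2_on_add) auto
  fix z :: complex assume z: "z \<in> unit_disk" "Im z \<noteq> 0"
  obtain f' where f': "(f has_derivative f') (at z)"
      "(z - cnj z) * (f' 1 + \<i> * f' \<i>) = 2 * of_real lam * (f z - f (cnj z))"
    using lambda_analyticD[OF assms(1) z] by blast
  obtain g' where g': "(g has_derivative g') (at z)"
      "(z - cnj z) * (g' 1 + \<i> * g' \<i>) = 2 * of_real lam * (g z - g (cnj z))"
    using lambda_analyticD[OF assms(2) z] by blast
  have "(z - cnj z) * ((f' 1 + g' 1) + \<i> * (f' \<i> + g' \<i>)) =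
      (z - cnj z) * (f' 1 + \<i> * f' \<i>) + (z - cnj z) * (g' 1 + \<i> * g' \<i>)"
    by (simp add: algebra_simps)
  also have "\<dots> = 2 * of_real lam * ((f z + g z) - (f (cnj z) + g (cnj z)))"
    unfolding f' g' by (simp add: algebra_simps)
  finally show "\<exists>h'. ((\<lambda>z. f z + g z) has_derivative h') (at z) \<and>
     (z - cnj z) * (h' 1 + \<i> * h' \<i>) = 2 * of_real lam * ((f z + g z) - (f (cnj z) + g (cnj z)))"
    using has_derivative_add[OF f'(1) g'(1)] by blast
qed

lemma lambda_analytic_cmult:
  assumes "lambda_analytic lam f"
  shows "lambda_analytic lam (\<lambda>z. c * f z)"
proof (rule lambda_analyticI)
  have "C2_on (\<lambda>z. blinfun_mult_right c (f (id_blinfun z))) unit_disk"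
    using assms unfolding lambda_analytic_def by (intro C2_on_linear_conjugate) auto
  then show "C2_on (\<lambda>z. c * f z) unit_disk"
    by simp
  fix z :: complex assume z: "z \<in> unit_disk" "Im z \<noteq> 0"
  obtain f' where f': "(f has_derivative f') (at z)"
      "(z - cnj z) * (f' 1 + \<i> * f' \<i>) = 2 * of_real lam * (f z - f (cnj z))"
    using lambda_analyticD[OF assms(1) z] by blast
  have "(z - cnj z) * (c * f' 1 + \<i> * (c * f' \<i>)) = c * ((z - cnj z) * (f' 1 + \<i> * f' \<i>))"
    by (simp add: algebra_simps)
  also have "\<dots> = 2 * of_real lam * (c * f z - c * f (cnj z))"
    unfolding f' by (simp add: algebra_simps)
  finally show "\<exists>h'. ((\<lambda>z. c * f z) has_derivative h') (at z) \<and>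
     (z - cnj z) * (h' 1 + \<i> * h' \<i>) = 2 * of_real lam * (c * f z - c * f (cnj z))"
    using has_derivative_mult_right[OF f'(1), of c] by blast
qed

lemma lambda_analytic_diff:
  assumes "lambda_analytic lam f" "lambda_analytic lam g"
  shows "lambda_analytic lam (\<lambda>z. f z - g z)"
  using lambda_analytic_add[OF assms(1) lambda_analytic_cmult[OF assms(2), of "-1"]] by simp

text \<open>
  Reflection in the real axis; it is used to split a \<open>\<lambda>\<close>-analytic function into two that
  commute with conjugation.
\<close>

lemma lambda_analytic_reflect:
  assumes "lambda_analytic lam f"
  shows "lambda_analytic lam (\<lambda>z. cnj (f (cnj z)))"
proof (rule lambda_analyticI)
  define C where "C = Blinfun cnj"
  have C: "blinfun_apply C = cnj"
    unfolding C_def by (simp add: bounded_linear_Blinfun_apply bounded_linear_cnj)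
  have "C2_on (\<lambda>z. C (f (C z))) unit_disk"
    using assms unfolding lambda_analytic_def by (intro C2_on_linear_conjugate) (auto simp: C)
  then show "C2_on (\<lambda>z. cnj (f (cnj z))) unit_disk"
    by (simp add: C)
  fix z :: complex assume z: "z \<in> unit_disk" "Im z \<noteq> 0"
  then have z': "cnj z \<in> unit_disk" "Im (cnj z) \<noteq> 0"
    by auto
  obtain f' where f': "(f has_derivative f') (at (cnj z))"
      "(cnj z - z) * (f' 1 + \<i> * f' \<i>) = 2 * of_real lam * (f (cnj z) - f z)"
    using lambda_analyticD[OF assms(1) z'] by auto
  have "((\<lambda>z. f (cnj z)) has_derivative (\<lambda>h. f' (cnj h))) (at z)"
    by (rule has_derivative_compose[where f = cnj and g = f and f' = cnj])
      (use f'(1) in \<open>auto intro: bounded_linear_imp_has_derivative bounded_linear_cnj\<close>)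
  then have d: "((\<lambda>z. cnj (f (cnj z))) has_derivative (\<lambda>h. cnj (f' (cnj h)))) (at z)"
    by (rule has_derivative_cnj)
  have "f' (- \<i>) = - f' \<i>"
    using has_derivative_linear[OF f'(1)] by (simp add: linear_neg)
  then have "(z - cnj z) * (cnj (f' (cnj 1)) + \<i> * cnj (f' (cnj \<i>))) = cnj ((cnj z - z) * (f' 1 + \<i> * f' \<i>))"
    by simp
  also have "\<dots> = 2 * of_real lam * (cnj (f (cnj z)) - cnj (f (cnj (cnj z))))"
    unfolding f' by simp
  finally show "\<exists>h'. ((\<lambda>z. cnj (f (cnj z))) has_derivative h') (at z) \<and>
     (z - cnj z) * (h' 1 + \<i> * h' \<i>) = 2 * of_real lam * (cnj (f (cnj z)) - cnj (f (cnj (cnj z))))"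
    using d by blast
qed

lemma lambda_analytic_dilation:
  assumes "lambda_analytic lam f" and r: "0 < r" "r \<le> 1"
  shows "lambda_analytic lam (\<lambda>z. f (of_real r * z))"
proof (rule lambda_analyticI)
  have in_disk: "of_real r * z \<in> unit_disk" if "z \<in> unit_disk" for z
  proof -
    have "r * norm z \<le> 1 * norm z"
      using r by (intro mult_right_mono) auto
    then show ?thesis
      using that r by (simp add: norm_mult)
  qed
  have "C2_on (\<lambda>z. id_blinfun (f (blinfun_mult_right (of_real r) z))) unit_disk"
    using assms in_disk unfolding lambda_analytic_def by (intro C2_on_linear_conjugate) auto
  then show "C2_on (\<lambda>z. f (of_real r * z)) unit_disk"
    by simp
  fix z :: complex assume z: "z \<in> unit_disk" "Im z \<noteq> 0"
  then have z': "of_real r * z \<in> unit_disk" "Im (of_real r * z) \<noteq> 0"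
    using in_disk r by auto
  obtain f' where f': "(f has_derivative f') (at (of_real r * z))"
      "(of_real r * z - cnj (of_real r * z)) * (f' 1 + \<i> * f' \<i>) = 2 * of_real lam * (f (of_real r * z) - f (cnj (of_real r * z)))"
    using lambda_analyticD[OF assms(1) z'] by auto
  have d: "((\<lambda>z. f (of_real r * z)) has_derivative (\<lambda>h. f' (of_real r * h))) (at z)"
    by (rule has_derivative_compose[where f = "\<lambda>z. of_real r * z" and g = f])
      (use f'(1) in \<open>auto intro!: derivative_eq_intros\<close>)
  have "f' (of_real r * h) = of_real r * f' h" for h
    using linear_scale[OF has_derivative_linear[OF f'(1)], of r h] by (simp add: scaleR_conv_of_real)
  then have "(z - cnj z) * (f' (of_real r * 1) + \<i> * f' (of_real r * \<i>)) =
     (of_real r * z - cnj (of_real r * z)) * (f' 1 + \<i> * f' \<i>)"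
    by (simp only: complex_cnj_mult complex_cnj_complex_of_real) (simp only: algebra_simps)
  also have "\<dots> = 2 * of_real lam * (f (of_real r * z) - f (of_real r * cnj z))"
    unfolding f' by simp
  finally show "\<exists>h'. ((\<lambda>z. f (of_real r * z)) has_derivative h') (at z) \<and>
     (z - cnj z) * (h' 1 + \<i> * h' \<i>) = 2 * of_real lam * (f (of_real r * z) - f (of_real r * cnj z))"
    using d by blast
qed

lemma lambda_analytic_continuous_on:
  assumes "lambda_analytic lam f"
  shows "continuous_on unit_disk f"
proof -
  have "isCont f z" if "z \<in> unit_disk" for z
    using assms that has_derivative_continuous unfolding lambda_analytic_def C2_on_def by blast
  then show ?thesis
    by (intro continuous_at_imp_continuous_on) auto
qed

section \<open>The polynomials \<open>\<phi>\<^sub>n\<close> and their derivatives\<close>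

text \<open>
  The coefficient of \<open>x\<^sup>k\<close> in \<open>(1 - x)\<close> to the power \<open>- a\<close>. The identities below are the
  coefficient forms of differentiation, of multiplication by \<open>1 - x\<close>, and of the product of two such
  series.
\<close>

definition rising_coeff :: "real \<Rightarrow> nat \<Rightarrow> real" where
  "rising_coeff a k = pochhammer a k / fact k"

lemma rising_coeff_0 [simp]: "rising_coeff a 0 = 1"
  by (simp add: rising_coeff_def)

lemma rising_coeff_Suc: "real (Suc k) * rising_coeff a (Suc k) = (a + real k) * rising_coeff a k"
  by (simp add: rising_coeff_def pochhammer_Suc field_simps del: of_nat_Suc)

lemma rising_coeff_shift: "a * rising_coeff (a + 1) k = (a + real k) * rising_coeff a k"
proof -
  have "a * pochhammer (a + 1) k = (a + real k) * pochhammer a k"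
    using pochhammer_rec[of a k] pochhammer_Suc[of a k] by (simp add: mult.commute)
  then show ?thesis
    by (simp add: rising_coeff_def)
qed

lemma rising_coeff_diff: "rising_coeff (a + 1) (Suc k) - rising_coeff (a + 1) k = rising_coeff a (Suc k)"
proof -
  have "real (Suc k) * (rising_coeff (a + 1) (Suc k) - rising_coeff (a + 1) k)
      = (a + 1 + real k) * rising_coeff (a + 1) k - real (Suc k) * rising_coeff (a + 1) k"
    by (simp only: right_diff_distrib rising_coeff_Suc)
  also have "\<dots> = a * rising_coeff (a + 1) k"
    by (simp add: algebra_simps)
  also have "\<dots> = real (Suc k) * rising_coeff a (Suc k)"
    by (simp only: rising_coeff_shift rising_coeff_Suc)
  finally show ?thesis
    by simp
qed

lemma rising_coeff_nonneg: "a \<ge> 0 \<Longrightarrow> rising_coeff a k \<ge> 0"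
  by (cases "a = 0") (auto simp: rising_coeff_def pochhammer_0_left pochhammer_pos less_imp_le)

lemma rising_coeff_pos: "a > 0 \<Longrightarrow> rising_coeff a k > 0"
  by (simp add: rising_coeff_def pochhammer_pos)

lemma rising_coeff_Vandermonde:
  "(\<Sum>j\<le>n. rising_coeff a j * rising_coeff b (n - j)) = rising_coeff (a + b) n"
proof -
  have "rising_coeff (a + b) n = (\<Sum>j\<le>n. of_nat (n choose j) * pochhammer a j * pochhammer b (n - j)) / fact n"
    by (simp add: rising_coeff_def pochhammer_binomial_sum)
  also have "\<dots> = (\<Sum>j\<le>n. rising_coeff a j * rising_coeff b (n - j))"
    unfolding sum_divide_distrib
    by (intro sum.cong refl) (simp add: rising_coeff_def binomial_fact field_simps)
  finally show ?thesis ..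
qed

definition mon :: "nat \<Rightarrow> nat \<Rightarrow> complex \<Rightarrow> complex" where
  "mon j k z = cnj z ^ j * z ^ k"

text \<open>
  The polynomial \<open>\<phi>\<^sub>n\<close> without its normalizing factor; all its coefficients are nonnegative, and they
  sum to \<open>rising_coeff (2 * lam + 1) n\<close>.
\<close>

definition phat :: "real \<Rightarrow> nat \<Rightarrow> complex \<Rightarrow> complex" where
  "phat lam n z = (\<Sum>j\<le>n. of_real (rising_coeff lam j * rising_coeff (lam + 1) (n - j)) * mon j (n - j) z)"

text \<open>
  On the unit circle this is the Gegenbauer polynomial with parameter \<open>\<lambda> + 1\<close> at \<open>Re z\<close>. It is real, and it
  carries the imaginary part of \<open>\<phi>\<close>: \<open>Im (phat lam (n + 1) z) = Im z * psi lam n z\<close>.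
\<close>

definition psi :: "real \<Rightarrow> nat \<Rightarrow> complex \<Rightarrow> complex" where
  "psi lam n z = (\<Sum>j\<le>n. of_real (rising_coeff (lam + 1) j * rising_coeff (lam + 1) (n - j)) * mon j (n - j) z)"

lemma phi_eq_phat: "phi lam n z = of_real (eps_lambda lam n) * phat lam n z"
  by (simp add: phi_def phat_def mon_def rising_coeff_def mult.assoc)

lemma phat_0 [simp]: "phat lam 0 z = 1"
  by (simp add: phat_def mon_def)

text \<open>
  Comparing coefficients, this is the relation \<open>rising_coeff_diff\<close>. Since \<open>psi\<close> is real and
  invariant under conjugation, it yields the reflection quotient \<open>phat_reflect_diff\<close> at once.
\<close>

lemma phat_Suc: "phat lam (Suc m) z = psi lam (Suc m) z - cnj z * psi lam m z"
proof -
  have "psi lam (Suc m) z - cnj z * psi lam m z =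
     of_real (rising_coeff (lam + 1) (Suc m)) * mon 0 (Suc m) z +
     ((\<Sum>j\<le>m. of_real (rising_coeff (lam + 1) (Suc j) * rising_coeff (lam + 1) (m - j)) * mon (Suc j) (m - j) z)
      - (\<Sum>j\<le>m. of_real (rising_coeff (lam + 1) j * rising_coeff (lam + 1) (m - j)) * mon (Suc j) (m - j) z))"
    unfolding psi_def sum.atMost_Suc_shift sum_distrib_left by (simp add: mon_def algebra_simps)
  also have "(\<Sum>j\<le>m. of_real (rising_coeff (lam + 1) (Suc j) * rising_coeff (lam + 1) (m - j)) * mon (Suc j) (m - j) z)
      - (\<Sum>j\<le>m. of_real (rising_coeff (lam + 1) j * rising_coeff (lam + 1) (m - j)) * mon (Suc j) (m - j) z)
      = (\<Sum>j\<le>m. of_real (rising_coeff lam (Suc j) * rising_coeff (lam + 1) (m - j)) * mon (Suc j) (m - j) z)"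
    unfolding sum_subtractf[symmetric] rising_coeff_diff[of lam, symmetric]
    by (intro sum.cong refl) (simp add: algebra_simps)
  also have "of_real (rising_coeff (lam + 1) (Suc m)) * mon 0 (Suc m) z + \<dots> = phat lam (Suc m) z"
    unfolding phat_def sum.atMost_Suc_shift by simp
  finally show ?thesis ..
qed

lemma cnj_mon: "cnj (mon j k z) = mon k j z" "mon j k (cnj z) = mon k j z"
  by (simp_all add: mon_def mult.commute)

lemma cnj_phat: "cnj (phat lam n z) = phat lam n (cnj z)"
  by (simp add: phat_def cnj_mon)

lemma cnj_psi: "cnj (psi lam n z) = psi lam n z"
proof -
  have "cnj (psi lam n z) = (\<Sum>j\<le>n. of_real (rising_coeff (lam + 1) j * rising_coeff (lam + 1) (n - j)) * mon (n - j) j z)"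
    by (simp add: psi_def cnj_mon)
  also have "\<dots> = psi lam n z"
    unfolding psi_def
    by (rule sum.reindex_bij_witness[of _ "\<lambda>j. n - j" "\<lambda>j. n - j"]) (auto simp: mult.commute)
  finally show ?thesis .
qed

lemma psi_cnj: "psi lam n (cnj z) = psi lam n z"
proof -
  have "psi lam n (cnj z) = cnj (psi lam n z)"
    by (simp add: psi_def cnj_mon)
  then show ?thesis
    by (simp add: cnj_psi)
qed

lemma phat_reflect_diff: "phat lam (Suc m) z - phat lam (Suc m) (cnj z) = (z - cnj z) * psi lam m z"
  by (simp add: phat_Suc psi_cnj algebra_simps)

lemma norm_phat_le:
  assumes "lam \<ge> 0"
  shows "norm (phat lam n z) \<le> rising_coeff (2 * lam + 1) n * norm z ^ n"
proof -
  have "norm (phat lam n z) \<le> (\<Sum>j\<le>n. rising_coeff lam j * rising_coeff (lam + 1) (n - j) * norm z ^ n)"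
    unfolding phat_def
  proof (rule sum_norm_le)
    fix j assume "j \<in> {..n}"
    then have "norm z ^ j * norm z ^ (n - j) = norm z ^ n"
      by (simp add: power_add[symmetric])
    then show "norm (of_real (rising_coeff lam j * rising_coeff (lam + 1) (n - j)) * mon j (n - j) z)
        \<le> rising_coeff lam j * rising_coeff (lam + 1) (n - j) * norm z ^ n"
      using assms by (simp add: norm_mult mon_def norm_power rising_coeff_nonneg)
  qed
  also have "\<dots> = rising_coeff (2 * lam + 1) n * norm z ^ n"
    unfolding sum_distrib_right[symmetric] rising_coeff_Vandermonde by simp
  finally show ?thesis .
qed

definition conj_blinfun :: "complex \<Rightarrow>\<^sub>L complex" where
  "conj_blinfun = Blinfun cnj"

lemma conj_blinfun_apply [simp]: "blinfun_apply conj_blinfun = cnj"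
  unfolding conj_blinfun_def by (simp add: bounded_linear_Blinfun_apply bounded_linear_cnj)

definition mult_blinfun :: "complex \<Rightarrow>\<^sub>L (complex \<Rightarrow>\<^sub>L complex)" where
  "mult_blinfun = Blinfun blinfun_mult_right"

lemma mult_blinfun_apply [simp]: "blinfun_apply (blinfun_apply mult_blinfun c) h = c * h"
  unfolding mult_blinfun_def
  by (simp add: bounded_linear_Blinfun_apply bounded_linear_blinfun_mult_right)

lemma norm_mult_blinfun_apply_le: "norm (blinfun_apply mult_blinfun c) \<le> norm c"
  by (rule norm_blinfun_bound) (auto simp: norm_mult)

lemma norm_mult_blinfun_le: "norm mult_blinfun \<le> 1"
  by (rule norm_blinfun_bound) (auto simp: norm_mult_blinfun_apply_le)

definition conj_mult_blinfun :: "complex \<Rightarrow>\<^sub>L (complex \<Rightarrow>\<^sub>L complex)" where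
  "conj_mult_blinfun = Blinfun (\<lambda>c. blinfun_apply mult_blinfun c o\<^sub>L conj_blinfun)"

lemma conj_mult_blinfun_apply [simp]: "blinfun_apply (blinfun_apply conj_mult_blinfun c) h = c * cnj h"
proof -
  have "bounded_linear (\<lambda>c. blinfun_apply mult_blinfun c o\<^sub>L conj_blinfun)"
    by (intro bounded_linear_intros)
  then show ?thesis
    unfolding conj_mult_blinfun_def by (simp add: bounded_linear_Blinfun_apply)
qed

lemma norm_conj_mult_blinfun_apply_le: "norm (blinfun_apply conj_mult_blinfun c) \<le> norm c"
  by (rule norm_blinfun_bound) (auto simp: norm_mult)

lemma norm_conj_mult_blinfun_le: "norm conj_mult_blinfun \<le> 1"
  by (rule norm_blinfun_bound) (auto simp: norm_conj_mult_blinfun_apply_le)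

definition mon1 :: "nat \<Rightarrow> nat \<Rightarrow> complex \<Rightarrow> (complex \<Rightarrow>\<^sub>L complex)" where
  "mon1 j k z = real j *\<^sub>R conj_mult_blinfun (mon (j - 1) k z) + real k *\<^sub>R mult_blinfun (mon j (k - 1) z)"

definition mon2 :: "nat \<Rightarrow> nat \<Rightarrow> complex \<Rightarrow> (complex \<Rightarrow>\<^sub>L (complex \<Rightarrow>\<^sub>L complex))" where
  "mon2 j k z = real j *\<^sub>R (conj_mult_blinfun o\<^sub>L mon1 (j - 1) k z) + real k *\<^sub>R (mult_blinfun o\<^sub>L mon1 j (k - 1) z)"

lemma mon1_apply: "mon1 j k z h = of_nat j * mon (j - 1) k z * cnj h + of_nat k * mon j (k - 1) z * h"
  by (simp add: mon1_def blinfun.add_left blinfun.scaleR_left scaleR_conv_of_real mult.assoc)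

lemma has_derivative_mon: "(mon j k has_derivative blinfun_apply (mon1 j k z)) (at z)"
proof -
  have "((\<lambda>z. cnj z ^ j * z ^ k) has_derivative
     (\<lambda>h. cnj z ^ j * (of_nat k * h * z ^ (k - 1)) + of_nat j * cnj h * cnj z ^ (j - 1) * z ^ k)) (at z)"
    by (intro has_derivative_mult has_derivative_power has_derivative_cnj has_derivative_ident)
  then show ?thesis
    unfolding mon_def[abs_def]
    by (rule has_derivative_eq_rhs) (simp add: fun_eq_iff mon1_apply mon_def mult_ac)
qed

lemma has_derivative_mon1: "(mon1 j k has_derivative blinfun_apply (mon2 j k z)) (at z)"
proof -
  have "((\<lambda>z. real j *\<^sub>R conj_mult_blinfun (mon (j - 1) k z) + real k *\<^sub>R mult_blinfun (mon j (k - 1) z))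
    has_derivative (\<lambda>h. real j *\<^sub>R conj_mult_blinfun (mon1 (j - 1) k z h) + real k *\<^sub>R mult_blinfun (mon1 j (k - 1) z h))) (at z)"
    by (intro has_derivative_add has_derivative_scaleR_right
        bounded_linear.has_derivative[OF blinfun.bounded_linear_right] has_derivative_mon)
  then show ?thesis
    unfolding mon1_def[abs_def]
    by (rule has_derivative_eq_rhs) (simp add: fun_eq_iff mon2_def mon1_def blinfun.add_left blinfun.scaleR_left)
qed

lemma continuous_on_mon: "continuous_on S (mon j k)"
  unfolding mon_def[abs_def] by (intro continuous_intros)

lemma continuous_on_mon1: "continuous_on S (mon1 j k)"
  unfolding mon1_def[abs_def] by (intro continuous_intros continuous_on_mon)

lemma continuous_on_mon2: "continuous_on S (mon2 j k)"
  unfolding mon2_def[abs_def] by (intro continuous_intros continuous_on_mon1)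

lemma norm_mon_le: "norm z \<le> r \<Longrightarrow> norm (mon j k z) \<le> r ^ (j + k)"
  using order_trans[OF norm_ge_zero, of z r]
  unfolding mon_def norm_mult norm_power power_add complex_mod_cnj
  by (intro mult_mono power_mono) auto

lemma norm_mon1_le:
  assumes "norm z \<le> r"
  shows "norm (mon1 j k z) \<le> real (j + k) * r ^ (j + k - 1)"
proof -
  have r: "0 \<le> r"
    using assms norm_ge_zero order_trans by blast
  have 1: "norm (real j *\<^sub>R conj_mult_blinfun (mon (j - 1) k z)) \<le> real j * r ^ (j + k - 1)"
  proof (cases j)
    case (Suc i)
    have "norm (conj_mult_blinfun (mon i k z)) \<le> r ^ (i + k)"
      using norm_conj_mult_blinfun_apply_le norm_mon_le[OF assms] order_trans by blast
    then show ?thesis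
      using Suc by (simp del: of_nat_Suc add: mult_left_mono)
  qed simp
  have 2: "norm (real k *\<^sub>R mult_blinfun (mon j (k - 1) z)) \<le> real k * r ^ (j + k - 1)"
  proof (cases k)
    case (Suc i)
    have "norm (mult_blinfun (mon j i z)) \<le> r ^ (j + i)"
      using norm_mult_blinfun_apply_le norm_mon_le[OF assms] order_trans by blast
    then show ?thesis
      using Suc by (simp del: of_nat_Suc add: mult_left_mono)
  qed simp
  show ?thesis
    unfolding mon1_def using norm_triangle_mono[OF 1 2] by (simp add: distrib_right)
qed

lemma norm_mon2_le:
  assumes "norm z \<le> r"
  shows "norm (mon2 j k z) \<le> (real (j + k))\<^sup>2 * r ^ (j + k - 2)"
proof -
  have r: "0 \<le> r"
    using assms norm_ge_zero order_trans by blast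
  have comp: "norm (A o\<^sub>L mon1 i l z) \<le> real (i + l) * r ^ (i + l - 1)"
    if "norm A \<le> 1" for A :: "complex \<Rightarrow>\<^sub>L (complex \<Rightarrow>\<^sub>L complex)" and i l
  proof -
    have "norm (A o\<^sub>L mon1 i l z) \<le> norm A * norm (mon1 i l z)"
      by (rule norm_blinfun_compose)
    also have "\<dots> \<le> 1 * norm (mon1 i l z)"
      by (intro mult_right_mono that) auto
    finally show ?thesis
      using norm_mon1_le[OF assms, of i l] by simp
  qed
  have mono: "real (i + l) * r ^ (i + l - 1) \<le> real (j + k) * r ^ (j + k - 2)"
    if "Suc (i + l) = j + k" for i l
  proof -
    have "i + l - 1 = j + k - 2"
      using that by simp
    then show ?thesis
      using that r by (intro mult_mono) auto
  qed
  have 1: "norm (real j *\<^sub>R (conj_mult_blinfun o\<^sub>L mon1 (j - 1) k z)) \<le> real j * (real (j + k) * r ^ (j + k - 2))"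
  proof (cases j)
    case (Suc i)
    have "norm (conj_mult_blinfun o\<^sub>L mon1 i k z) \<le> real (j + k) * r ^ (j + k - 2)"
      using comp[OF norm_conj_mult_blinfun_le, of i k] mono[of i k] Suc by simp
    then show ?thesis
      using Suc by (simp del: of_nat_Suc add: mult_left_mono)
  qed simp
  have 2: "norm (real k *\<^sub>R (mult_blinfun o\<^sub>L mon1 j (k - 1) z)) \<le> real k * (real (j + k) * r ^ (j + k - 2))"
  proof (cases k)
    case (Suc i)
    have "norm (mult_blinfun o\<^sub>L mon1 j i z) \<le> real (j + k) * r ^ (j + k - 2)"
      using comp[OF norm_mult_blinfun_le, of j i] mono[of j i] Suc by simp
    then show ?thesis
      using Suc by (simp del: of_nat_Suc add: mult_left_mono)
  qed simp
  show ?thesis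
    unfolding mon2_def using norm_triangle_mono[OF 1 2] by (simp add: distrib_right power2_eq_square mult.assoc)
qed

definition phat1 :: "real \<Rightarrow> nat \<Rightarrow> complex \<Rightarrow> (complex \<Rightarrow>\<^sub>L complex)" where
  "phat1 lam n z = (\<Sum>j\<le>n. (rising_coeff lam j * rising_coeff (lam + 1) (n - j)) *\<^sub>R mon1 j (n - j) z)"

definition phat2 :: "real \<Rightarrow> nat \<Rightarrow> complex \<Rightarrow> (complex \<Rightarrow>\<^sub>L (complex \<Rightarrow>\<^sub>L complex))" where
  "phat2 lam n z = (\<Sum>j\<le>n. (rising_coeff lam j * rising_coeff (lam + 1) (n - j)) *\<^sub>R mon2 j (n - j) z)"

lemma has_derivative_phat: "(phat lam n has_derivative blinfun_apply (phat1 lam n z)) (at z)"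
proof -
  have "((\<lambda>z. \<Sum>j\<le>n. (rising_coeff lam j * rising_coeff (lam + 1) (n - j)) *\<^sub>R mon j (n - j) z) has_derivative
    (\<lambda>h. \<Sum>j\<le>n. (rising_coeff lam j * rising_coeff (lam + 1) (n - j)) *\<^sub>R mon1 j (n - j) z h)) (at z)"
    by (intro has_derivative_sum has_derivative_scaleR_right has_derivative_mon)
  then show ?thesis
    unfolding phat_def[abs_def] scaleR_conv_of_real
    by (rule has_derivative_eq_rhs)
       (simp add: fun_eq_iff phat1_def blinfun.sum_left blinfun.scaleR_left scaleR_conv_of_real)
qed

lemma has_derivative_phat1: "(phat1 lam n has_derivative blinfun_apply (phat2 lam n z)) (at z)"
proof -
  have "((\<lambda>z. \<Sum>j\<le>n. (rising_coeff lam j * rising_coeff (lam + 1) (n - j)) *\<^sub>R mon1 j (n - j) z) has_derivative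
    (\<lambda>h. \<Sum>j\<le>n. (rising_coeff lam j * rising_coeff (lam + 1) (n - j)) *\<^sub>R mon2 j (n - j) z h)) (at z)"
    by (intro has_derivative_sum has_derivative_scaleR_right has_derivative_mon1)
  then show ?thesis
    unfolding phat1_def[abs_def]
    by (rule has_derivative_eq_rhs)
       (simp add: fun_eq_iff phat2_def blinfun.sum_left blinfun.scaleR_left)
qed

lemma continuous_on_phat2: "continuous_on S (phat2 lam n)"
  unfolding phat2_def[abs_def] by (intro continuous_intros continuous_on_mon2)

text \<open>
  The weights are nonnegative and their sum is known, so a bound for each monomial gives one for the
  combination; it is applied to both derivatives.
\<close>

lemma norm_phat_sum_le:
  fixes g :: "nat \<Rightarrow> nat \<Rightarrow> 'a::real_normed_vector"
  assumes "lam \<ge> 0" "\<And>j k. j + k = n \<Longrightarrow> norm (g j k) \<le> b"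
  shows "norm (\<Sum>j\<le>n. (rising_coeff lam j * rising_coeff (lam + 1) (n - j)) *\<^sub>R g j (n - j))
     \<le> rising_coeff (2 * lam + 1) n * b"
proof -
  have "norm (\<Sum>j\<le>n. (rising_coeff lam j * rising_coeff (lam + 1) (n - j)) *\<^sub>R g j (n - j))
     \<le> (\<Sum>j\<le>n. (rising_coeff lam j * rising_coeff (lam + 1) (n - j)) * b)"
    using assms by (intro sum_norm_le) (auto simp: rising_coeff_nonneg abs_mult intro!: mult_left_mono)
  also have "\<dots> = rising_coeff (2 * lam + 1) n * b"
    unfolding sum_distrib_right[symmetric] rising_coeff_Vandermonde by simp
  finally show ?thesis .
qed

lemma norm_phat1_le:
  assumes "lam \<ge> 0" "norm z \<le> r"
  shows "norm (phat1 lam n z) \<le> rising_coeff (2 * lam + 1) n * (real n * r ^ (n - 1))"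
  unfolding phat1_def using norm_mon1_le[OF assms(2)] by (intro norm_phat_sum_le assms) fastforce

lemma norm_phat2_le:
  assumes "lam \<ge> 0" "norm z \<le> r"
  shows "norm (phat2 lam n z) \<le> rising_coeff (2 * lam + 1) n * ((real n)\<^sup>2 * r ^ (n - 2))"
  unfolding phat2_def using norm_mon2_le[OF assms(2)] by (intro norm_phat_sum_le assms) fastforce

lemma phat1_0 [simp]: "phat1 lam 0 z = 0"
  by (intro blinfun_eqI) (simp add: phat1_def blinfun.scaleR_left mon1_apply)

text \<open>
  Differentiating lowers the degree: the derivative in \<open>cnj z\<close> is \<open>\<lambda> psi\<close>, and the derivative along the
  real direction is \<open>(n + 2 \<lambda>)\<close> times the previous polynomial.
\<close>

lemma phat1_Suc_apply:
  "phat1 lam (Suc m) z h = of_real lam * psi lam m z * cnj h +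
     (of_real (real (Suc m) + 2 * lam) * phat lam m z - of_real lam * psi lam m z) * h"
proof -
  have zbar: "(\<Sum>j\<le>Suc m. of_real (rising_coeff lam j * rising_coeff (lam + 1) (Suc m - j)) * (of_nat j * mon (j - 1) (Suc m - j) z))
     = of_real lam * psi lam m z" (is "?A = _")
  proof -
    have "?A = (\<Sum>j\<le>m. of_real (rising_coeff lam (Suc j) * rising_coeff (lam + 1) (m - j)) * (of_nat (Suc j) * mon j (m - j) z))"
      unfolding sum.atMost_Suc_shift by simp
    also have "\<dots> = (\<Sum>j\<le>m. of_real ((real (Suc j) * rising_coeff lam (Suc j)) * rising_coeff (lam + 1) (m - j)) * mon j (m - j) z)"
      by (intro sum.cong refl) (simp add: mult_ac)
    also have "\<dots> = of_real lam * psi lam m z"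
      unfolding psi_def sum_distrib_left rising_coeff_Suc rising_coeff_shift[symmetric]
      by (intro sum.cong refl) (simp add: mult_ac)
    finally show ?thesis .
  qed
  have coeff: "rising_coeff lam j * (real (Suc k) * rising_coeff (lam + 1) (Suc k)) =
     (real (Suc (j + k)) + 2 * lam) * (rising_coeff lam j * rising_coeff (lam + 1) k)
       - lam * (rising_coeff (lam + 1) j * rising_coeff (lam + 1) k)" for j k
  proof -
    have "lam * (rising_coeff (lam + 1) j * rising_coeff (lam + 1) k) = (lam + real j) * rising_coeff lam j * rising_coeff (lam + 1) k"
      unfolding mult.assoc[symmetric] rising_coeff_shift ..
    then show ?thesis
      unfolding rising_coeff_Suc by (simp add: algebra_simps)
  qed
  have z: "(\<Sum>j\<le>Suc m. of_real (rising_coeff lam j * rising_coeff (lam + 1) (Suc m - j)) * (of_nat (Suc m - j) * mon j (Suc m - j - 1) z))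
     = of_real (real (Suc m) + 2 * lam) * phat lam m z - of_real lam * psi lam m z" (is "?B = _")
  proof -
    have "?B = (\<Sum>j\<le>m. of_real (rising_coeff lam j * (real (Suc (m - j)) * rising_coeff (lam + 1) (Suc (m - j)))) * mon j (m - j) z)"
      unfolding sum.atMost_Suc by (simp, intro sum.cong refl) (simp add: Suc_diff_le mult_ac)
    also have "\<dots> = (\<Sum>j\<le>m. of_real (real (Suc m) + 2 * lam) * (of_real (rising_coeff lam j * rising_coeff (lam + 1) (m - j)) * mon j (m - j) z)
         - of_real lam * (of_real (rising_coeff (lam + 1) j * rising_coeff (lam + 1) (m - j)) * mon j (m - j) z))"
      unfolding coeff by (intro sum.cong refl) (simp add: algebra_simps)
    also have "\<dots> = of_real (real (Suc m) + 2 * lam) * phat lam m z - of_real lam * psi lam m z"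
      unfolding sum_subtractf phat_def psi_def sum_distrib_left ..
    finally show ?thesis .
  qed
  have "phat1 lam (Suc m) z h = ?A * cnj h + ?B * h"
    unfolding sum_distrib_right sum.distrib[symmetric] phat1_def blinfun.sum_left
    by (intro sum.cong refl) (simp add: blinfun.scaleR_left mon1_apply scaleR_conv_of_real algebra_simps)
  then show ?thesis
    unfolding zbar z .
qed

lemma phat1_Euler: "phat1 lam n z z = of_nat n * phat lam n z"
proof -
  have "mon1 j k z z = of_nat (j + k) * mon j k z" for j k
    by (cases j; cases k) (simp_all add: mon1_apply mon_def algebra_simps)
  then show ?thesis
    unfolding phat1_def phat_def blinfun.sum_left sum_distrib_left
    by (intro sum.cong refl) (simp add: blinfun.scaleR_left scaleR_conv_of_real mult_ac)
qed

text \<open>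
  This combines Euler's relation for homogeneous functions with the formula for the derivative.
\<close>

lemma z_times_phat:
  "of_real (real (Suc m) + 2 * lam) * (z * phat lam m z) =
     of_nat (Suc m) * phat lam (Suc m) z + of_real lam * (z - cnj z) * psi lam m z"
  using phat1_Euler[of lam "Suc m" z] unfolding phat1_Suc_apply by (simp add: algebra_simps)

lemma phat1_D_zbar:
  "(z - cnj z) * (phat1 lam n z 1 + \<i> * phat1 lam n z \<i>) = 2 * of_real lam * (phat lam n z - phat lam n (cnj z))"
proof (cases n)
  case (Suc m)
  have "phat1 lam n z 1 + \<i> * phat1 lam n z \<i> = 2 * of_real lam * psi lam m z"
    unfolding Suc phat1_Suc_apply by (simp add: algebra_simps)
  then show ?thesis
    unfolding Suc phat_reflect_diff by simp
qed simp

text \<open>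
  Termwise differentiation under a Weierstrass majorant, phrased with derivatives as bounded linear maps so
  that it can be applied to a series of derivatives again.
\<close>

lemma has_derivative_suminf:
  fixes g :: "nat \<Rightarrow> complex \<Rightarrow> 'b::banach" and g1 :: "nat \<Rightarrow> complex \<Rightarrow> (complex \<Rightarrow>\<^sub>L 'b)"
  assumes der: "\<And>n z. (g n has_derivative blinfun_apply (g1 n z)) (at z)"
    and M: "summable M" "\<And>n z. norm z \<le> r \<Longrightarrow> norm (g n z) \<le> M n" "\<And>n z. norm z \<le> r \<Longrightarrow> norm (g1 n z) \<le> M n"
    and z: "norm z < r"
  shows "((\<lambda>z. \<Sum>n. g n z) has_derivative blinfun_apply (\<Sum>n. g1 n z)) (at z)"
proof -
  let ?S = "ball (0::complex) r"
  have z: "z \<in> ?S"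
    using z by simp
  have lim: "uniform_limit ?S (\<lambda>n x. \<Sum>i<n. g1 i x) (\<lambda>x. suminf (\<lambda>i. g1 i x)) sequentially"
    using M by (intro Weierstrass_m_test) auto
  have sm: "summable (\<lambda>n. g n x)" if "x \<in> ?S" for x
    using M that by (intro summable_comparison_test'[OF M(1)]) auto
  have "\<exists>h. \<forall>x\<in>?S. (\<lambda>n. g n x) sums h x \<and> (h has_derivative blinfun_apply (suminf (\<lambda>i. g1 i x))) (at x within ?S)"
  proof (rule has_derivative_series)
    show "(g n has_derivative blinfun_apply (g1 n x)) (at x within ?S)" for n x
      by (rule has_derivative_at_withinI[OF der])
    fix e :: real assume "e > 0"
    from lim this have "\<forall>\<^sub>F n in sequentially. \<forall>x\<in>?S. dist (\<Sum>i<n. g1 i x) (suminf (\<lambda>i. g1 i x)) < e"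
      unfolding uniform_limit_iff by blast
    then show "\<forall>\<^sub>F n in sequentially. \<forall>x\<in>?S. \<forall>h. norm ((\<Sum>i<n. g1 i x h) - suminf (\<lambda>i. g1 i x) h) \<le> e * norm h"
    proof eventually_elim
      case (elim n)
      show ?case
      proof (intro ballI allI)
        fix x h assume x: "x \<in> ?S"
        have "(\<Sum>i<n. g1 i x h) - suminf (\<lambda>i. g1 i x) h = ((\<Sum>i<n. g1 i x) - suminf (\<lambda>i. g1 i x)) h"
          by (simp add: blinfun.diff_left blinfun.sum_left)
        then have "norm ((\<Sum>i<n. g1 i x h) - suminf (\<lambda>i. g1 i x) h) \<le> norm ((\<Sum>i<n. g1 i x) - suminf (\<lambda>i. g1 i x)) * norm h"
          by (simp only: norm_blinfun)
        also have "\<dots> \<le> e * norm h"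
          using elim x by (intro mult_right_mono) (auto simp: dist_norm less_imp_le)
        finally show "norm ((\<Sum>i<n. g1 i x h) - suminf (\<lambda>i. g1 i x) h) \<le> e * norm h" .
      qed
    qed
  next
    show "(\<lambda>n. g n z) sums (\<Sum>n. g n z)"
      using sm[OF z] by (rule summable_sums)
  qed (use z in auto)
  then obtain h where h: "\<And>x. x \<in> ?S \<Longrightarrow> (\<lambda>n. g n x) sums h x"
    "\<And>x. x \<in> ?S \<Longrightarrow> (h has_derivative blinfun_apply (suminf (\<lambda>i. g1 i x))) (at x within ?S)"
    by blast
  have "(h has_derivative blinfun_apply (suminf (\<lambda>i. g1 i z))) (at z)"
    using h(2)[OF z] at_within_open[OF z open_ball] by simp
  then show ?thesis
    by (rule has_derivative_transform_within_open[of _ _ _ _ ?S]) (use z h(1) in \<open>auto simp: sums_iff\<close>)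
qed

lemma radius_between:
  fixes z :: complex
  assumes "z \<in> unit_disk"
  shows "\<exists>r. 0 < r \<and> r < 1 \<and> norm z < r"
proof -
  obtain r where "norm z < r" "r < 1"
    using dense[of "norm z" 1] assms by auto
  moreover from this have "0 < r"
    using norm_ge_zero[of z] by linarith
  ultimately show ?thesis
    by blast
qed

lemma C2_on_series:
  fixes f :: "nat \<Rightarrow> complex \<Rightarrow> 'b::banach" and f1 :: "nat \<Rightarrow> complex \<Rightarrow> (complex \<Rightarrow>\<^sub>L 'b)"
    and f2 :: "nat \<Rightarrow> complex \<Rightarrow> (complex \<Rightarrow>\<^sub>L (complex \<Rightarrow>\<^sub>L 'b))"
  assumes der1: "\<And>n z. (f n has_derivative blinfun_apply (f1 n z)) (at z)"
    and der2: "\<And>n z. (f1 n has_derivative blinfun_apply (f2 n z)) (at z)"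
    and cont: "\<And>n S. continuous_on S (f2 n)"
    and bound: "\<And>r. 0 < r \<Longrightarrow> r < 1 \<Longrightarrow> \<exists>M. summable M \<and> (\<forall>n z. norm z \<le> r \<longrightarrow>
        norm (f n z) \<le> M n \<and> norm (f1 n z) \<le> M n \<and> norm (f2 n z) \<le> M n)"
  shows "C2_on (\<lambda>z. \<Sum>n. f n z) unit_disk"
    and "\<And>z. z \<in> unit_disk \<Longrightarrow> ((\<lambda>z. \<Sum>n. f n z) has_derivative blinfun_apply (\<Sum>n. f1 n z)) (at z)"
proof -
  show d1: "((\<lambda>z. \<Sum>n. f n z) has_derivative blinfun_apply (\<Sum>n. f1 n z)) (at z)" if zd: "z \<in> unit_disk" for z
  proof -
    obtain r where r: "0 < r" "r < 1" "norm z < r"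
      using radius_between[OF zd] by blast
    obtain M where "summable M" "\<forall>n z. norm z \<le> r \<longrightarrow>
        norm (f n z) \<le> M n \<and> norm (f1 n z) \<le> M n \<and> norm (f2 n z) \<le> M n"
      using bound r by blast
    then show ?thesis
      using r by (intro has_derivative_suminf[OF der1]) auto
  qed
  have d2: "((\<lambda>z. \<Sum>n. f1 n z) has_derivative blinfun_apply (\<Sum>n. f2 n z)) (at z)" if zd: "z \<in> unit_disk" for z
  proof -
    obtain r where r: "0 < r" "r < 1" "norm z < r"
      using radius_between[OF zd] by blast
    obtain M where "summable M" "\<forall>n z. norm z \<le> r \<longrightarrow>
        norm (f n z) \<le> M n \<and> norm (f1 n z) \<le> M n \<and> norm (f2 n z) \<le> M n"
      using bound r by blast
    then show ?thesis
      using r by (intro has_derivative_suminf[OF der2]) auto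
  qed
  have "isCont (\<lambda>z. \<Sum>n. f2 n z) z" if zd: "z \<in> unit_disk" for z
  proof -
    obtain r where r: "0 < r" "r < 1" "norm z < r"
      using radius_between[OF zd] by blast
    obtain M where M: "summable M" "\<forall>n z. norm z \<le> r \<longrightarrow>
        norm (f n z) \<le> M n \<and> norm (f1 n z) \<le> M n \<and> norm (f2 n z) \<le> M n"
      using bound r by blast
    have "uniform_limit (ball 0 r) (\<lambda>n x. \<Sum>i<n. f2 i x) (\<lambda>x. suminf (\<lambda>i. f2 i x)) sequentially"
      using M by (intro Weierstrass_m_test) auto
    then have "continuous_on (ball 0 r) (\<lambda>x. suminf (\<lambda>i. f2 i x))"
      by (rule uniform_limit_theorem[rotated]) (auto intro!: always_eventually continuous_on_sum cont)
    then show ?thesis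
      using r by (simp add: continuous_on_eq_continuous_at)
  qed
  then have "continuous_on unit_disk (\<lambda>z. \<Sum>n. f2 n z)"
    by (intro continuous_at_imp_continuous_on) auto
  then show "C2_on (\<lambda>z. \<Sum>n. f n z) unit_disk"
    unfolding C2_on_def
    by (intro exI[of _ "\<lambda>z. \<Sum>n. f1 n z"] exI[of _ "\<lambda>z. \<Sum>n. f2 n z"] conjI ballI d1 d2)
qed

text \<open>
  With \<open>B\<^sub>n = rising_coeff (2 * lam + 1) n\<close>, the maximum of \<open>|phat lam n|\<close> on the closed disk, this is the
  square of \<open>B\<^sub>n\<close> divided by the squared \<open>L\<^sup>2\<close> norm of \<open>phat lam n\<close>. Estimates of the form
  \<open>|c\<^sub>n| B\<^sub>n \<le> C weight_bound lam n\<close> are what orthogonality yields for coefficients, and they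
  suffice for convergence inside the disk since the growth in \<open>n\<close> is polynomial.
\<close>

definition weight_bound :: "real \<Rightarrow> nat \<Rightarrow> real" where
  "weight_bound lam n = rising_coeff (2 * lam + 1) n * (real n + lam + 1) / (lam + 1)"

lemma weight_bound_summable:
  assumes lam: "lam \<ge> 0" and r: "0 < r" "r < 1"
  shows "summable (\<lambda>n. weight_bound lam n * (real n + 1)\<^sup>2 * r ^ n)"
proof -
  let ?f = "\<lambda>n. weight_bound lam n * (real n + 1)\<^sup>2"
  have pos: "?f n > 0" for n
    using lam rising_coeff_pos[of "2 * lam + 1" n] by (simp add: weight_bound_def)
  have cancel: "(a * p / q * s) / (u * a / v * p' / q * s') = v * p * s / (u * p' * s')"
    if "a \<noteq> 0" "q \<noteq> 0" "v \<noteq> 0" for a p q s u v p' s' :: real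
    using that by (simp add: divide_simps)
  have "norm (?f n) / norm (?f (Suc n)) =
      (real n + 1) * (real n + lam + 1) * (real n + 1)\<^sup>2 /
       ((2 * lam + 1 + real n) * (real n + lam + 2) * (real n + 2)\<^sup>2)" for n
  proof -
    have "rising_coeff (2 * lam + 1) (Suc n) = (2 * lam + 1 + real n) * rising_coeff (2 * lam + 1) n / (real n + 1)"
      using rising_coeff_Suc[of n "2 * lam + 1"] by (simp add: field_simps)
    then have "?f n / ?f (Suc n) = (rising_coeff (2 * lam + 1) n * (real n + lam + 1) / (lam + 1) * (real n + 1)\<^sup>2) /
       ((2 * lam + 1 + real n) * rising_coeff (2 * lam + 1) n / (real n + 1) * (real n + lam + 2) / (lam + 1) * (real n + 2)\<^sup>2)"
      by (simp add: weight_bound_def algebra_simps)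
    also have "\<dots> = (real n + 1) * (real n + lam + 1) * (real n + 1)\<^sup>2 /
       ((2 * lam + 1 + real n) * (real n + lam + 2) * (real n + 2)\<^sup>2)"
      by (rule cancel) (use lam rising_coeff_pos[of "2 * lam + 1" n] in auto)
    finally show ?thesis
      using pos[of n] pos[of "Suc n"] by simp
  qed
  moreover have "(\<lambda>n. (real n + 1) * (real n + lam + 1) * (real n + 1)\<^sup>2 /
       ((2 * lam + 1 + real n) * (real n + lam + 2) * (real n + 2)\<^sup>2)) \<longlonglongrightarrow> 1"
    by real_asymp
  ultimately have "(\<lambda>n. norm (?f n) / norm (?f (Suc n))) \<longlonglongrightarrow> 1"
    by simp
  then have "conv_radius ?f = 1"
    by (intro conv_radius_ratio_limit_nonzero) (auto simp: one_ereal_def)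
  then show ?thesis
    using r by (intro summable_in_conv_radius) auto
qed

section \<open>Series in the polynomials \<open>\<phi>\<^sub>n\<close>\<close>

lemma power_diff_le_power_over_square:
  fixes r :: real
  assumes "0 < r" "r < 1" "k \<le> 2"
  shows "r ^ (n - k) \<le> r ^ n / r\<^sup>2"
proof -
  have "r ^ (n - k) * r\<^sup>2 = r ^ (n - k + 2)"
    by (simp only: power_add)
  also have "\<dots> \<le> r ^ n"
    using assms by (intro power_decreasing) auto
  finally show ?thesis
    using assms by (simp add: field_simps)
qed

lemma weight_bound_pos: "lam \<ge> 0 \<Longrightarrow> weight_bound lam n > 0"
  using rising_coeff_pos[of "2 * lam + 1" n] by (simp add: weight_bound_def)

lemma phat_term_le:
  assumes lam: "lam \<ge> 0" and r: "0 < r" and z: "norm z \<le> r"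
    and c: "norm c * rising_coeff (2 * lam + 1) n \<le> e * weight_bound lam n"
  shows "norm (c * phat lam n z) \<le> e * (weight_bound lam n * (real n + 1)\<^sup>2 * r ^ n)"
proof -
  have e: "0 \<le> e"
  proof -
    have "0 \<le> norm c * rising_coeff (2 * lam + 1) n"
      using lam by (simp add: rising_coeff_nonneg)
    then have "0 \<le> e * weight_bound lam n"
      using c by linarith
    then show ?thesis
      using weight_bound_pos[OF lam, of n] by (simp add: zero_le_mult_iff)
  qed
  have "norm (c * phat lam n z) \<le> norm c * (rising_coeff (2 * lam + 1) n * norm z ^ n)"
    unfolding norm_mult by (intro mult_left_mono norm_phat_le lam) auto
  also have "\<dots> \<le> norm c * (rising_coeff (2 * lam + 1) n * r ^ n)"
    using lam z by (intro mult_left_mono power_mono) (auto simp: rising_coeff_nonneg)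
  also have "\<dots> \<le> (e * weight_bound lam n) * r ^ n"
    using mult_right_mono[OF c, of "r ^ n"] r by (simp add: mult.assoc)
  also have "\<dots> \<le> (e * weight_bound lam n) * ((real n + 1)\<^sup>2 * r ^ n)"
  proof (intro mult_left_mono)
    have "1 * r ^ n \<le> (real n + 1)\<^sup>2 * r ^ n"
      using r by (intro mult_right_mono) auto
    then show "r ^ n \<le> (real n + 1)\<^sup>2 * r ^ n"
      by simp
  qed (use e weight_bound_pos[OF lam, of n] in auto)
  finally show ?thesis
    by (simp add: mult_ac)
qed

lemma phat_series:
  assumes lam: "lam \<ge> 0"
    and c: "\<And>n. norm (c n) * rising_coeff (2 * lam + 1) n \<le> C * weight_bound lam n"
  shows lambda_analytic_phat_series: "lambda_analytic lam (\<lambda>z. \<Sum>n. c n * phat lam n z)"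
    and summable_phat_series: "\<And>z. z \<in> unit_disk \<Longrightarrow> summable (\<lambda>n. c n * phat lam n z)"
proof -
  define f where "f n z = c n * phat lam n z" for n z
  define f1 where "f1 n z = mult_blinfun (c n) o\<^sub>L phat1 lam n z" for n z
  \<comment> \<open>Multiplication by \<open>c\<close>, acting on derivatives.\<close>
  define K where "K c = Blinfun (\<lambda>X :: complex \<Rightarrow>\<^sub>L complex. mult_blinfun c o\<^sub>L X)" for c
  have K_apply: "K c X = mult_blinfun c o\<^sub>L X" for c X
  proof -
    have "bounded_linear (\<lambda>X :: complex \<Rightarrow>\<^sub>L complex. mult_blinfun c o\<^sub>L X)"
      by (intro bounded_linear_intros)
    then show ?thesis
      unfolding K_def by (simp add: bounded_linear_Blinfun_apply)
  qed
  have mult_le: "norm (mult_blinfun a o\<^sub>L X) \<le> norm a * norm X" for a and X :: "complex \<Rightarrow>\<^sub>L complex"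
    using norm_blinfun_compose[of "mult_blinfun a" X] norm_mult_blinfun_apply_le[of a]
    by (meson mult_right_mono norm_ge_zero order_trans)
  have norm_K: "norm (K a) \<le> norm a" for a
    by (rule norm_blinfun_bound) (simp_all add: K_apply mult_le)
  define f2 where "f2 n z = K (c n) o\<^sub>L phat2 lam n z" for n z
  have der1: "(f n has_derivative blinfun_apply (f1 n z)) (at z)" for n z
  proof -
    have "((\<lambda>z. c n * phat lam n z) has_derivative (\<lambda>h. c n * phat1 lam n z h)) (at z)"
      by (intro has_derivative_mult_right has_derivative_phat)
    then show ?thesis
      unfolding f_def[abs_def] by (rule has_derivative_eq_rhs) (simp add: f1_def fun_eq_iff)
  qed
  have der2: "(f1 n has_derivative blinfun_apply (f2 n z)) (at z)" for n z
  proof -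
    have "((\<lambda>z. K (c n) (phat1 lam n z)) has_derivative (\<lambda>h. K (c n) (phat2 lam n z h))) (at z)"
      by (intro bounded_linear.has_derivative[OF blinfun.bounded_linear_right] has_derivative_phat1)
    then show ?thesis
      unfolding f1_def[abs_def] K_apply[symmetric]
      by (rule has_derivative_eq_rhs) (simp add: f2_def fun_eq_iff)
  qed
  have cont: "continuous_on S (f2 n)" for n S
    unfolding f2_def[abs_def] by (intro continuous_intros continuous_on_phat2)
  have C: "0 \<le> C"
  proof -
    have "0 \<le> C * weight_bound lam 0"
      using c[of 0] by (simp add: order_trans[OF norm_ge_zero])
    then show ?thesis
      using weight_bound_pos[OF lam, of 0] by (simp add: zero_le_mult_iff)
  qed
  have bound: "\<exists>M. summable M \<and> (\<forall>n z. norm z \<le> r \<longrightarrow>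
        norm (f n z) \<le> M n \<and> norm (f1 n z) \<le> M n \<and> norm (f2 n z) \<le> M n)"
    if r: "0 < r" "r < 1" for r
  proof -
    \<comment> \<open>Two derivatives lower the exponent of \<open>r\<close> by at most 2 and bring down at most two factors \<open>n\<close>.\<close>
    let ?M = "\<lambda>n. C / r\<^sup>2 * (weight_bound lam n * (real n + 1)\<^sup>2 * r ^ n)"
    have main: "norm (c n) * (rising_coeff (2 * lam + 1) n * (s * r ^ (n - k))) \<le> ?M n"
      if "0 \<le> s" "s \<le> (real n + 1)\<^sup>2" "k \<le> 2" for n k s
    proof -
      have "norm (c n) * (rising_coeff (2 * lam + 1) n * (s * r ^ (n - k)))
          = (norm (c n) * rising_coeff (2 * lam + 1) n) * (s * r ^ (n - k))"
        by simp
      also have "\<dots> \<le> (C * weight_bound lam n) * ((real n + 1)\<^sup>2 * (r ^ n / r\<^sup>2))"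
        using that r C weight_bound_pos[OF lam, of n]
        by (intro mult_mono c power_diff_le_power_over_square) auto
      finally show ?thesis
        by (simp add: field_simps)
    qed
    have n_le: "real n \<le> (real n + 1)\<^sup>2" for n
    proof -
      have "(real n + 1)\<^sup>2 - real n = (real n)\<^sup>2 + real n + 1"
        by (simp add: power2_eq_square algebra_simps)
      also have "\<dots> \<ge> 0"
        by simp
      finally show ?thesis
        by simp
    qed
    have "norm (f n z) \<le> ?M n \<and> norm (f1 n z) \<le> ?M n \<and> norm (f2 n z) \<le> ?M n"
      if z: "norm z \<le> r" for n z
    proof (intro conjI)
      have "norm (f n z) \<le> norm (c n) * (rising_coeff (2 * lam + 1) n * norm z ^ n)"
        unfolding norm_mult f_def by (intro mult_left_mono norm_phat_le lam) auto
      also have "\<dots> \<le> norm (c n) * (rising_coeff (2 * lam + 1) n * (1 * r ^ (n - 0)))"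
        using lam z by (simp, intro mult_left_mono power_mono) (auto simp: rising_coeff_nonneg)
      also have "\<dots> \<le> ?M n"
        by (rule main) auto
      finally show "norm (f n z) \<le> ?M n" .
      have "norm (f1 n z) \<le> norm (c n) * (rising_coeff (2 * lam + 1) n * (real n * r ^ (n - 1)))"
        unfolding f1_def using mult_le norm_phat1_le[OF lam z]
        by (meson mult_left_mono norm_ge_zero order_trans)
      also have "\<dots> \<le> ?M n"
        by (rule main) (auto simp: n_le)
      finally show "norm (f1 n z) \<le> ?M n" .
      have "norm (f2 n z) \<le> norm (K (c n)) * norm (phat2 lam n z)"
        unfolding f2_def by (rule norm_blinfun_compose)
      also have "\<dots> \<le> norm (c n) * (rising_coeff (2 * lam + 1) n * ((real n)\<^sup>2 * r ^ (n - 2)))"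
        by (intro mult_mono norm_K norm_phat2_le[OF lam z]) auto
      also have "\<dots> \<le> ?M n"
        by (rule main) (auto simp: power_mono)
      finally show "norm (f2 n z) \<le> ?M n" .
    qed
    moreover have "summable ?M"
      by (intro summable_mult weight_bound_summable lam r)
    ultimately show ?thesis
      by blast
  qed
  have sm: "summable (\<lambda>n. f n z)" "summable (\<lambda>n. f1 n z)" if z: "z \<in> unit_disk" for z
  proof -
    obtain r where r: "0 < r" "r < 1" "norm z < r"
      using radius_between[OF z] by blast
    obtain M where M: "summable M" "\<forall>n z. norm z \<le> r \<longrightarrow>
        norm (f n z) \<le> M n \<and> norm (f1 n z) \<le> M n \<and> norm (f2 n z) \<le> M n"
      using bound[OF r(1,2)] by (rule exE) (rule that, blast+)
    have "norm (f n z) \<le> M n" "norm (f1 n z) \<le> M n" for n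
      using M(2) r(3) by auto
    then show "summable (\<lambda>n. f n z)" "summable (\<lambda>n. f1 n z)"
      by (auto intro: summable_comparison_test'[OF M(1)])
  qed
  show "summable (\<lambda>n. c n * phat lam n z)" if "z \<in> unit_disk" for z
    using sm(1)[OF that] by (simp add: f_def)
  have "lambda_analytic lam (\<lambda>z. \<Sum>n. f n z)"
  proof (rule lambda_analyticI)
    show "C2_on (\<lambda>z. \<Sum>n. f n z) unit_disk"
      by (rule C2_on_series(1)[OF der1 der2 cont bound])
    fix z :: complex assume z: "z \<in> unit_disk" "Im z \<noteq> 0"
    have s: "(\<lambda>n. f n z) sums (\<Sum>n. f n z)" "(\<lambda>n. f n (cnj z)) sums (\<Sum>n. f n (cnj z))"
      using sm(1)[of z] sm(1)[of "cnj z"] z by (auto intro: summable_sums)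
    have s1: "(\<lambda>n. f1 n z h) sums ((\<Sum>n. f1 n z) h)" for h
      using bounded_linear.sums[OF blinfun.bounded_linear_left summable_sums[OF sm(2)[OF z(1)]]] .
    have "(\<lambda>n. (z - cnj z) * (f1 n z 1 + \<i> * f1 n z \<i>)) sums ((z - cnj z) * ((\<Sum>n. f1 n z) 1 + \<i> * (\<Sum>n. f1 n z) \<i>))"
      by (intro sums_mult sums_add s1)
    moreover have "(z - cnj z) * (f1 n z 1 + \<i> * f1 n z \<i>) = 2 * of_real lam * (f n z - f n (cnj z))" for n
    proof -
      have "(z - cnj z) * (f1 n z 1 + \<i> * f1 n z \<i>) = c n * ((z - cnj z) * (phat1 lam n z 1 + \<i> * phat1 lam n z \<i>))"
        by (simp add: f1_def algebra_simps)
      then show ?thesis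
        unfolding phat1_D_zbar by (simp add: f_def algebra_simps)
    qed
    ultimately have "(\<lambda>n. 2 * of_real lam * (f n z - f n (cnj z))) sums ((z - cnj z) * ((\<Sum>n. f1 n z) 1 + \<i> * (\<Sum>n. f1 n z) \<i>))"
      by simp
    moreover have "(\<lambda>n. 2 * of_real lam * (f n z - f n (cnj z))) sums (2 * of_real lam * ((\<Sum>n. f n z) - (\<Sum>n. f n (cnj z))))"
      by (intro sums_mult sums_diff s)
    ultimately have "(z - cnj z) * ((\<Sum>n. f1 n z) 1 + \<i> * (\<Sum>n. f1 n z) \<i>) = 2 * of_real lam * ((\<Sum>n. f n z) - (\<Sum>n. f n (cnj z)))"
      by (rule sums_unique2)
    then show "\<exists>f'. ((\<lambda>z. \<Sum>n. f n z) has_derivative f') (at z) \<and>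
        (z - cnj z) * (f' 1 + \<i> * f' \<i>) = 2 * of_real lam * ((\<Sum>n. f n z) - (\<Sum>n. f n (cnj z)))"
      using C2_on_series(2)[OF der1 der2 cont bound z(1)] by blast
  qed
  then show "lambda_analytic lam (\<lambda>z. \<Sum>n. c n * phat lam n z)"
    by (simp add: f_def)
qed

lemma finite_coeff_bound:
  fixes c :: "nat \<Rightarrow> complex"
  assumes lam: "lam \<ge> 0" and c: "\<And>n. n \<ge> N \<Longrightarrow> c n = 0"
  shows "\<exists>C. \<forall>n. norm (c n) * rising_coeff (2 * lam + 1) n \<le> C * weight_bound lam n"
proof (intro exI allI)
  let ?q = "\<lambda>n. norm (c n) * rising_coeff (2 * lam + 1) n / weight_bound lam n"
  fix n
  have q: "?q n \<ge> 0" for n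
    using weight_bound_pos[OF lam, of n] lam by (simp add: rising_coeff_nonneg)
  have "?q n \<le> (\<Sum>m<N. ?q m)"
  proof (cases "n < N")
    case True
    then show ?thesis
      by (intro member_le_sum) (use q in auto)
  next
    case False
    then have zero: "?q n = 0"
      using c by simp
    show ?thesis
      unfolding zero by (intro sum_nonneg q)
  qed
  then show "norm (c n) * rising_coeff (2 * lam + 1) n \<le> (\<Sum>m<N. ?q m) * weight_bound lam n"
    using weight_bound_pos[OF lam, of n] by (simp add: pos_divide_le_eq)
qed

lemma suminf_phat_finite:
  assumes "\<And>n. n \<ge> N \<Longrightarrow> c n = 0"
  shows "(\<Sum>n. c n * phat lam n z) = (\<Sum>n<N. c n * phat lam n z)"
  using assms by (intro suminf_finite) auto

lemma lambda_analytic_phat_sum: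
  assumes lam: "lam \<ge> 0"
  shows "lambda_analytic lam (\<lambda>z. \<Sum>n<N. c n * phat lam n z)"
proof -
  define c' where "c' n = (if n < N then c n else 0)" for n
  have "\<exists>C. \<forall>n. norm (c' n) * rising_coeff (2 * lam + 1) n \<le> C * weight_bound lam n"
    by (rule finite_coeff_bound[OF lam, of N]) (simp add: c'_def)
  then have "lambda_analytic lam (\<lambda>z. \<Sum>n. c' n * phat lam n z)"
    using lambda_analytic_phat_series[OF lam] by blast
  moreover have "(\<Sum>n. c' n * phat lam n z) = (\<Sum>n<N. c n * phat lam n z)" for z
    by (subst suminf_phat_finite[of N]) (auto simp: c'_def)
  ultimately show ?thesis
    by simp
qed

text \<open>
  Coefficients that are Cauchy uniformly in \<open>n\<close>, relative to \<open>weight_bound\<close>, have limits with the same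
  growth. The series with the limit coefficients is \<open>\<lambda>\<close>-analytic, and \<open>phat_term_le\<close> compares it with the
  given polynomials on smaller disks.
\<close>

lemma phat_polynomials_limit:
  fixes c :: "nat \<Rightarrow> nat \<Rightarrow> complex"
  assumes lam: "lam \<ge> 0" and fin: "\<And>k n. n \<ge> N k \<Longrightarrow> c k n = 0"
    and cauchy: "\<And>e. e > 0 \<Longrightarrow> \<exists>K. \<forall>k\<ge>K. \<forall>l\<ge>K. \<forall>n.
        norm (c k n - c l n) * rising_coeff (2 * lam + 1) n \<le> e * weight_bound lam n"
  shows "\<exists>F. lambda_analytic lam F \<and> (\<forall>r. 0 < r \<longrightarrow> r < 1 \<longrightarrow>
     uniform_limit (cball 0 r) (\<lambda>k z. \<Sum>n<N k. c k n * phat lam n z) F sequentially)"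
proof -
  let ?B = "\<lambda>n. rising_coeff (2 * lam + 1) n"
  have B: "?B n > 0" for n
    using lam by (simp add: rising_coeff_pos)
  have "Cauchy (\<lambda>k. c k n)" for n
  proof (rule metric_CauchyI)
    fix e :: real assume e: "e > 0"
    define e' where "e' = e / 2 * ?B n / weight_bound lam n"
    have "e' > 0"
      using e B weight_bound_pos[OF lam] by (simp add: e'_def)
    then obtain K where K: "\<forall>k\<ge>K. \<forall>l\<ge>K. \<forall>n. norm (c k n - c l n) * ?B n \<le> e' * weight_bound lam n"
      using cauchy by blast
    have "e' * weight_bound lam n = e / 2 * ?B n"
      using weight_bound_pos[OF lam, of n] by (simp add: e'_def)
    then have "norm (c k n - c l n) * ?B n \<le> e / 2 * ?B n" if "k \<ge> K" "l \<ge> K" for k l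
      using K that by metis
    then have "norm (c k n - c l n) \<le> e / 2" if "k \<ge> K" "l \<ge> K" for k l
      using that B by (meson mult_le_cancel_right_pos)
    then have "dist (c k n) (c l n) < e" if "k \<ge> K" "l \<ge> K" for k l
      using that e by (fastforce simp: dist_norm)
    then show "\<exists>M. \<forall>m\<ge>M. \<forall>na\<ge>M. dist (c m n) (c na n) < e"
      by blast
  qed
  then have "\<forall>n. \<exists>l. (\<lambda>k. c k n) \<longlonglongrightarrow> l"
    using Cauchy_convergent unfolding convergent_def by blast
  then obtain d where d: "\<And>n. (\<lambda>k. c k n) \<longlonglongrightarrow> d n"
    using choice[of "\<lambda>n l. (\<lambda>k. c k n) \<longlonglongrightarrow> l"] by blast
  have close: "\<exists>K. \<forall>k\<ge>K. \<forall>n. norm (c k n - d n) * ?B n \<le> e * weight_bound lam n" if e: "e > 0" for e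
  proof -
    obtain K where K: "\<forall>k\<ge>K. \<forall>l\<ge>K. \<forall>n. norm (c k n - c l n) * ?B n \<le> e * weight_bound lam n"
      using cauchy[OF e] by blast
    have "norm (c k n - d n) * ?B n \<le> e * weight_bound lam n" if "k \<ge> K" for k n
    proof (rule LIMSEQ_le_const2)
      show "(\<lambda>l. norm (c k n - c l n) * ?B n) \<longlonglongrightarrow> norm (c k n - d n) * ?B n"
        by (intro tendsto_intros d)
      show "\<exists>N. \<forall>l\<ge>N. norm (c k n - c l n) * ?B n \<le> e * weight_bound lam n"
        using K that by blast
    qed
    then show ?thesis
      by blast
  qed
  obtain C where C: "\<And>n. norm (d n) * ?B n \<le> C * weight_bound lam n"
  proof -
    obtain K where K: "\<And>n. norm (c K n - d n) * ?B n \<le> 1 * weight_bound lam n"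
      using close[of 1] by auto
    obtain C where C: "\<And>n. norm (c K n) * ?B n \<le> C * weight_bound lam n"
      using finite_coeff_bound[OF lam, of "N K" "c K"] fin by blast
    have "norm (d n) * ?B n \<le> (C + 1) * weight_bound lam n" for n
    proof -
      have "norm (d n) \<le> norm (c K n) + norm (c K n - d n)"
        by (metis norm_minus_commute norm_triangle_sub)
      then have "norm (d n) * ?B n \<le> (norm (c K n) + norm (c K n - d n)) * ?B n"
        using B by (intro mult_right_mono) (auto intro: less_imp_le)
      also have "\<dots> \<le> (C + 1) * weight_bound lam n"
        using K[of n] C[of n] by (simp add: distrib_right)
      finally show ?thesis .
    qed
    then show ?thesis
      using that by blast
  qed
  define F where "F z = (\<Sum>n. d n * phat lam n z)" for z
  have "lambda_analytic lam F"
    unfolding F_def[abs_def] by (rule lambda_analytic_phat_series[OF lam C])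
  moreover have "uniform_limit (cball 0 r) (\<lambda>k z. \<Sum>n<N k. c k n * phat lam n z) F sequentially"
    if r: "0 < r" "r < 1" for r
    unfolding uniform_limit_iff
  proof (intro allI impI)
    let ?M = "\<lambda>n. weight_bound lam n * (real n + 1)\<^sup>2 * r ^ n"
    have M: "summable ?M"
      by (rule weight_bound_summable[OF lam r])
    have S: "0 \<le> suminf ?M"
      using weight_bound_pos[OF lam] r by (intro suminf_nonneg M) (simp add: less_imp_le)
    fix e :: real assume e: "e > 0"
    \<comment> \<open>Adding 1 keeps the denominator positive.\<close>
    define e' where "e' = e / 2 / (suminf ?M + 1)"
    have e': "e' > 0"
      using e S by (simp add: e'_def)
    then obtain K where K: "\<forall>k\<ge>K. \<forall>n. norm (c k n - d n) * ?B n \<le> e' * weight_bound lam n"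
      using close by blast
    have "dist (\<Sum>n<N k. c k n * phat lam n z) (F z) < e" if k: "k \<ge> K" and z: "z \<in> cball 0 r" for k z
    proof -
      have zd: "z \<in> unit_disk" and zr: "norm z \<le> r"
        using z r by auto
      have "\<exists>C. \<forall>n. norm (c k n) * ?B n \<le> C * weight_bound lam n"
        by (rule finite_coeff_bound[OF lam]) (rule fin)
      then have s1: "summable (\<lambda>n. c k n * phat lam n z)"
        using summable_phat_series[OF lam _ zd] by blast
      have s2: "summable (\<lambda>n. d n * phat lam n z)"
        by (rule summable_phat_series[OF lam C zd])
      have le_term: "norm ((c k n - d n) * phat lam n z) \<le> e' * ?M n" for n
        using K k by (intro phat_term_le lam r zr) auto
      have s: "summable (\<lambda>n. norm ((c k n - d n) * phat lam n z))"
        using le_term by (intro summable_comparison_test'[OF summable_mult[OF M]]) auto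
      have "(\<Sum>n<N k. c k n * phat lam n z) = (\<Sum>n. c k n * phat lam n z)"
        by (intro suminf_phat_finite[symmetric] fin)
      then have "(\<Sum>n<N k. c k n * phat lam n z) - F z = (\<Sum>n. (c k n - d n) * phat lam n z)"
        using suminf_diff[OF s1 s2] by (simp add: F_def left_diff_distrib)
      then have "norm ((\<Sum>n<N k. c k n * phat lam n z) - F z) \<le> (\<Sum>n. norm ((c k n - d n) * phat lam n z))"
        using summable_norm[OF s] by simp
      also have "\<dots> \<le> (\<Sum>n. e' * ?M n)"
        by (intro suminf_le le_term s summable_mult M)
      also have "\<dots> = e' * suminf ?M"
        by (rule suminf_mult[OF M])
      also have "\<dots> \<le> e' * (suminf ?M + 1)"
        using e' by simp
      also have "\<dots> = e / 2"
      proof -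
        have cancel: "x / y * y = x" if "y \<noteq> 0" for x y :: real
          using that by simp
        have "suminf ?M + 1 \<noteq> 0"
          using S by linarith
        then show ?thesis
          unfolding e'_def by (rule cancel)
      qed
      also have "\<dots> < e"
        using e by simp
      finally show ?thesis
        by (simp add: dist_norm)
    qed
    then show "\<forall>\<^sub>F k in sequentially. \<forall>z\<in>cball 0 r. dist (\<Sum>n<N k. c k n * phat lam n z) (F z) < e"
      unfolding eventually_sequentially by blast
  qed
  ultimately show ?thesis
    by blast
qed

section \<open>The measure and its moments\<close>

definition weight :: "real \<Rightarrow> complex \<Rightarrow> real" where
  "weight lam z = c_lambda lam * \<bar>Im z\<bar> powr (2 * lam)"

lemma c_lambda_pos: "lam \<ge> 0 \<Longrightarrow> c_lambda lam > 0"
  by (simp add: c_lambda_def Gamma_real_pos)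

lemma weight_nonneg: "lam \<ge> 0 \<Longrightarrow> weight lam z \<ge> 0"
  using c_lambda_pos[of lam] by (simp add: weight_def)

lemma weight_measurable [measurable]: "weight lam \<in> borel_measurable borel"
  unfolding weight_def[abs_def] by measurable

lemma unit_disk_measurable [measurable]: "unit_disk \<in> sets borel"
  by simp

lemma sets_sigma: "sets (sigma_lambda lam) = sets (restrict_space borel unit_disk)"
  by (simp add: sigma_lambda_def sets_restrict_space)

lemma space_sigma [simp]: "space (sigma_lambda lam) = unit_disk"
  by (simp add: sigma_lambda_def space_restrict_space)

lemma measurable_sigma_iff:
  "f \<in> borel_measurable (sigma_lambda lam) \<longleftrightarrow> f \<in> borel_measurable (restrict_space borel unit_disk)"
  using measurable_cong_sets[OF sets_sigma refl] by blast

lemma measurable_restrict_lborel_iff: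
  "f \<in> borel_measurable (restrict_space lborel unit_disk) \<longleftrightarrow> f \<in> borel_measurable (restrict_space borel unit_disk)"
  by (intro arg_cong2[where f = "(\<in>)"] measurable_cong_sets sets_restrict_space_cong) auto

lemma continuous_on_measurable_sigma:
  fixes f :: "complex \<Rightarrow> 'b::topological_space"
  shows "continuous_on unit_disk f \<Longrightarrow> f \<in> borel_measurable (sigma_lambda lam)"
  unfolding measurable_sigma_iff by (rule borel_measurable_continuous_on_restrict)

lemma nn_integral_sigma:
  assumes "f \<in> borel_measurable (sigma_lambda lam)"
  shows "(\<integral>\<^sup>+z. f z \<partial>sigma_lambda lam) = (\<integral>\<^sup>+z. ennreal (weight lam z) * f z * indicator unit_disk z \<partial>lborel)"
proof -
  have "(\<integral>\<^sup>+z. f z \<partial>sigma_lambda lam) = (\<integral>\<^sup>+z. ennreal (weight lam z) * f z \<partial>restrict_space lborel unit_disk)"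
    unfolding sigma_lambda_def weight_def[symmetric]
    using assms by (intro nn_integral_density)
      (auto simp: measurable_sigma_iff measurable_restrict_lborel_iff intro!: measurable_restrict_space1)
  also have "\<dots> = (\<integral>\<^sup>+z. ennreal (weight lam z) * f z * indicator unit_disk z \<partial>lborel)"
    by (intro nn_integral_restrict_space) auto
  finally show ?thesis .
qed

lemma integral_sigma:
  fixes f :: "complex \<Rightarrow> 'b::{banach, second_countable_topology}"
  assumes "lam \<ge> 0" "f \<in> borel_measurable (sigma_lambda lam)"
  shows "(\<integral>z. f z \<partial>sigma_lambda lam) = (\<integral>z. indicator unit_disk z *\<^sub>R (weight lam z *\<^sub>R f z) \<partial>lborel)"
proof -
  have "(\<integral>z. f z \<partial>sigma_lambda lam) = (\<integral>z. weight lam z *\<^sub>R f z \<partial>restrict_space lborel unit_disk)"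
    unfolding sigma_lambda_def weight_def[symmetric]
    using assms by (intro integral_density)
      (auto simp: measurable_sigma_iff measurable_restrict_lborel_iff weight_nonneg intro!: measurable_restrict_space1)
  also have "\<dots> = (\<integral>z. indicator unit_disk z *\<^sub>R (weight lam z *\<^sub>R f z) \<partial>lborel)"
    by (intro integral_restrict_space) auto
  finally show ?thesis .
qed

lemma Complex_measurable [measurable]:
  "(\<lambda>p :: real \<times> real. Complex (fst p) (snd p)) \<in> borel_measurable borel"
proof -
  have "continuous_on UNIV (\<lambda>p :: real \<times> real. of_real (fst p) + \<i> * of_real (snd p))"
    by (intro continuous_intros)
  then show ?thesis
    by (simp add: borel_measurable_continuous_onI Complex_eq)
qed

text \<open>
  This gives access to Fubini's theorem in the coordinates \<open>x\<close> and \<open>y\<close>.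
\<close>

lemma lborel_complex_eq_distr:
  "(lborel :: complex measure) = distr (lborel \<Otimes>\<^sub>M lborel) borel (\<lambda>p. Complex (fst p) (snd p))"
proof (rule lborel_eqI)
  fix l u :: complex
  assume le: "\<And>b. b \<in> Basis \<Longrightarrow> l \<bullet> b \<le> u \<bullet> b"
  have le': "Re l \<le> Re u" "Im l \<le> Im u"
    using le[of 1] le[of \<i>] by (auto simp: Basis_complex_def)
  have "(\<lambda>p. Complex (fst p) (snd p)) -` box l u \<inter> space (lborel \<Otimes>\<^sub>M lborel) = box (Re l) (Re u) \<times> box (Im l) (Im u)"
    by (auto simp: in_box_complex_iff space_pair_measure box_real)
  then have "emeasure (distr (lborel \<Otimes>\<^sub>M lborel) borel (\<lambda>p. Complex (fst p) (snd p))) (box l u)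
     = emeasure (lborel \<Otimes>\<^sub>M lborel) (box (Re l) (Re u) \<times> box (Im l) (Im u))"
    by (subst emeasure_distr) (simp_all add: lborel_prod)
  also have "\<dots> = emeasure lborel (box (Re l) (Re u)) * emeasure lborel (box (Im l) (Im u))"
    by (intro lborel.emeasure_pair_measure_Times) auto
  also have "\<dots> = ennreal (\<Prod>b\<in>Basis. (u - l) \<bullet> b)"
    using le' by (simp add: Basis_complex_def ennreal_mult'[symmetric] box_real)
  finally show "emeasure (distr (lborel \<Otimes>\<^sub>M lborel) borel (\<lambda>p. Complex (fst p) (snd p))) (box l u)
     = (\<Prod>b\<in>Basis. (u - l) \<bullet> b)" .
qed simp

lemma nn_integral_lborel_complex:
  fixes f :: "complex \<Rightarrow> ennreal"
  assumes [measurable]: "f \<in> borel_measurable borel"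
  shows "(\<integral>\<^sup>+z. f z \<partial>lborel) = (\<integral>\<^sup>+x. \<integral>\<^sup>+y. f (Complex x y) \<partial>lborel \<partial>lborel)"
proof -
  have m: "(\<lambda>p :: real \<times> real. Complex (fst p) (snd p)) \<in> (lborel \<Otimes>\<^sub>M lborel) \<rightarrow>\<^sub>M borel"
    using Complex_measurable by (simp add: lborel_prod)
  have "(\<integral>\<^sup>+z. f z \<partial>lborel) = (\<integral>\<^sup>+p. f (Complex (fst p) (snd p)) \<partial>(lborel \<Otimes>\<^sub>M lborel))"
    by (subst lborel_complex_eq_distr, subst nn_integral_distr) (use m in auto)
  also have "\<dots> = (\<integral>\<^sup>+x. \<integral>\<^sup>+y. f (Complex x y) \<partial>lborel \<partial>lborel)"
    by (subst lborel.nn_integral_fst[symmetric]) (use measurable_compose[OF m assms] in auto)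
  finally show ?thesis .
qed

lemma lborel_complex_reflect:
  assumes "\<bar>s\<bar> = 1" "\<bar>t\<bar> = 1"
  shows "lborel = distr lborel borel (\<lambda>z. Complex (s * Re z) (t * Im z))"
proof -
  define c :: "complex \<Rightarrow> real" where "c b = (if b = 1 then s else t)" for b
  have "lborel = density (distr lborel borel (\<lambda>z. 0 + (\<Sum>j\<in>Basis. (c j * (z \<bullet> j)) *\<^sub>R j))) (\<lambda>_. (\<Prod>j\<in>Basis. \<bar>c j\<bar>))"
    by (rule lborel_affine_euclidean) (use assms in \<open>auto simp: c_def\<close>)
  moreover have "0 + (\<Sum>j\<in>Basis. (c j * (z \<bullet> j)) *\<^sub>R j) = Complex (s * Re z) (t * Im z)" for z
    by (simp add: Basis_complex_def c_def complex_eq_iff)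
  moreover have "(\<Prod>j\<in>Basis. \<bar>c j\<bar>) = 1"
    using assms by (simp add: Basis_complex_def c_def)
  ultimately show ?thesis
    by (simp add: density_1)
qed

text \<open>
  The measure is invariant under both reflections of the disk, so odd functions integrate to 0.
\<close>

lemma integral_sigma_reflect:
  fixes f :: "complex \<Rightarrow> 'b::{banach, second_countable_topology}"
  assumes lam: "lam \<ge> 0" and f: "f \<in> borel_measurable borel" and st: "\<bar>s\<bar> = 1" "\<bar>t\<bar> = 1"
  shows "(\<integral>z. f (Complex (s * Re z) (t * Im z)) \<partial>sigma_lambda lam) = (\<integral>z. f z \<partial>sigma_lambda lam)"
proof -
  let ?T = "\<lambda>z. Complex (s * Re z) (t * Im z)"
  have T [measurable]: "?T \<in> borel_measurable borel"
    by (intro borel_measurable_continuous_onI) (simp add: Complex_eq, intro continuous_intros)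
  note [measurable] = f
  have sq: "s\<^sup>2 = 1" "t\<^sup>2 = 1"
    using st by (auto simp: power2_eq_1_iff)
  have norm: "norm (?T z) = norm z" for z
    using sq by (simp add: cmod_def power_mult_distrib)
  have w: "weight lam (?T z) = weight lam z" for z
    using st by (simp add: weight_def abs_mult)
  have meas: "g \<in> borel_measurable (sigma_lambda lam)" if "g \<in> borel_measurable borel" for g :: "complex \<Rightarrow> 'b"
    using that unfolding measurable_sigma_iff by (intro measurable_restrict_space1)
  have "(\<integral>z. f z \<partial>sigma_lambda lam) = (\<integral>z. indicator unit_disk z *\<^sub>R (weight lam z *\<^sub>R f z) \<partial>lborel)"
    by (intro integral_sigma lam meas f)
  also have "\<dots> = (\<integral>z. indicator unit_disk (?T z) *\<^sub>R (weight lam (?T z) *\<^sub>R f (?T z)) \<partial>lborel)"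
  proof -
    have m: "(\<lambda>z. indicator unit_disk z *\<^sub>R (weight lam z *\<^sub>R f z)) \<in> borel_measurable borel"
      by (intro borel_measurable_scaleR borel_measurable_indicator weight_measurable f) auto
    show ?thesis
      by (subst lborel_complex_reflect[OF st], subst integral_distr[OF _ m]) auto
  qed
  also have "\<dots> = (\<integral>z. indicator unit_disk z *\<^sub>R (weight lam z *\<^sub>R f (?T z)) \<partial>lborel)"
    by (simp add: w norm indicator_def)
  also have "\<dots> = (\<integral>z. f (?T z) \<partial>sigma_lambda lam)"
    by (intro integral_sigma[symmetric] lam meas) simp
  finally show ?thesis ..
qed

lemma nn_integral_even:
  fixes f :: "real \<Rightarrow> ennreal"
  assumes [measurable]: "f \<in> borel_measurable borel"
  shows "(\<integral>\<^sup>+x. f \<bar>x\<bar> \<partial>lborel) = 2 * (\<integral>\<^sup>+x. f x * indicator {0..} x \<partial>lborel)"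
proof -
  have "(\<integral>\<^sup>+x. f \<bar>x\<bar> \<partial>lborel) = (\<integral>\<^sup>+x. f \<bar>x\<bar> * indicator {0..} x + f \<bar>x\<bar> * indicator {..<0} x \<partial>lborel)"
    by (intro nn_integral_cong) (auto simp: indicator_def)
  also have "\<dots> = (\<integral>\<^sup>+x. f \<bar>x\<bar> * indicator {0..} x \<partial>lborel) + (\<integral>\<^sup>+x. f \<bar>x\<bar> * indicator {..<0} x \<partial>lborel)"
    by (intro nn_integral_add) auto
  also have "(\<integral>\<^sup>+x. f \<bar>x\<bar> * indicator {0..} x \<partial>lborel) = (\<integral>\<^sup>+x. f x * indicator {0..} x \<partial>lborel)"
    by (intro nn_integral_cong) (auto simp: indicator_def)
  also have "(\<integral>\<^sup>+x. f \<bar>x\<bar> * indicator {..<0} x \<partial>lborel) = (\<integral>\<^sup>+x. f \<bar>x\<bar> * indicator {0<..} x \<partial>lborel)"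
    by (subst nn_integral_real_affine[where c = "-1" and t = 0])
       (auto intro!: nn_integral_cong simp: indicator_def)
  also have "\<dots> = (\<integral>\<^sup>+x. f x * indicator {0..} x \<partial>lborel)"
    by (intro nn_integral_cong_AE AE_I[of _ _ "{0}"]) (auto simp: indicator_def)
  finally show ?thesis
    by (simp add: mult_2)
qed

lemma nn_integral_abs_powr:
  assumes b: "b \<ge> 0" and s: "s \<ge> 0"
  shows "(\<integral>\<^sup>+y. ennreal (\<bar>y\<bar> powr b) * indicator {..<s} \<bar>y\<bar> \<partial>lborel) = ennreal (2 * s powr (b + 1) / (b + 1))"
proof -
  have "(\<integral>\<^sup>+y. ennreal (\<bar>y\<bar> powr b) * indicator {..<s} \<bar>y\<bar> \<partial>lborel)
      = 2 * (\<integral>\<^sup>+y. ennreal (y powr b) * indicator {..<s} y * indicator {0..} y \<partial>lborel)"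
    using nn_integral_even[of "\<lambda>y. ennreal (y powr b) * indicator {..<s} y"] by simp
  also have "(\<integral>\<^sup>+y. ennreal (y powr b) * indicator {..<s} y * indicator {0..} y \<partial>lborel)
     = (\<integral>\<^sup>+y. ennreal (indicator {0..s} y * y powr b) \<partial>lborel)"
    by (intro nn_integral_cong_AE AE_I[of _ _ "{s}"]) (auto simp: indicator_def)
  also have "\<dots> = ennreal (s powr (b + 1) / (b + 1))"
    using b s by (intro nn_integral_has_integral_lebesgue has_integral_powr_from_0) auto
  also have "2 * \<dots> = ennreal (2 * s powr (b + 1) / (b + 1))"
    using b by (simp add: ennreal_mult'[symmetric] flip: ennreal_numeral)
  finally show ?thesis .
qed

text \<open>
  The substitution \<open>t = x\<^sup>2\<close> turns the integral over \<open>(0, 1)\<close> into Euler's integral.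
\<close>

lemma nn_integral_power_Beta:
  assumes b: "b \<ge> 0"
  shows "(\<integral>\<^sup>+x. ennreal (\<bar>x\<bar> ^ a * (1 - x\<^sup>2) powr b) * indicator {..<1} \<bar>x\<bar> \<partial>lborel)
     = ennreal (Beta ((real a + 1) / 2) (b + 1))"
proof -
  let ?h = "\<lambda>t. t powr ((real a + 1) / 2 - 1) * (1 - t) powr (b + 1 - 1)"
  have "(\<integral>\<^sup>+x. ennreal (\<bar>x\<bar> ^ a * (1 - x\<^sup>2) powr b) * indicator {..<1} \<bar>x\<bar> \<partial>lborel)
     = (\<integral>\<^sup>+x. ennreal (\<bar>x\<bar> ^ a * (1 - \<bar>x\<bar>\<^sup>2) powr b) * indicator {..<1} \<bar>x\<bar> \<partial>lborel)"
    by simp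
  also have "\<dots> = 2 * (\<integral>\<^sup>+x. ennreal (x ^ a * (1 - x\<^sup>2) powr b) * indicator {..<1} x * indicator {0..} x \<partial>lborel)"
    by (rule nn_integral_even) measurable
  also have "\<dots> = (\<integral>\<^sup>+x. 2 * (ennreal (x ^ a * (1 - x\<^sup>2) powr b) * indicator {..<1} x * indicator {0..} x) \<partial>lborel)"
    by (rule nn_integral_cmult[symmetric]) measurable
  also have "\<dots> = (\<integral>\<^sup>+x. ennreal (?h (x\<^sup>2) * (2 * x) * indicator {0..1} x) \<partial>lborel)"
  proof (intro nn_integral_cong_AE AE_I[of _ _ "{0, 1}"])
    have "2 * (ennreal (x ^ a * (1 - x\<^sup>2) powr b) * indicator {..<1} x * indicator {0..} x) =
        ennreal (?h (x\<^sup>2) * (2 * x) * indicator {0..1} x)" if x: "x \<noteq> 0" "x \<noteq> 1" for x :: real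
    proof (cases "0 < x \<and> x < 1")
      case True
      have "(x\<^sup>2) powr ((real a + 1) / 2 - 1) = x powr (real a - 1)"
      proof -
        have "2 * ((real a + 1) / 2 - 1) = real a - 1"
          by (simp add: field_simps)
        moreover have "x\<^sup>2 = x powr 2"
          using True by simp
        ultimately show ?thesis
          by (simp only: powr_powr)
      qed
      also have "\<dots> * x = x ^ a"
        using True by (simp add: powr_mult_base[symmetric] mult.commute powr_realpow powr_diff)
      finally have "(x\<^sup>2) powr ((real a + 1) / 2 - 1) * x = x ^ a" .
      then have h: "?h (x\<^sup>2) * (2 * x) = 2 * (x ^ a * (1 - x\<^sup>2) powr b)"
        by (simp add: mult_ac)
      have "indicator {0..1} x = (1::real)"
        using True by simp
      then have "ennreal (?h (x\<^sup>2) * (2 * x) * indicator {0..1} x) = ennreal (2 * (x ^ a * (1 - x\<^sup>2) powr b))"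
        by (simp only: h mult_1_right)
      moreover have "2 * (ennreal (x ^ a * (1 - x\<^sup>2) powr b) * indicator {..<1} x * indicator {0..} x)
          = ennreal (2 * (x ^ a * (1 - x\<^sup>2) powr b))"
        using True by (simp add: ennreal_mult' flip: ennreal_numeral)
      ultimately show ?thesis
        by (simp only:)
    next
      case False
      then show ?thesis
        using x by (auto simp: indicator_def)
    qed
    then show "{x \<in> space lborel. 2 * (ennreal (x ^ a * (1 - x\<^sup>2) powr b) * indicator {..<1} x * indicator {0..} x) \<noteq>
        ennreal (?h (x\<^sup>2) * (2 * x) * indicator {0..1} x)} \<subseteq> {0, 1}"
      by blast
  qed (auto simp: emeasure_lborel_countable)
  also have "\<dots> = (\<integral>\<^sup>+t. ennreal (?h t * indicator {0\<^sup>2..1\<^sup>2} t) \<partial>lborel)"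
    by (rule nn_integral_substitution[symmetric, where g = "\<lambda>x. x\<^sup>2" and g' = "\<lambda>x. 2 * x"])
       (auto intro!: derivative_eq_intros continuous_intros simp: set_borel_measurable_def)
  also have "\<dots> = (\<integral>\<^sup>+t. ennreal (indicator {0..1} t * ?h t) \<partial>lborel)"
    by (simp add: mult.commute)
  also have "\<dots> = ennreal (Beta ((real a + 1) / 2) (b + 1))"
    by (intro nn_integral_has_integral_lebesgue has_integral_Beta_real) (use b in auto)
  finally show ?thesis .
qed

definition moment :: "real \<Rightarrow> nat \<Rightarrow> nat \<Rightarrow> real" where
  "moment lam a b = c_lambda lam * (Gamma ((real a + 1) / 2) * Gamma ((real b + 1) / 2 + lam)
     / Gamma ((real a + real b) / 2 + lam + 2))"

text \<open>
  Integrating first in \<open>y\<close> over the chord of half length \<open>sqrt (1 - x\<^sup>2)\<close> leaves a Beta integral in \<open>x\<close>.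
\<close>

lemma nn_integral_abs_moment:
  assumes lam: "lam \<ge> 0"
  shows "(\<integral>\<^sup>+z. ennreal (\<bar>Re z\<bar> ^ a * \<bar>Im z\<bar> ^ b) \<partial>sigma_lambda lam) = ennreal (moment lam a b)"
proof -
  let ?b = "real b + 2 * lam"
  have b: "?b \<ge> 0"
    using lam by simp
  have "(\<integral>\<^sup>+z. ennreal (\<bar>Re z\<bar> ^ a * \<bar>Im z\<bar> ^ b) \<partial>sigma_lambda lam) =
     (\<integral>\<^sup>+z. ennreal (weight lam z) * ennreal (\<bar>Re z\<bar> ^ a * \<bar>Im z\<bar> ^ b) * indicator unit_disk z \<partial>lborel)"
    by (intro nn_integral_sigma continuous_on_measurable_sigma measurable_compose[OF _ measurable_ennreal] continuous_intros)
  also have "\<dots> = (\<integral>\<^sup>+z. ennreal (c_lambda lam) * (ennreal (\<bar>Re z\<bar> ^ a) * (ennreal (\<bar>Im z\<bar> powr ?b) * indicator unit_disk z)) \<partial>lborel)"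
  proof (intro nn_integral_cong)
    fix z :: complex
    have "\<bar>Im z\<bar> powr (2 * lam) * \<bar>Im z\<bar> ^ b = \<bar>Im z\<bar> powr ?b"
      by (cases "Im z = 0") (simp_all add: powr_add powr_realpow)
    then have "weight lam z * (\<bar>Re z\<bar> ^ a * \<bar>Im z\<bar> ^ b) = c_lambda lam * (\<bar>Re z\<bar> ^ a * \<bar>Im z\<bar> powr ?b)"
      unfolding weight_def by (metis (no_types, opaque_lifting) mult.assoc mult.left_commute)
    moreover have "ennreal (weight lam z) * ennreal (\<bar>Re z\<bar> ^ a * \<bar>Im z\<bar> ^ b) = ennreal (weight lam z * (\<bar>Re z\<bar> ^ a * \<bar>Im z\<bar> ^ b))"
      using weight_nonneg[OF lam, of z] by (intro ennreal_mult'[symmetric])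
    ultimately have "ennreal (weight lam z) * ennreal (\<bar>Re z\<bar> ^ a * \<bar>Im z\<bar> ^ b) = ennreal (c_lambda lam * (\<bar>Re z\<bar> ^ a * \<bar>Im z\<bar> powr ?b))"
      by (simp only:)
    then show "ennreal (weight lam z) * ennreal (\<bar>Re z\<bar> ^ a * \<bar>Im z\<bar> ^ b) * indicator unit_disk z
        = ennreal (c_lambda lam) * (ennreal (\<bar>Re z\<bar> ^ a) * (ennreal (\<bar>Im z\<bar> powr ?b) * indicator unit_disk z))"
      using c_lambda_pos[OF lam] by (simp add: ennreal_mult' mult.assoc)
  qed
  also have "\<dots> = ennreal (c_lambda lam) * (\<integral>\<^sup>+z. ennreal (\<bar>Re z\<bar> ^ a) * (ennreal (\<bar>Im z\<bar> powr ?b) * indicator unit_disk z) \<partial>lborel)"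
    by (intro nn_integral_cmult) measurable
  also have "(\<integral>\<^sup>+z. ennreal (\<bar>Re z\<bar> ^ a) * (ennreal (\<bar>Im z\<bar> powr ?b) * indicator unit_disk z) \<partial>lborel)
      = (\<integral>\<^sup>+x. \<integral>\<^sup>+y. ennreal (\<bar>x\<bar> ^ a) * (ennreal (\<bar>y\<bar> powr ?b) * indicator unit_disk (Complex x y)) \<partial>lborel \<partial>lborel)"
    by (subst nn_integral_lborel_complex) auto
  also have "\<dots> = (\<integral>\<^sup>+x. ennreal (2 / (?b + 1)) * (ennreal (\<bar>x\<bar> ^ a * (1 - x\<^sup>2) powr ((?b + 1) / 2)) * indicator {..<1} \<bar>x\<bar>) \<partial>lborel)"
  proof (intro nn_integral_cong)
    fix x :: real
    have disk: "Complex x y \<in> unit_disk \<longleftrightarrow> \<bar>x\<bar> < 1 \<and> \<bar>y\<bar> < sqrt (1 - x\<^sup>2)" for y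
    proof -
      have "Complex x y \<in> unit_disk \<longleftrightarrow> x\<^sup>2 + y\<^sup>2 < 1"
        by (simp add: cmod_def)
      also have "\<dots> \<longleftrightarrow> \<bar>y\<bar> < sqrt (1 - x\<^sup>2)"
        by (metis (no_types, lifting) less_diff_eq add.commute real_sqrt_abs real_sqrt_less_iff)
      also have "\<dots> \<longleftrightarrow> \<bar>x\<bar> < 1 \<and> \<bar>y\<bar> < sqrt (1 - x\<^sup>2)"
      proof -
        have "\<bar>x\<bar> < 1" if "\<bar>y\<bar> < sqrt (1 - x\<^sup>2)"
        proof -
          have "0 < sqrt (1 - x\<^sup>2)"
            using that abs_ge_zero[of y] by linarith
          then have "x\<^sup>2 < 1"
            by simp
          then show ?thesis
            by (simp add: abs_square_less_1)
        qed
        then show ?thesis by blast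
      qed
      finally show ?thesis .
    qed
    have "(\<integral>\<^sup>+y. ennreal (\<bar>x\<bar> ^ a) * (ennreal (\<bar>y\<bar> powr ?b) * indicator unit_disk (Complex x y)) \<partial>lborel)
        = (\<integral>\<^sup>+y. ennreal (\<bar>x\<bar> ^ a) * indicator {..<1} \<bar>x\<bar> * (ennreal (\<bar>y\<bar> powr ?b) * indicator {..<sqrt (1 - x\<^sup>2)} \<bar>y\<bar>) \<partial>lborel)"
      using disk by (intro nn_integral_cong) (auto simp: indicator_def)
    also have "\<dots> = ennreal (\<bar>x\<bar> ^ a) * indicator {..<1} \<bar>x\<bar> * (\<integral>\<^sup>+y. ennreal (\<bar>y\<bar> powr ?b) * indicator {..<sqrt (1 - x\<^sup>2)} \<bar>y\<bar> \<partial>lborel)"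
      by (intro nn_integral_cmult) measurable
    also have "\<dots> = ennreal (2 / (?b + 1)) * (ennreal (\<bar>x\<bar> ^ a * (1 - x\<^sup>2) powr ((?b + 1) / 2)) * indicator {..<1} \<bar>x\<bar>)"
    proof (cases "\<bar>x\<bar> < 1")
      case True
      then have x: "1 - x\<^sup>2 > 0"
        by (simp add: abs_square_less_1)
      have "sqrt (1 - x\<^sup>2) powr (?b + 1) = (1 - x\<^sup>2) powr ((?b + 1) / 2)"
        using x by (simp add: powr_half_sqrt[symmetric] powr_powr)
      then have "(\<integral>\<^sup>+y. ennreal (\<bar>y\<bar> powr ?b) * indicator {..<sqrt (1 - x\<^sup>2)} \<bar>y\<bar> \<partial>lborel)
          = ennreal (2 * (1 - x\<^sup>2) powr ((?b + 1) / 2) / (?b + 1))"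
        using nn_integral_abs_powr[OF b, of "sqrt (1 - x\<^sup>2)"] x by simp
      then show ?thesis
        using True b by (simp add: ennreal_mult'[symmetric] mult_ac)
    qed simp
    finally show "(\<integral>\<^sup>+y. ennreal (\<bar>x\<bar> ^ a) * (ennreal (\<bar>y\<bar> powr ?b) * indicator unit_disk (Complex x y)) \<partial>lborel)
      = ennreal (2 / (?b + 1)) * (ennreal (\<bar>x\<bar> ^ a * (1 - x\<^sup>2) powr ((?b + 1) / 2)) * indicator {..<1} \<bar>x\<bar>)" .
  qed
  also have "\<dots> = ennreal (2 / (?b + 1)) * ennreal (Beta ((real a + 1) / 2) ((?b + 1) / 2 + 1))"
    using b by (subst nn_integral_cmult) (auto simp: nn_integral_power_Beta)
  also have "ennreal (c_lambda lam) * \<dots> = ennreal (c_lambda lam * (2 / (?b + 1) * Beta ((real a + 1) / 2) ((?b + 1) / 2 + 1)))"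
    using c_lambda_pos[OF lam] b by (simp add: ennreal_mult'[symmetric])
  also have "c_lambda lam * (2 / (?b + 1) * Beta ((real a + 1) / 2) ((?b + 1) / 2 + 1)) = moment lam a b"
  proof -
    have G: "Gamma ((?b + 1) / 2 + 1) = (?b + 1) / 2 * Gamma ((?b + 1) / 2)"
      using b by (intro Gamma_plus1) (auto dest: nonpos_Ints_nonpos)
    have 1: "2 / (?b + 1) * Gamma ((?b + 1) / 2 + 1) = Gamma ((?b + 1) / 2)"
      unfolding G using b by simp
    have 2: "(?b + 1) / 2 = (real b + 1) / 2 + lam"
      by (simp add: field_simps)
    have 3: "(real a + 1) / 2 + ((?b + 1) / 2 + 1) = (real a + real b) / 2 + lam + 2"
      by (simp add: field_simps)
    have "2 / (?b + 1) * Beta ((real a + 1) / 2) ((?b + 1) / 2 + 1) =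
        Gamma ((real a + 1) / 2) * (2 / (?b + 1) * Gamma ((?b + 1) / 2 + 1)) / Gamma ((real a + 1) / 2 + ((?b + 1) / 2 + 1))"
      by (simp add: Beta_def)
    also have "\<dots> = Gamma ((real a + 1) / 2) * Gamma ((real b + 1) / 2 + lam) / Gamma ((real a + real b) / 2 + lam + 2)"
      by (simp only: 1 3) (simp only: 2)
    finally show ?thesis
      by (simp only: moment_def)
  qed
  finally show ?thesis .
qed

section \<open>Homogeneous polynomials and a divergence theorem\<close>

lemma moment_0_0: "lam \<ge> 0 \<Longrightarrow> moment lam 0 0 = 1"
proof -
  assume lam: "lam \<ge> 0"
  have "Gamma (lam + 2) \<noteq> 0" "Gamma (lam + 1 / 2) \<noteq> 0" "Gamma (1 / 2 :: real) \<noteq> 0"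
    using lam by (auto intro!: less_imp_neq[symmetric] Gamma_real_pos)
  then show ?thesis
    by (simp add: moment_def c_lambda_def add.commute)
qed

lemma emeasure_sigma_space:
  assumes lam: "lam \<ge> 0"
  shows "emeasure (sigma_lambda lam) (space (sigma_lambda lam)) = 1"
proof -
  have "emeasure (sigma_lambda lam) (space (sigma_lambda lam)) = (\<integral>\<^sup>+z. ennreal (\<bar>Re z\<bar> ^ 0 * \<bar>Im z\<bar> ^ 0) \<partial>sigma_lambda lam)"
    by simp
  also have "\<dots> = 1"
    unfolding nn_integral_abs_moment[OF lam] by (simp add: moment_0_0[OF lam])
  finally show ?thesis .
qed

lemma finite_measure_sigma: "lam \<ge> 0 \<Longrightarrow> finite_measure (sigma_lambda lam)"
  by (intro finite_measureI) (simp only: emeasure_sigma_space, simp)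

definition signed_moment :: "real \<Rightarrow> nat \<Rightarrow> nat \<Rightarrow> real" where
  "signed_moment lam a b = (if even a \<and> even b then moment lam a b else 0)"

lemma integrable_monomial:
  assumes lam: "lam \<ge> 0"
  shows "integrable (sigma_lambda lam) (\<lambda>z. Re z ^ a * Im z ^ b)"
proof (rule integrableI_bounded)
  show "(\<lambda>z. Re z ^ a * Im z ^ b) \<in> borel_measurable (sigma_lambda lam)"
    by (intro continuous_on_measurable_sigma continuous_intros)
  have "(\<integral>\<^sup>+z. ennreal (norm (Re z ^ a * Im z ^ b)) \<partial>sigma_lambda lam) = ennreal (moment lam a b)"
    using nn_integral_abs_moment[OF lam, of a b] by (simp add: abs_mult power_abs)
  then show "(\<integral>\<^sup>+z. ennreal (norm (Re z ^ a * Im z ^ b)) \<partial>sigma_lambda lam) < \<infinity>"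
    by simp
qed

lemma moment_nonneg:
  assumes lam: "lam \<ge> 0"
  shows "moment lam a b \<ge> 0"
proof -
  have "(real a + 1) / 2 > 0" "(real b + 1) / 2 + lam > 0" "(real a + real b) / 2 + lam + 2 > 0"
    using lam by (auto intro: add_pos_nonneg add_nonneg_pos)
  then have "Gamma ((real a + 1) / 2) > 0" "Gamma ((real b + 1) / 2 + lam) > 0" "Gamma ((real a + real b) / 2 + lam + 2) > 0"
    by (auto intro!: Gamma_real_pos)
  then show ?thesis
    unfolding moment_def using c_lambda_pos[OF lam] by (intro mult_nonneg_nonneg divide_nonneg_nonneg) linarith+
qed

lemma integral_monomial:
  assumes lam: "lam \<ge> 0"
  shows "(\<integral>z. Re z ^ a * Im z ^ b \<partial>sigma_lambda lam) = signed_moment lam a b"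
proof (cases "even a \<and> even b")
  case True
  then have abs: "\<bar>Re z\<bar> ^ a * \<bar>Im z\<bar> ^ b = Re z ^ a * Im z ^ b" for z :: complex
    by (simp add: power_even_abs)
  have "(\<integral>z. Re z ^ a * Im z ^ b \<partial>sigma_lambda lam) = enn2real (\<integral>\<^sup>+z. ennreal (Re z ^ a * Im z ^ b) \<partial>sigma_lambda lam)"
    by (intro integral_eq_nn_integral continuous_on_measurable_sigma continuous_intros)
       (use True in \<open>auto simp: zero_le_even_power\<close>)
  also have "\<dots> = moment lam a b"
    using nn_integral_abs_moment[OF lam, of a b] moment_nonneg[OF lam, of a b] by (simp add: abs)
  finally show ?thesis
    using True by (simp add: signed_moment_def)
next
  case False
  let ?I = "\<integral>z. Re z ^ a * Im z ^ b \<partial>sigma_lambda lam"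
  have m: "(\<lambda>z. Re z ^ a * Im z ^ b) \<in> borel_measurable borel"
    by measurable
  have "?I = - ?I"
  proof (cases "even a")
    case True
    then have "odd b"
      using False by simp
    then show ?thesis
      using integral_sigma_reflect[OF lam m, of 1 "-1"] by simp
  next
    case False
    then show ?thesis
      using integral_sigma_reflect[OF lam m, of "-1" 1] by simp
  qed
  then have "?I = 0"
    by linarith
  then show ?thesis
    using False by (simp only: signed_moment_def if_False)
qed

text \<open>
  The functional equation of \<open>Gamma\<close>. For monomials these recursions are integration by parts on
  the disk.
\<close>

lemma moment_add_2:
  assumes lam: "lam \<ge> 0"
  shows "(real a + real b + 2 * lam + 4) * moment lam (a + 2) b = (real a + 1) * moment lam a b" (is ?x)
    and "(real a + real b + 2 * lam + 4) * moment lam a (b + 2) = (real b + 1 + 2 * lam) * moment lam a b" (is ?y)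
proof -
  let ?d = "(real a + real b) / 2 + lam + 2"
  have G: "Gamma (x + 1) = x * Gamma x" if "x > 0" for x :: real
    using that by (intro Gamma_plus1) (auto dest: nonpos_Ints_nonpos)
  have d: "?d > 0"
    using lam by (simp add: add_nonneg_pos)
  have Gd: "Gamma ?d \<noteq> 0"
    using Gamma_real_pos[OF d] by simp
  have key: "(2 * d) * (c * ((p * g) * h / (d * w))) = (2 * p) * (c * (g * h / w))"
    if "d \<noteq> 0" "w \<noteq> 0" for c d p g h w :: real
    using that by (simp add: field_simps)
  have e1: "(real (a + 2) + 1) / 2 = (real a + 1) / 2 + 1" "(real (a + 2) + real b) / 2 + lam + 2 = ?d + 1"
    "real a + real b + 2 * lam + 4 = 2 * ?d" "real a + 1 = 2 * ((real a + 1) / 2)"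
    by (simp_all add: field_simps)
  have pos1: "(real a + 1) / 2 > 0"
    by simp
  show ?x
    unfolding moment_def e1(1) e1(2) G[OF d] G[OF pos1]
    using key[of ?d "Gamma ?d" "c_lambda lam" "(real a + 1) / 2" "Gamma ((real a + 1) / 2)" "Gamma ((real b + 1) / 2 + lam)"]
      d Gd unfolding e1(3) e1(4)[symmetric] by simp
  have e2: "(real (b + 2) + 1) / 2 + lam = ((real b + 1) / 2 + lam) + 1" "(real a + real (b + 2)) / 2 + lam + 2 = ?d + 1"
    "real b + 1 + 2 * lam = 2 * ((real b + 1) / 2 + lam)"
    by (simp_all add: field_simps)
  have pos: "(real b + 1) / 2 + lam > 0"
    using lam by (simp add: add_pos_nonneg)
  show ?y
    unfolding moment_def e2(1) e2(2) G[OF d] G[OF pos]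
    using key[of ?d "Gamma ?d" "c_lambda lam" "(real b + 1) / 2 + lam" "Gamma ((real b + 1) / 2 + lam)" "Gamma ((real a + 1) / 2)"]
      d Gd unfolding e1(3) e2(3) by (simp add: mult.commute)
qed

lemma signed_moment_x:
  assumes lam: "lam \<ge> 0"
  shows "real a * signed_moment lam (a - 1) b = (real a + real b + 2 * lam + 3) * signed_moment lam (a + 1) b"
proof (cases a)
  case 0
  then show ?thesis
    by (simp add: signed_moment_def)
next
  case (Suc i)
  have "real a + real b + 2 * lam + 3 = real i + real b + 2 * lam + 4"
    by (simp add: Suc)
  moreover have "a - 1 = i" "a + 1 = i + 2" "real a = real i + 1"
    using Suc by auto
  ultimately show ?thesis
    using moment_add_2(1)[OF lam, of i b] by (simp only: signed_moment_def) simp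
qed

lemma signed_moment_y:
  assumes lam: "lam \<ge> 0"
  shows "(real b + 1 + 2 * lam) * signed_moment lam a b = (real a + real b + 2 * lam + 4) * signed_moment lam a (b + 2)"
  using moment_add_2(2)[OF lam, of a b] by (simp add: signed_moment_def)

text \<open>
  Here \<open>N\<close> is the number of coefficients, so the degree is \<open>N - 1\<close>, and \<open>N = 0\<close> means \<open>F = 0\<close>. Counting
  this way lets a polynomial of degree \<open>d\<close> be paired with one of degree \<open>d - 1\<close> also for \<open>d = 0\<close>.
\<close>

definition hpoly :: "nat \<Rightarrow> (complex \<Rightarrow> real) \<Rightarrow> bool" where
  "hpoly N F \<longleftrightarrow> (\<exists>c. \<forall>z. F z = (\<Sum>j<N. c j * (Re z ^ (N - 1 - j) * Im z ^ j)))"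

lemma hpoly_zero: "hpoly N (\<lambda>_. 0)"
  unfolding hpoly_def by (rule exI[of _ "\<lambda>_. 0"]) simp

lemma hpoly_const: "hpoly 1 (\<lambda>_. c)"
  unfolding hpoly_def by (rule exI[of _ "\<lambda>_. c"]) simp

lemma hpoly_add:
  assumes "hpoly N F" "hpoly N G"
  shows "hpoly N (\<lambda>z. F z + G z)"
proof -
  obtain c d where "\<forall>z. F z = (\<Sum>j<N. c j * (Re z ^ (N - 1 - j) * Im z ^ j))"
     "\<forall>z. G z = (\<Sum>j<N. d j * (Re z ^ (N - 1 - j) * Im z ^ j))"
    using assms unfolding hpoly_def by blast
  then show ?thesis
    unfolding hpoly_def by (intro exI[of _ "\<lambda>j. c j + d j"]) (simp add: sum.distrib distrib_right)
qed

lemma hpoly_scale: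
  assumes "hpoly N F"
  shows "hpoly N (\<lambda>z. a * F z)"
proof -
  obtain c where "\<forall>z. F z = (\<Sum>j<N. c j * (Re z ^ (N - 1 - j) * Im z ^ j))"
    using assms unfolding hpoly_def by blast
  then show ?thesis
    unfolding hpoly_def by (intro exI[of _ "\<lambda>j. a * c j"]) (simp add: sum_distrib_left mult.assoc)
qed

lemma hpoly_diff: "hpoly N F \<Longrightarrow> hpoly N G \<Longrightarrow> hpoly N (\<lambda>z. F z - G z)"
  using hpoly_add[of N F "\<lambda>z. - 1 * G z"] hpoly_scale[of N G "-1"] by simp

lemma hpoly_sum: "(\<And>i. i \<in> A \<Longrightarrow> hpoly N (F i)) \<Longrightarrow> hpoly N (\<lambda>z. \<Sum>i\<in>A. F i z)"
  by (induction A rule: infinite_finite_induct) (auto intro: hpoly_zero hpoly_add)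

lemma hpoly_Re:
  assumes "hpoly N F"
  shows "hpoly (Suc N) (\<lambda>z. Re z * F z)"
proof -
  obtain c where c: "\<And>z. F z = (\<Sum>j<N. c j * (Re z ^ (N - 1 - j) * Im z ^ j))"
    using assms unfolding hpoly_def by blast
  have "Re z * F z = (\<Sum>j<Suc N. (if j < N then c j else 0) * (Re z ^ (Suc N - 1 - j) * Im z ^ j))" for z
  proof -
    have step: "Re z * (c j * (Re z ^ (N - 1 - j) * Im z ^ j)) = c j * (Re z ^ (N - j) * Im z ^ j)" if "j < N" for j
    proof -
      have "N - j = Suc (N - 1 - j)"
        using that by simp
      then show ?thesis
        by (simp only: power_Suc mult_ac)
    qed
    have "Re z * F z = (\<Sum>j<N. c j * (Re z ^ (N - j) * Im z ^ j))"
      unfolding c sum_distrib_left by (intro sum.cong refl step) auto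
    then show ?thesis
      by simp
  qed
  then show ?thesis
    unfolding hpoly_def by (intro exI[of _ "\<lambda>j. if j < N then c j else 0"]) blast
qed

lemma hpoly_Im:
  assumes "hpoly N F"
  shows "hpoly (Suc N) (\<lambda>z. Im z * F z)"
proof -
  obtain c where c: "\<And>z. F z = (\<Sum>j<N. c j * (Re z ^ (N - 1 - j) * Im z ^ j))"
    using assms unfolding hpoly_def by blast
  have "Im z * F z = (\<Sum>j<Suc N. (case j of 0 \<Rightarrow> 0 | Suc i \<Rightarrow> c i) * (Re z ^ (Suc N - 1 - j) * Im z ^ j))" for z
    unfolding sum.lessThan_Suc_shift c sum_distrib_left by (auto intro!: sum.cong simp: mult_ac)
  then show ?thesis
    unfolding hpoly_def by (intro exI[of _ "\<lambda>j. case j of 0 \<Rightarrow> 0 | Suc i \<Rightarrow> c i"]) blast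
qed

lemma hpoly_monomial_mult:
  assumes "hpoly N G"
  shows "hpoly (i + j + N) (\<lambda>z. Re z ^ i * Im z ^ j * G z)"
proof -
  have 1: "hpoly (j + N) (\<lambda>z. Im z ^ j * G z)"
  proof (induction j)
    case (Suc j)
    show ?case
      using hpoly_Im[OF Suc] by (simp add: mult.assoc)
  qed (use assms in simp)
  have "hpoly (i + (j + N)) (\<lambda>z. Re z ^ i * (Im z ^ j * G z))"
  proof (induction i)
    case (Suc i)
    show ?case
      using hpoly_Re[OF Suc] by (simp add: mult.assoc)
  qed (use 1 in simp)
  then show ?thesis
    by (simp add: mult.assoc add.assoc)
qed

lemma hpoly_mult:
  assumes "hpoly (Suc d) F" "hpoly N G"
  shows "hpoly (d + N) (\<lambda>z. F z * G z)"
proof -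
  obtain c where c: "\<And>z. F z = (\<Sum>j<Suc d. c j * (Re z ^ (Suc d - 1 - j) * Im z ^ j))"
    using assms(1) unfolding hpoly_def by blast
  have "hpoly (d + N) (\<lambda>z. \<Sum>j<Suc d. c j * (Re z ^ (Suc d - 1 - j) * Im z ^ j * G z))"
  proof (intro hpoly_sum hpoly_scale)
    fix j assume "j \<in> {..<Suc d}"
    then show "hpoly (d + N) (\<lambda>z. Re z ^ (Suc d - 1 - j) * Im z ^ j * G z)"
      using hpoly_monomial_mult[OF assms(2), of "d - j" j] by simp
  qed
  then show ?thesis
    unfolding c sum_distrib_right by (simp add: mult.assoc)
qed

lemma hpoly_integrable:
  assumes lam: "lam \<ge> 0" and "hpoly N F"
  shows "integrable (sigma_lambda lam) F"
proof -
  obtain c where c: "\<And>z. F z = (\<Sum>j<N. c j * (Re z ^ (N - 1 - j) * Im z ^ j))"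
    using assms(2) unfolding hpoly_def by blast
  show ?thesis
    unfolding c by (intro Bochner_Integration.integrable_sum integrable_mult_right integrable_monomial lam)
qed

lemma integral_monomial_sum:
  assumes lam: "lam \<ge> 0"
  shows "integrable (sigma_lambda lam) (\<lambda>z. \<Sum>j<N. c j * (Re z ^ p j * Im z ^ q j))"
    and "(\<integral>z. (\<Sum>j<N. c j * (Re z ^ p j * Im z ^ q j)) \<partial>sigma_lambda lam) = (\<Sum>j<N. c j * signed_moment lam (p j) (q j))"
  using integrable_monomial[OF lam]
  by (auto simp: Bochner_Integration.integral_sum integral_monomial[OF lam] intro!: Bochner_Integration.integrable_sum)

text \<open>
  For a monomial both sides are given by \<open>signed_moment_x\<close>; the general case is linear in the coefficients.
\<close>

lemma hpoly_integral_x: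
  assumes lam: "lam \<ge> 0" and F: "hpoly (Suc d) F"
    and Fx: "\<And>z. ((\<lambda>t. F (z + of_real t)) has_real_derivative Fx z) (at 0)"
  shows "integrable (sigma_lambda lam) Fx"
    and "(\<integral>z. Fx z \<partial>sigma_lambda lam) = (real d + 2 * lam + 3) * (\<integral>z. Re z * F z \<partial>sigma_lambda lam)"
proof -
  obtain c where c: "\<And>z. F z = (\<Sum>j<Suc d. c j * (Re z ^ (d - j) * Im z ^ j))"
    using F unfolding hpoly_def by auto
  have Fx_eq: "Fx z = (\<Sum>j<Suc d. (c j * real (d - j)) * (Re z ^ (d - j - 1) * Im z ^ j))" for z
  proof -
    have "((\<lambda>t. F (z + of_real t)) has_real_derivative (\<Sum>j<Suc d. (c j * real (d - j)) * (Re z ^ (d - j - 1) * Im z ^ j))) (at 0)"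
      unfolding c by (auto intro!: derivative_eq_intros sum.cong simp: mult_ac)
    then show ?thesis
      using Fx DERIV_unique by blast
  qed
  have xF: "Re z * F z = (\<Sum>j<Suc d. c j * (Re z ^ (d - j + 1) * Im z ^ j))" for z
    unfolding c sum_distrib_left by (simp add: mult_ac)
  show "integrable (sigma_lambda lam) Fx"
    unfolding Fx_eq by (rule integral_monomial_sum(1)[OF lam])
  have "(\<integral>z. Fx z \<partial>sigma_lambda lam) = (\<Sum>j<Suc d. (c j * real (d - j)) * signed_moment lam (d - j - 1) j)"
    unfolding Fx_eq by (rule integral_monomial_sum(2)[OF lam])
  also have "\<dots> = (\<Sum>j<Suc d. (real d + 2 * lam + 3) * (c j * signed_moment lam (d - j + 1) j))"
  proof (intro sum.cong refl)
    fix j assume "j \<in> {..<Suc d}"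
    then have "real (d - j) + real j = real d"
      by simp
    then have "real (d - j) * signed_moment lam (d - j - 1) j = (real d + 2 * lam + 3) * signed_moment lam (d - j + 1) j"
      using signed_moment_x[OF lam, of "d - j" j] by (simp only:)
    then show "(c j * real (d - j)) * signed_moment lam (d - j - 1) j = (real d + 2 * lam + 3) * (c j * signed_moment lam (d - j + 1) j)"
      by (simp only: mult.assoc mult.left_commute)
  qed
  also have "\<dots> = (real d + 2 * lam + 3) * (\<integral>z. Re z * F z \<partial>sigma_lambda lam)"
    unfolding xF integral_monomial_sum(2)[OF lam] sum_distrib_left ..
  finally show "(\<integral>z. Fx z \<partial>sigma_lambda lam) = (real d + 2 * lam + 3) * (\<integral>z. Re z * F z \<partial>sigma_lambda lam)" .
qed

text \<open>
  Here \<open>Gy + 2 * lam * H\<close> is the weighted \<open>y\<close>-divergence of \<open>G = y H\<close>, that is, the derivative of the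
  product of \<open>G\<close> and \<open>|y|\<close> to the power \<open>2 \<lambda>\<close>, divided by that power.
\<close>

lemma hpoly_integral_y:
  assumes lam: "lam \<ge> 0" and H: "hpoly d H"
    and Gy: "\<And>z. ((\<lambda>t. Im (z + \<i> * of_real t) * H (z + \<i> * of_real t)) has_real_derivative Gy z) (at 0)"
  shows "integrable (sigma_lambda lam) (\<lambda>z. Gy z + 2 * lam * H z)"
    and "(\<integral>z. Gy z + 2 * lam * H z \<partial>sigma_lambda lam) = (real d + 2 * lam + 3) * (\<integral>z. Im z * (Im z * H z) \<partial>sigma_lambda lam)"
proof -
  obtain c where c: "\<And>z. H z = (\<Sum>j<d. c j * (Re z ^ (d - 1 - j) * Im z ^ j))"
    using H unfolding hpoly_def by auto
  have Gy_eq: "Gy z = (\<Sum>j<d. (c j * (real j + 1)) * (Re z ^ (d - 1 - j) * Im z ^ j))" for z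
  proof -
    have "Im w * H w = (\<Sum>j<d. c j * (Re w ^ (d - 1 - j) * Im w ^ Suc j))" for w
      unfolding c sum_distrib_left by (simp add: mult_ac)
    moreover have "((\<lambda>t. \<Sum>j<d. c j * (Re (z + \<i> * of_real t) ^ (d - 1 - j) * Im (z + \<i> * of_real t) ^ Suc j))
       has_real_derivative (\<Sum>j<d. (c j * (real j + 1)) * (Re z ^ (d - 1 - j) * Im z ^ j))) (at 0)"
      by (auto intro!: derivative_eq_intros sum.cong simp del: power_Suc simp: algebra_simps)
    ultimately have "((\<lambda>t. Im (z + \<i> * of_real t) * H (z + \<i> * of_real t))
       has_real_derivative (\<Sum>j<d. (c j * (real j + 1)) * (Re z ^ (d - 1 - j) * Im z ^ j))) (at 0)"
      by (simp only:)
    then show ?thesis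
      by (rule DERIV_unique[OF Gy])
  qed
  have eq: "Gy z + 2 * lam * H z = (\<Sum>j<d. (c j * (real j + 1 + 2 * lam)) * (Re z ^ (d - 1 - j) * Im z ^ j))" for z
    unfolding Gy_eq c sum_distrib_left sum.distrib[symmetric] by (simp add: algebra_simps)
  have yyH: "Im z * (Im z * H z) = (\<Sum>j<d. c j * (Re z ^ (d - 1 - j) * Im z ^ (j + 2)))" for z
    unfolding c sum_distrib_left by (simp add: power_add power2_eq_square mult_ac)
  show "integrable (sigma_lambda lam) (\<lambda>z. Gy z + 2 * lam * H z)"
    unfolding eq by (rule integral_monomial_sum(1)[OF lam])
  have "(\<integral>z. Gy z + 2 * lam * H z \<partial>sigma_lambda lam) = (\<Sum>j<d. (c j * (real j + 1 + 2 * lam)) * signed_moment lam (d - 1 - j) j)"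
    unfolding eq by (rule integral_monomial_sum(2)[OF lam])
  also have "\<dots> = (\<Sum>j<d. (real d + 2 * lam + 3) * (c j * signed_moment lam (d - 1 - j) (j + 2)))"
  proof (intro sum.cong refl)
    fix j assume "j \<in> {..<d}"
    then have "real (d - 1 - j) + real j + 2 * lam + 4 = real d + 2 * lam + 3"
      by (simp add: of_nat_diff)
    then have "(real j + 1 + 2 * lam) * signed_moment lam (d - 1 - j) j = (real d + 2 * lam + 3) * signed_moment lam (d - 1 - j) (j + 2)"
      using signed_moment_y[OF lam, of j "d - 1 - j"] by (simp only:)
    then show "(c j * (real j + 1 + 2 * lam)) * signed_moment lam (d - 1 - j) j = (real d + 2 * lam + 3) * (c j * signed_moment lam (d - 1 - j) (j + 2))"
      by (simp only: mult.assoc mult.left_commute)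
  qed
  also have "\<dots> = (real d + 2 * lam + 3) * (\<integral>z. Im z * (Im z * H z) \<partial>sigma_lambda lam)"
    unfolding yyH integral_monomial_sum(2)[OF lam] sum_distrib_left ..
  finally show "(\<integral>z. Gy z + 2 * lam * H z \<partial>sigma_lambda lam) = (real d + 2 * lam + 3) * (\<integral>z. Im z * (Im z * H z) \<partial>sigma_lambda lam)" .
qed

text \<open>
  The divergence theorem on the disk for the field \<open>(F, y H)\<close> and the density of the measure: for a
  homogeneous field the flux through the circle is proportional to the integral of \<open>x F + y G\<close> over the
  disk.
\<close>

lemma hpoly_divergence:
  assumes lam: "lam \<ge> 0" and F: "hpoly (Suc d) F" and H: "hpoly d H"
    and Fx: "\<And>z. ((\<lambda>t. F (z + of_real t)) has_real_derivative Fx z) (at 0)"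
    and Gy: "\<And>z. ((\<lambda>t. Im (z + \<i> * of_real t) * H (z + \<i> * of_real t)) has_real_derivative Gy z) (at 0)"
  shows "(\<integral>z. Fx z + Gy z + 2 * lam * H z \<partial>sigma_lambda lam) =
     (real d + 2 * lam + 3) * (\<integral>z. Re z * F z + Im z * (Im z * H z) \<partial>sigma_lambda lam)"
proof -
  have "(\<integral>z. Fx z + Gy z + 2 * lam * H z \<partial>sigma_lambda lam) = (\<integral>z. Fx z + (Gy z + 2 * lam * H z) \<partial>sigma_lambda lam)"
    by (simp add: add.assoc)
  also have "\<dots> = (\<integral>z. Fx z \<partial>sigma_lambda lam) + (\<integral>z. Gy z + 2 * lam * H z \<partial>sigma_lambda lam)"
    by (intro Bochner_Integration.integral_add hpoly_integral_x(1)[OF lam F Fx] hpoly_integral_y(1)[OF lam H Gy])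
  also have "\<dots> = (real d + 2 * lam + 3) * ((\<integral>z. Re z * F z \<partial>sigma_lambda lam) + (\<integral>z. Im z * (Im z * H z) \<partial>sigma_lambda lam))"
    unfolding hpoly_integral_x(2)[OF lam F Fx] hpoly_integral_y(2)[OF lam H Gy] by (simp add: distrib_left)
  also have "(\<integral>z. Re z * F z \<partial>sigma_lambda lam) + (\<integral>z. Im z * (Im z * H z) \<partial>sigma_lambda lam)
      = (\<integral>z. Re z * F z + Im z * (Im z * H z) \<partial>sigma_lambda lam)"
    by (intro Bochner_Integration.integral_add[symmetric] hpoly_integrable[OF lam hpoly_Re[OF F]]
        hpoly_integrable[OF lam hpoly_Im[OF hpoly_Im[OF H]]])
  finally show ?thesis .
qed

section \<open>Orthogonality of the polynomials \<open>\<phi>\<^sub>n\<close>\<close>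

text \<open>
  The real and imaginary parts \<open>U\<^sub>n\<close> and \<open>V\<^sub>n\<close>, and the quotient \<open>V\<^sub>n / y\<close>, which is a polynomial.
\<close>

definition phat_re :: "real \<Rightarrow> nat \<Rightarrow> complex \<Rightarrow> real" where
  "phat_re lam n z = Re (phat lam n z)"

definition phat_im :: "real \<Rightarrow> nat \<Rightarrow> complex \<Rightarrow> real" where
  "phat_im lam n z = Im (phat lam n z)"

definition phat_im_over_y :: "real \<Rightarrow> nat \<Rightarrow> complex \<Rightarrow> real" where
  "phat_im_over_y lam n z = (case n of 0 \<Rightarrow> 0 | Suc m \<Rightarrow> Re (psi lam m z))"

text \<open>
  The factor in \<open>\<partial>\<^sub>x phat\<^sub>n = kap\<^sub>n phat\<^sub>n\<^sub>-\<^sub>1\<close>. It vanishes at \<open>n = 0\<close>, so that the truncated index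
  \<open>n - 1\<close> does no harm there.
\<close>

definition kap :: "real \<Rightarrow> nat \<Rightarrow> real" where
  "kap lam n = (if n = 0 then 0 else real n + 2 * lam)"

lemma psi_eq_of_real: "psi lam m z = of_real (Re (psi lam m z))"
  using cnj_psi[of lam m z] by (simp add: complex_eq_iff)

lemma phat_im_eq: "phat_im lam n z = Im z * phat_im_over_y lam n z"
proof (cases n)
  case (Suc m)
  have "2 * \<i> * of_real (Im (phat lam n z)) = phat lam n z - cnj (phat lam n z)"
    by (simp add: complex_eq_iff)
  also have "\<dots> = (z - cnj z) * of_real (Re (psi lam m z))"
    unfolding cnj_phat Suc phat_reflect_diff by (metis psi_eq_of_real)
  finally show ?thesis
    by (simp add: phat_im_def phat_im_over_y_def Suc complex_eq_iff)
qed (simp add: phat_im_def phat_im_over_y_def)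

lemma hpoly_mon: "hpoly (Suc (j + k)) (\<lambda>z. Re (mon j k z)) \<and> hpoly (Suc (j + k)) (\<lambda>z. Im (mon j k z))"
proof (induction j)
  case 0
  show ?case
  proof (induction k)
    case 0
    show ?case
      using hpoly_const[of 1] hpoly_const[of 0] by (simp add: mon_def)
  next
    case (Suc k)
    have "Re (mon 0 (Suc k) z) = Re z * Re (mon 0 k z) - Im z * Im (mon 0 k z)"
      "Im (mon 0 (Suc k) z) = Re z * Im (mon 0 k z) + Im z * Re (mon 0 k z)" for z
      by (simp_all add: mon_def)
    then show ?case
      using hpoly_diff[OF hpoly_Re[OF conjunct1[OF Suc]] hpoly_Im[OF conjunct2[OF Suc]]]
        hpoly_add[OF hpoly_Re[OF conjunct2[OF Suc]] hpoly_Im[OF conjunct1[OF Suc]]] by simp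
  qed
next
  case (Suc j)
  have "Re (mon (Suc j) k z) = Re z * Re (mon j k z) + Im z * Im (mon j k z)"
    "Im (mon (Suc j) k z) = Re z * Im (mon j k z) - Im z * Re (mon j k z)" for z
    by (simp_all add: mon_def mult.assoc)
  then show ?case
    using hpoly_add[OF hpoly_Re[OF conjunct1[OF Suc]] hpoly_Im[OF conjunct2[OF Suc]]]
      hpoly_diff[OF hpoly_Re[OF conjunct2[OF Suc]] hpoly_Im[OF conjunct1[OF Suc]]] by simp
qed

lemma hpoly_mon_sum:
  "hpoly (Suc n) (\<lambda>z. Re (\<Sum>j\<le>n. of_real (c j) * mon j (n - j) z))"
  "hpoly (Suc n) (\<lambda>z. Im (\<Sum>j\<le>n. of_real (c j) * mon j (n - j) z))"
proof -
  have m: "hpoly (Suc n) (\<lambda>z. Re (mon j (n - j) z)) \<and> hpoly (Suc n) (\<lambda>z. Im (mon j (n - j) z))" if "j \<in> {..n}" for j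
    using hpoly_mon[of j "n - j"] that by simp
  have "hpoly (Suc n) (\<lambda>z. \<Sum>j\<le>n. c j * Re (mon j (n - j) z))" "hpoly (Suc n) (\<lambda>z. \<Sum>j\<le>n. c j * Im (mon j (n - j) z))"
    by (intro hpoly_sum hpoly_scale; use m in blast)+
  then show "hpoly (Suc n) (\<lambda>z. Re (\<Sum>j\<le>n. of_real (c j) * mon j (n - j) z))"
    "hpoly (Suc n) (\<lambda>z. Im (\<Sum>j\<le>n. of_real (c j) * mon j (n - j) z))"
    by simp_all
qed

lemma hpoly_phat_re: "hpoly (Suc n) (phat_re lam n)"
  unfolding phat_re_def[abs_def] phat_def by (rule hpoly_mon_sum)

lemma hpoly_phat_im: "hpoly (Suc n) (phat_im lam n)"
  unfolding phat_im_def[abs_def] phat_def by (rule hpoly_mon_sum)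

lemma hpoly_phat_im_over_y: "hpoly n (phat_im_over_y lam n)"
proof (cases n)
  case 0
  then show ?thesis
    using hpoly_zero[of 0] by (simp add: phat_im_over_y_def[abs_def])
next
  case (Suc m)
  then show ?thesis
    unfolding phat_im_over_y_def[abs_def] psi_def by (simp only: nat.case hpoly_mon_sum)
qed

lemma phat1_1: "phat1 lam n z 1 = of_real (kap lam n) * phat lam (n - 1) z"
  by (cases n) (simp_all add: phat1_Suc_apply kap_def)

lemma phat1_i: "phat1 lam n z \<i> = \<i> * (of_real (kap lam n) * phat lam (n - 1) z - 2 * of_real lam * of_real (phat_im_over_y lam n z))"
proof (cases n)
  case (Suc m)
  have "phat1 lam n z \<i> = \<i> * (of_real (kap lam n) * phat lam (n - 1) z - 2 * of_real lam * psi lam m z)"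
    by (simp add: Suc phat1_Suc_apply kap_def algebra_simps)
  also have "psi lam m z = of_real (phat_im_over_y lam n z)"
    by (simp add: Suc phat_im_over_y_def psi_eq_of_real[symmetric])
  finally show ?thesis .
qed (simp add: kap_def phat_im_over_y_def)

lemma phat_re_phat_im_derivatives:
  shows "((\<lambda>t. phat_re lam n (z + of_real t)) has_real_derivative kap lam n * phat_re lam (n - 1) z) (at 0)"
    and "((\<lambda>t. phat_im lam n (z + of_real t)) has_real_derivative kap lam n * phat_im lam (n - 1) z) (at 0)"
    and "((\<lambda>t. phat_re lam n (z + \<i> * of_real t)) has_real_derivative - kap lam n * phat_im lam (n - 1) z) (at 0)"
    and "((\<lambda>t. phat_im lam n (z + \<i> * of_real t)) has_real_derivative kap lam n * phat_re lam (n - 1) z - 2 * lam * phat_im_over_y lam n z) (at 0)"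
proof -
  note d = has_real_derivative_along[OF has_derivative_phat[of lam n z]]
  show "((\<lambda>t. phat_re lam n (z + of_real t)) has_real_derivative kap lam n * phat_re lam (n - 1) z) (at 0)"
    "((\<lambda>t. phat_im lam n (z + of_real t)) has_real_derivative kap lam n * phat_im lam (n - 1) z) (at 0)"
    using d[of 1] by (simp_all add: phat1_1 phat_re_def phat_im_def)
  show "((\<lambda>t. phat_re lam n (z + \<i> * of_real t)) has_real_derivative - kap lam n * phat_im lam (n - 1) z) (at 0)"
    "((\<lambda>t. phat_im lam n (z + \<i> * of_real t)) has_real_derivative kap lam n * phat_re lam (n - 1) z - 2 * lam * phat_im_over_y lam n z) (at 0)"
    using d[of \<i>] by (simp_all add: phat1_i phat_re_def phat_im_def)
qed

text \<open>
  If \<open>p + i q\<close> denotes the \<open>x\<close>-derivative of \<open>U\<^sub>n + i V\<^sub>n\<close>, this says that \<open>z (p + i q) = n U\<^sub>n + i (n + 2 \<lambda>) V\<^sub>n\<close>.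
\<close>

lemma z_times_phat_re_phat_im:
  "kap lam n * (Re z * phat_re lam (n - 1) z - Im z * phat_im lam (n - 1) z) = real n * phat_re lam n z"
  "kap lam n * (Re z * phat_im lam (n - 1) z + Im z * phat_re lam (n - 1) z) = (real n + 2 * lam) * phat_im lam n z"
proof -
  have "of_real (kap lam n) * (z * phat lam (n - 1) z) =
     of_nat n * phat lam n z + of_real lam * (2 * \<i> * of_real (phat_im lam n z))"
  proof (cases n)
    case (Suc m)
    have "of_real (kap lam n) * (z * phat lam (n - 1) z) = of_nat n * phat lam n z + of_real lam * ((z - cnj z) * psi lam m z)"
      using z_times_phat[of m lam z] by (simp add: Suc kap_def mult.assoc)
    also have "(z - cnj z) * psi lam m z = phat lam n z - cnj (phat lam n z)"
      by (simp add: Suc phat_reflect_diff cnj_phat)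
    also have "\<dots> = 2 * \<i> * of_real (phat_im lam n z)"
      by (simp add: complex_eq_iff phat_im_def)
    finally show ?thesis .
  qed (simp add: kap_def phat_im_def)
  then show "kap lam n * (Re z * phat_re lam (n - 1) z - Im z * phat_im lam (n - 1) z) = real n * phat_re lam n z"
    "kap lam n * (Re z * phat_im lam (n - 1) z + Im z * phat_re lam (n - 1) z) = (real n + 2 * lam) * phat_im lam n z"
    by (simp_all add: complex_eq_iff phat_re_def phat_im_def distrib_right)
qed

definition ip_re :: "real \<Rightarrow> nat \<Rightarrow> nat \<Rightarrow> real" where
  "ip_re lam m n = (\<integral>z. phat_re lam m z * phat_re lam n z \<partial>sigma_lambda lam)"

definition ip_im :: "real \<Rightarrow> nat \<Rightarrow> nat \<Rightarrow> real" where
  "ip_im lam m n = (\<integral>z. phat_im lam m z * phat_im lam n z \<partial>sigma_lambda lam)"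

lemma ip_commute: "ip_re lam m n = ip_re lam n m" "ip_im lam m n = ip_im lam n m"
  by (simp_all add: ip_re_def ip_im_def mult.commute)

lemma integrable_phat_re_phat_im:
  assumes "lam \<ge> 0"
  shows "integrable (sigma_lambda lam) (\<lambda>z. phat_re lam m z * phat_re lam n z)"
    and "integrable (sigma_lambda lam) (\<lambda>z. phat_im lam m z * phat_im lam n z)"
    and "integrable (sigma_lambda lam) (\<lambda>z. phat_re lam m z * phat_im lam n z)"
  by (rule hpoly_integrable[OF assms hpoly_mult[OF hpoly_phat_re hpoly_phat_re]]
    hpoly_integrable[OF assms hpoly_mult[OF hpoly_phat_im hpoly_phat_im]]
    hpoly_integrable[OF assms hpoly_mult[OF hpoly_phat_re hpoly_phat_im]])+

text \<open>
  Write \<open>u + i v\<close> for the polynomial of index \<open>m\<close> and \<open>p + i q\<close> for the \<open>x\<close>-derivative of the one of index \<open>n\<close>,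
  which is \<open>kap lam n\<close> times the one of index \<open>n - 1\<close>.
  By the Cauchy-Riemann systems the field \<open>(u p - v q, - (u q + v p))\<close> has weighted divergence 0, so the real
  part of \<open>z (u + i v) (p + i q)\<close> has integral 0. By \<open>z_times_phat_re_phat_im\<close> this is the claim.
\<close>

lemma ip_conjugate_relation:
  assumes lam: "lam \<ge> 0"
  shows "real n * ip_re lam m n = (real n + 2 * lam) * ip_im lam m n"
proof (cases n)
  case 0
  then show ?thesis
    by (simp add: ip_im_def phat_im_def)
next
  case (Suc l)
  let ?d = "m + l"
  let ?u = "phat_re lam m" and ?v = "phat_im lam m" and ?w = "phat_im_over_y lam m" and ?u1 = "phat_re lam (m - 1)" and ?v1 = "phat_im lam (m - 1)"
  let ?p = "phat_re lam l" and ?q = "phat_im lam l" and ?s = "phat_im_over_y lam l" and ?p1 = "phat_re lam (l - 1)" and ?q1 = "phat_im lam (l - 1)"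
  let ?a = "kap lam m" and ?b = "kap lam l" and ?k = "kap lam n"
  let ?Fx = "\<lambda>z. ?k * ((?a * ?u1 z * ?p z + ?b * ?p1 z * ?u z) - (?a * ?v1 z * ?q z + ?b * ?q1 z * ?v z))"
  let ?Gy = "\<lambda>z. - ?k * ((- ?a * ?v1 z * ?q z + (?b * ?p1 z - 2 * lam * ?s z) * ?u z) + (- ?b * ?q1 z * ?v z + (?a * ?u1 z - 2 * lam * ?w z) * ?p z))"
  define F where "F z = ?k * (?u z * ?p z - ?v z * ?q z)" for z
  define H where "H z = - ?k * (?u z * ?s z + ?p z * ?w z)" for z
  have yH: "Im z * H z = - ?k * (?u z * ?q z + ?p z * ?v z)" for z
    by (simp add: H_def phat_im_eq algebra_simps)
  have hF: "hpoly (Suc ?d) F"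
    unfolding F_def[abs_def]
    using hpoly_mult[OF hpoly_phat_re[of m lam] hpoly_phat_re[of l lam]] hpoly_mult[OF hpoly_phat_im[of m lam] hpoly_phat_im[of l lam]]
    by (intro hpoly_scale hpoly_diff) simp_all
  have hH: "hpoly ?d H"
    unfolding H_def[abs_def]
    using hpoly_mult[OF hpoly_phat_re[of m lam] hpoly_phat_im_over_y[of l lam]] hpoly_mult[OF hpoly_phat_re[of l lam] hpoly_phat_im_over_y[of m lam]]
    by (intro hpoly_scale hpoly_add) (simp_all add: add.commute)
  have "(\<integral>z. ?Fx z
      + ?Gy z
      + 2 * lam * H z \<partial>sigma_lambda lam)
      = (real ?d + 2 * lam + 3) * (\<integral>z. Re z * F z + Im z * (Im z * H z) \<partial>sigma_lambda lam)"
  proof (rule hpoly_divergence[OF lam hF hH])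
    fix z
    show "((\<lambda>t. F (z + of_real t)) has_real_derivative
       ?Fx z) (at 0)"
      unfolding F_def
      using DERIV_cmult[OF DERIV_diff[OF DERIV_mult[OF phat_re_phat_im_derivatives(1)[of lam m z] phat_re_phat_im_derivatives(1)[of lam l z]]
         DERIV_mult[OF phat_re_phat_im_derivatives(2)[of lam m z] phat_re_phat_im_derivatives(2)[of lam l z]]], of "?k"] by simp
    show "((\<lambda>t. Im (z + \<i> * of_real t) * H (z + \<i> * of_real t)) has_real_derivative
      ?Gy z) (at 0)"
      unfolding yH
      using DERIV_cmult[OF DERIV_add[OF DERIV_mult[OF phat_re_phat_im_derivatives(3)[of lam m z] phat_re_phat_im_derivatives(4)[of lam l z]]
         DERIV_mult[OF phat_re_phat_im_derivatives(3)[of lam l z] phat_re_phat_im_derivatives(4)[of lam m z]]], of "- ?k"] by simp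
  qed
  moreover have "?Fx z
      + ?Gy z
      + 2 * lam * H z = 0" for z
    unfolding H_def by (simp add: algebra_simps)
  moreover have "Re z * F z + Im z * (Im z * H z) = real n * (?u z * phat_re lam n z) - (real n + 2 * lam) * (?v z * phat_im lam n z)" for z
  proof -
    have "Re z * F z + Im z * (Im z * H z) = ?u z * (?k * (Re z * ?p z - Im z * ?q z))
       - ?v z * (?k * (Re z * ?q z + Im z * ?p z))"
      unfolding yH F_def by (simp add: algebra_simps)
    also have "\<dots> = ?u z * (real n * phat_re lam n z) - ?v z * ((real n + 2 * lam) * phat_im lam n z)"
      using z_times_phat_re_phat_im[of lam n z] Suc by (simp only: diff_Suc_1)
    finally show ?thesis
      by (simp add: algebra_simps)
  qed
  ultimately have e0: "0 = (real ?d + 2 * lam + 3) *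
     (\<integral>z. real n * (?u z * phat_re lam n z) - (real n + 2 * lam) * (?v z * phat_im lam n z) \<partial>sigma_lambda lam)"
    by simp
  have nz: "real ?d + 2 * lam + 3 \<noteq> 0"
    using lam by linarith
  have cancel: "x = 0" if "0 = c * x" "c \<noteq> 0" for c x :: real
    using that by simp
  have "(\<integral>z. real n * (?u z * phat_re lam n z) - (real n + 2 * lam) * (?v z * phat_im lam n z) \<partial>sigma_lambda lam) = 0"
    by (rule cancel[OF e0 nz])
  moreover have "(\<integral>z. real n * (?u z * phat_re lam n z) - (real n + 2 * lam) * (?v z * phat_im lam n z) \<partial>sigma_lambda lam)
     = real n * ip_re lam m n - (real n + 2 * lam) * ip_im lam m n"
    unfolding ip_re_def ip_im_def
    by (subst Bochner_Integration.integral_diff) (auto intro!: integrable_mult_right integrable_phat_re_phat_im[OF lam])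
  ultimately show ?thesis
    by simp
qed

text \<open>
  In the same notation the field \<open>(u p + v q, v p - u q)\<close> has weighted divergence \<open>2 (u\<^sub>x p + v\<^sub>x q)\<close>, and
  its product with the position vector is \<open>n u U\<^sub>n + (n + 2 \<lambda>) v V\<^sub>n\<close>.
\<close>

lemma ip_derivative_relation:
  assumes lam: "lam \<ge> 0" and n: "n > 0"
  shows "2 * kap lam m * kap lam n * (ip_re lam (m - 1) (n - 1) + ip_im lam (m - 1) (n - 1)) =
     (real m + real n + 2 * lam + 2) * (real n * ip_re lam m n + (real n + 2 * lam) * ip_im lam m n)"
proof -
  obtain l where l: "n = Suc l"
    using n gr0_implies_Suc by blast
  let ?d = "m + l"
  let ?u = "phat_re lam m" and ?v = "phat_im lam m" and ?w = "phat_im_over_y lam m" and ?u1 = "phat_re lam (m - 1)" and ?v1 = "phat_im lam (m - 1)"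
  let ?p = "phat_re lam l" and ?q = "phat_im lam l" and ?s = "phat_im_over_y lam l" and ?p1 = "phat_re lam (l - 1)" and ?q1 = "phat_im lam (l - 1)"
  let ?a = "kap lam m" and ?b = "kap lam l" and ?k = "kap lam n"
  let ?Fx = "\<lambda>z. ?k * ((?a * ?u1 z * ?p z + ?b * ?p1 z * ?u z) + (?a * ?v1 z * ?q z + ?b * ?q1 z * ?v z))"
  let ?Gy = "\<lambda>z. ?k * ((- ?b * ?q1 z * ?v z + (?a * ?u1 z - 2 * lam * ?w z) * ?p z) - (- ?a * ?v1 z * ?q z + (?b * ?p1 z - 2 * lam * ?s z) * ?u z))"
  define F where "F z = ?k * (?u z * ?p z + ?v z * ?q z)" for z
  define H where "H z = ?k * (?p z * ?w z - ?u z * ?s z)" for z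
  have yH: "Im z * H z = ?k * (?p z * ?v z - ?u z * ?q z)" for z
    by (simp add: H_def phat_im_eq algebra_simps)
  have hF: "hpoly (Suc ?d) F"
    unfolding F_def[abs_def]
    using hpoly_mult[OF hpoly_phat_re[of m lam] hpoly_phat_re[of l lam]] hpoly_mult[OF hpoly_phat_im[of m lam] hpoly_phat_im[of l lam]]
    by (intro hpoly_scale hpoly_add) simp_all
  have hH: "hpoly ?d H"
    unfolding H_def[abs_def]
    using hpoly_mult[OF hpoly_phat_re[of m lam] hpoly_phat_im_over_y[of l lam]] hpoly_mult[OF hpoly_phat_re[of l lam] hpoly_phat_im_over_y[of m lam]]
    by (intro hpoly_scale hpoly_diff) (simp_all add: add.commute)
  have "(\<integral>z. ?Fx z
      + ?Gy z
      + 2 * lam * H z \<partial>sigma_lambda lam)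
      = (real ?d + 2 * lam + 3) * (\<integral>z. Re z * F z + Im z * (Im z * H z) \<partial>sigma_lambda lam)"
  proof (rule hpoly_divergence[OF lam hF hH])
    fix z
    show "((\<lambda>t. F (z + of_real t)) has_real_derivative
       ?Fx z) (at 0)"
      unfolding F_def
      using DERIV_cmult[OF DERIV_add[OF DERIV_mult[OF phat_re_phat_im_derivatives(1)[of lam m z] phat_re_phat_im_derivatives(1)[of lam l z]]
         DERIV_mult[OF phat_re_phat_im_derivatives(2)[of lam m z] phat_re_phat_im_derivatives(2)[of lam l z]]], of "?k"] by simp
    show "((\<lambda>t. Im (z + \<i> * of_real t) * H (z + \<i> * of_real t)) has_real_derivative
      ?Gy z) (at 0)"
      unfolding yH
      using DERIV_cmult[OF DERIV_diff[OF DERIV_mult[OF phat_re_phat_im_derivatives(3)[of lam l z] phat_re_phat_im_derivatives(4)[of lam m z]]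
         DERIV_mult[OF phat_re_phat_im_derivatives(3)[of lam m z] phat_re_phat_im_derivatives(4)[of lam l z]]], of "?k"] by simp
  qed
  moreover have "?Fx z
      + ?Gy z
      + 2 * lam * H z = 2 * ?a * ?k * (?u1 z * ?p z + ?v1 z * ?q z)" for z
    unfolding H_def by (simp add: algebra_simps)
  moreover have "Re z * F z + Im z * (Im z * H z) = real n * (?u z * phat_re lam n z) + (real n + 2 * lam) * (?v z * phat_im lam n z)" for z
  proof -
    have "Re z * F z + Im z * (Im z * H z) = ?u z * (?k * (Re z * ?p z - Im z * ?q z))
       + ?v z * (?k * (Re z * ?q z + Im z * ?p z))"
      unfolding yH F_def by (simp add: algebra_simps)
    also have "\<dots> = ?u z * (real n * phat_re lam n z) + ?v z * ((real n + 2 * lam) * phat_im lam n z)"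
      using z_times_phat_re_phat_im[of lam n z] l by (simp only: diff_Suc_1)
    finally show ?thesis
      by (simp add: algebra_simps)
  qed
  ultimately have "(\<integral>z. 2 * ?a * ?k * (?u1 z * ?p z + ?v1 z * ?q z) \<partial>sigma_lambda lam)
     = (real ?d + 2 * lam + 3) *
     (\<integral>z. real n * (?u z * phat_re lam n z) + (real n + 2 * lam) * (?v z * phat_im lam n z) \<partial>sigma_lambda lam)"
    by (simp only:)
  moreover have "(\<integral>z. real n * (?u z * phat_re lam n z) + (real n + 2 * lam) * (?v z * phat_im lam n z) \<partial>sigma_lambda lam)
     = real n * ip_re lam m n + (real n + 2 * lam) * ip_im lam m n"
    unfolding ip_re_def ip_im_def
    by (subst Bochner_Integration.integral_add) (auto intro!: integrable_mult_right integrable_phat_re_phat_im[OF lam])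
  moreover have "(\<integral>z. 2 * ?a * ?k * (?u1 z * ?p z + ?v1 z * ?q z) \<partial>sigma_lambda lam)
     = 2 * ?a * ?k * (ip_re lam (m - 1) l + ip_im lam (m - 1) l)"
    unfolding ip_re_def ip_im_def
    by (subst Bochner_Integration.integral_add[symmetric]) (auto intro!: integrable_phat_re_phat_im[OF lam])
  moreover have "real ?d + 2 * lam + 3 = real m + real n + 2 * lam + 2" "n - 1 = l"
    using l by auto
  ultimately show ?thesis
    by (simp only:)
qed

text \<open>
  The left side of \<open>ip_derivative_relation\<close> is symmetric in \<open>m\<close> and \<open>n\<close>. For positive indices, comparing with the
  exchanged relation gives \<open>(n - m) (ip_re + ip_im) = 0\<close>, while \<open>ip_conjugate_relation\<close> says that \<open>ip_re\<close> and \<open>ip_im\<close>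
  are proportional with nonnegative factors; so both vanish.
\<close>

lemma ip_orthogonal:
  assumes lam: "lam \<ge> 0" and mn: "m \<noteq> n"
  shows "ip_re lam m n = 0 \<and> ip_im lam m n = 0"
proof -
  have zero: "ip_re lam m n = 0 \<and> ip_im lam m n = 0"
    if n: "n > 0" and s: "real n * ip_re lam m n + (real n + 2 * lam) * ip_im lam m n = 0" for m n
  proof -
    have r: "real n * ip_re lam m n = (real n + 2 * lam) * ip_im lam m n"
      by (rule ip_conjugate_relation[OF lam])
    have "real n * ip_re lam m n = 0" "(real n + 2 * lam) * ip_im lam m n = 0"
      using r s by linarith+
    then show ?thesis
      using n lam by (auto simp: add_pos_nonneg less_imp_neq[symmetric] add_nonneg_eq_0_iff)
  qed
  have main: "ip_re lam m n = 0 \<and> ip_im lam m n = 0" if "n > 0" "m \<noteq> n" for m n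
  proof (cases "m = 0")
    case True
    have "(real m + real n + 2 * lam + 2) * (real n * ip_re lam m n + (real n + 2 * lam) * ip_im lam m n) = 0"
      using ip_derivative_relation[OF lam \<open>n > 0\<close>, of m] True by (simp add: kap_def)
    moreover have "real m + real n + 2 * lam + 2 \<noteq> 0"
      using lam by linarith
    ultimately show ?thesis
      using zero[OF \<open>n > 0\<close>] by (metis mult_eq_0_iff)
  next
    case False
    define A where "A = ip_re lam m n + ip_im lam m n"
    have k: "real m + real n + 2 * lam + 2 \<noteq> 0"
      using lam by linarith
    have e1: "2 * kap lam m * kap lam n * (ip_re lam (m - 1) (n - 1) + ip_im lam (m - 1) (n - 1)) =
       (real m + real n + 2 * lam + 2) * (real n * ip_re lam m n + (real n + 2 * lam) * ip_im lam m n)"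
      using ip_derivative_relation[OF lam \<open>n > 0\<close>] .
    have e2: "2 * kap lam m * kap lam n * (ip_re lam (m - 1) (n - 1) + ip_im lam (m - 1) (n - 1)) =
       (real m + real n + 2 * lam + 2) * (real m * ip_re lam m n + (real m + 2 * lam) * ip_im lam m n)"
    proof -
      have "2 * kap lam n * kap lam m * (ip_re lam (n - 1) (m - 1) + ip_im lam (n - 1) (m - 1)) =
          (real n + real m + 2 * lam + 2) * (real m * ip_re lam n m + (real m + 2 * lam) * ip_im lam n m)"
        using False by (intro ip_derivative_relation[OF lam]) simp
      then show ?thesis
        unfolding ip_commute[of lam n m] ip_commute[of lam "n - 1" "m - 1"]
        by (simp only: ac_simps)
    qed
    have "real n * ip_re lam m n + (real n + 2 * lam) * ip_im lam m n = real m * ip_re lam m n + (real m + 2 * lam) * ip_im lam m n"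
      using e1 e2 k by (metis mult_cancel_left)
    then have "(real n - real m) * A = 0"
      by (simp add: A_def algebra_simps)
    then have A: "ip_im lam m n = - ip_re lam m n"
      using \<open>m \<noteq> n\<close> by (simp add: A_def)
    have "real n * ip_re lam m n = (real n + 2 * lam) * ip_im lam m n"
      by (rule ip_conjugate_relation[OF lam])
    then have "(real n + (real n + 2 * lam)) * ip_re lam m n = 0"
      unfolding A by (simp add: algebra_simps)
    moreover have "real n + (real n + 2 * lam) \<noteq> 0"
      using \<open>n > 0\<close> lam by auto
    ultimately show ?thesis
      using A by simp
  qed
  show ?thesis
  proof (cases "n > 0")
    case True
    then show ?thesis
      using main mn by blast
  next
    case False
    then show ?thesis
      using main[of m n] mn by (metis ip_commute neq0_conv main)
  qed
qed

definition phat_norm_sq :: "real \<Rightarrow> nat \<Rightarrow> real" where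
  "phat_norm_sq lam n = (lam + 1) / (real n + lam + 1) * rising_coeff (2 * lam + 1) n"

text \<open>
  On the diagonal the two relations give a recursion in \<open>n\<close> for the squared norm. Since \<open>n ip_re = (n + 2 \<lambda>)
  ip_im\<close>, the real part carries at least half of it.
\<close>

lemma ip_norm:
  assumes lam: "lam \<ge> 0"
  shows "ip_re lam n n + ip_im lam n n = phat_norm_sq lam n \<and> ip_re lam n n \<ge> phat_norm_sq lam n / 2"
proof (induction n)
  case 0
  have "ip_re lam 0 0 = 1"
    using integral_monomial[OF lam, of 0 0] moment_0_0[OF lam]
    by (simp add: ip_re_def phat_re_def signed_moment_def)
  moreover have "ip_im lam 0 0 = 0"
    by (simp add: ip_im_def phat_im_def)
  ultimately show ?case
    using lam by (simp add: phat_norm_sq_def)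
next
  case (Suc m)
  let ?n = "real m + 1"
  let ?A = "ip_re lam (Suc m) (Suc m)" and ?B = "ip_im lam (Suc m) (Suc m)"
  have k: "kap lam (Suc m) = ?n + 2 * lam" "real (Suc m) = ?n"
    by (simp_all add: kap_def)
  have pos: "?n + 2 * lam > 0" "?n > 0" "?n + lam + 1 > 0" "?n + lam > 0"
    using lam by auto
  have r: "?n * ?A = (?n + 2 * lam) * ?B"
    using ip_conjugate_relation[OF lam, of "Suc m" "Suc m"] unfolding k .
  have "2 * (?n + 2 * lam) * (?n + 2 * lam) * phat_norm_sq lam m = (2 * ?n + 2 * lam + 2) * (?n * ?A + (?n + 2 * lam) * ?B)"
  proof -
    have "2 * kap lam (Suc m) * kap lam (Suc m) * (ip_re lam m m + ip_im lam m m) =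
       (real (Suc m) + real (Suc m) + 2 * lam + 2) * (real (Suc m) * ?A + (real (Suc m) + 2 * lam) * ?B)"
      using ip_derivative_relation[OF lam zero_less_Suc, of "Suc m" m] by (simp only: diff_Suc_1)
    then show ?thesis
      unfolding k conjunct1[OF Suc] by (simp only: mult_2)
  qed
  also have "\<dots> = 4 * (?n + lam + 1) * (?n + 2 * lam) * ?B"
    unfolding r by (simp add: algebra_simps)
  finally have "(?n + 2 * lam) * ((?n + 2 * lam) * phat_norm_sq lam m) = (?n + 2 * lam) * (2 * (?n + lam + 1) * ?B)"
    by (simp add: algebra_simps)
  then have B: "(?n + 2 * lam) * phat_norm_sq lam m = 2 * (?n + lam + 1) * ?B"
    using pos by simp
  have N: "phat_norm_sq lam (Suc m) * (?n * (?n + lam + 1)) = (?n + 2 * lam) * (?n + lam) * phat_norm_sq lam m"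
  proof -
    have rc: "?n * rising_coeff (2 * lam + 1) (Suc m) = (?n + 2 * lam) * rising_coeff (2 * lam + 1) m"
      using rising_coeff_Suc[of m "2 * lam + 1"] by (simp add: algebra_simps)
    have "phat_norm_sq lam (Suc m) * (?n * (?n + lam + 1)) = (lam + 1) * (?n * rising_coeff (2 * lam + 1) (Suc m))"
      using pos by (simp add: phat_norm_sq_def add.commute)
    also have "\<dots> = (?n + 2 * lam) * (?n + lam) * phat_norm_sq lam m"
      unfolding rc using pos by (simp add: phat_norm_sq_def add.commute add.left_commute)
    finally show ?thesis .
  qed
  have "(?A + ?B) * (?n * (?n + lam + 1)) = (?n * ?A + ?n * ?B) * (?n + lam + 1)"
    by (simp add: algebra_simps)
  also have "\<dots> = (?n + lam) * (2 * (?n + lam + 1) * ?B)"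
    unfolding r by (simp add: algebra_simps)
  also have "\<dots> = phat_norm_sq lam (Suc m) * (?n * (?n + lam + 1))"
    unfolding N B[symmetric] by (simp add: algebra_simps)
  finally have sum: "?A + ?B = phat_norm_sq lam (Suc m)"
    using pos by simp
  have "?B \<ge> 0"
    unfolding ip_im_def by (intro Bochner_Integration.integral_nonneg) simp
  then have "?n * ?B \<le> (?n + 2 * lam) * ?B"
    using lam by (intro mult_right_mono) auto
  then have "?n * ?B \<le> ?n * ?A"
    unfolding r .
  then have "?B \<le> ?A"
    using pos by (meson mult_le_cancel_left_pos)
  then show ?case
    using sum by linarith
qed

text \<open>
  The imaginary part of the inner product vanishes because reflection in the real axis conjugates the
  integrand.
\<close>

lemma integral_phat_product:
  assumes lam: "lam \<ge> 0"
  shows "integrable (sigma_lambda lam) (\<lambda>z. phat lam m z * cnj (phat lam n z))"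
    and "(\<integral>z. phat lam m z * cnj (phat lam n z) \<partial>sigma_lambda lam) = of_real (if m = n then phat_norm_sq lam n else 0)"
proof -
  let ?f = "\<lambda>z. phat lam m z * cnj (phat lam n z)"
  have eq: "?f = (\<lambda>z. of_real (phat_re lam m z * phat_re lam n z + phat_im lam m z * phat_im lam n z) + \<i> * of_real (phat_re lam n z * phat_im lam m z - phat_re lam m z * phat_im lam n z))"
    by (rule ext) (simp add: complex_eq_iff phat_re_def phat_im_def algebra_simps)
  show int: "integrable (sigma_lambda lam) ?f"
    unfolding eq by (intro Bochner_Integration.integrable_add integrable_mult_right integrable_of_real
        Bochner_Integration.integrable_diff integrable_phat_re_phat_im[OF lam])
  let ?I = "\<integral>z. ?f z \<partial>sigma_lambda lam"
  have Re: "Re ?I = ip_re lam m n + ip_im lam m n"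
  proof -
    have "Re ?I = (\<integral>z. Re (?f z) \<partial>sigma_lambda lam)"
      using int by (rule integral_Re[symmetric])
    also have "\<dots> = (\<integral>z. phat_re lam m z * phat_re lam n z + phat_im lam m z * phat_im lam n z \<partial>sigma_lambda lam)"
      by (simp add: phat_re_def phat_im_def)
    also have "\<dots> = ip_re lam m n + ip_im lam m n"
      unfolding ip_re_def ip_im_def by (intro Bochner_Integration.integral_add integrable_phat_re_phat_im[OF lam])
    finally show ?thesis .
  qed
  have Im: "Im ?I = 0"
  proof -
    have refl: "Complex (1 * Re z) (- 1 * Im z) = cnj z" for z
      by (simp add: complex_eq_iff)
    have "continuous_on UNIV ?f"
      unfolding phat_def by (intro continuous_intros continuous_on_mon)
    then have "?f \<in> borel_measurable borel"
      by (rule borel_measurable_continuous_onI)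
    from integral_sigma_reflect[OF lam this, of 1 "-1"]
    have "?I = (\<integral>z. cnj (?f z) \<partial>sigma_lambda lam)"
      unfolding refl by (simp add: cnj_phat)
    also have "\<dots> = cnj ?I"
      by (rule Bochner_Integration.integral_cnj)
    finally show ?thesis
      by (metis complex_cnj_cancel_iff cnj.simps(2) equal_neg_zero)
  qed
  have "ip_re lam m n + ip_im lam m n = (if m = n then phat_norm_sq lam n else 0)"
    using ip_orthogonal[OF lam, of m n] ip_norm[OF lam, of n] by auto
  then show "?I = of_real (if m = n then phat_norm_sq lam n else 0)"
    using Re Im by (simp add: complex_eq_iff)
qed

section \<open>A maximum principle for real parts\<close>

lemma DERIV_transform_nhds:
  assumes "\<forall>\<^sub>F t in nhds x. f t = g t" "(g has_real_derivative D) (at x)"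
  shows "(f has_real_derivative D) (at x)"
  using DERIV_cong_ev[OF refl assms(1) refl] assms(2) by (rule iffD2)

text \<open>
  The mean value theorem, first in direction \<open>a\<close> and then in direction \<open>b\<close>, for the second mixed difference.
\<close>

lemma mixed_difference_mean_value:
  fixes v va vab :: "complex \<Rightarrow> real"
  assumes h: "h > 0"
    and S: "\<And>s t. 0 \<le> s \<Longrightarrow> s \<le> h \<Longrightarrow> 0 \<le> t \<Longrightarrow> t \<le> h \<Longrightarrow> z + a * of_real s + b * of_real t \<in> S"
    and va: "\<And>w. w \<in> S \<Longrightarrow> ((\<lambda>t. v (w + a * of_real t)) has_real_derivative va w) (at 0)"
    and vab: "\<And>w. w \<in> S \<Longrightarrow> ((\<lambda>t. va (w + b * of_real t)) has_real_derivative vab w) (at 0)"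
  shows "\<exists>s t. 0 < s \<and> s < h \<and> 0 < t \<and> t < h \<and>
    v (z + a * of_real h + b * of_real h) - v (z + a * of_real h) - v (z + b * of_real h) + v z
      = h\<^sup>2 * vab (z + a * of_real s + b * of_real t)"
proof -
  have va': "((\<lambda>s. v (z + a * of_real s + b * of_real t)) has_real_derivative va (z + a * of_real s + b * of_real t)) (at s)"
    if "0 \<le> s" "s \<le> h" "0 \<le> t" "t \<le> h" for s t
  proof -
    have "((\<lambda>x. v (z + a * of_real (x + s) + b * of_real t)) has_real_derivative va (z + a * of_real s + b * of_real t)) (at 0)"
      using va[OF S[OF that]] by (simp add: algebra_simps)
    then show ?thesis
      using DERIV_shift[of "\<lambda>s. v (z + a * of_real s + b * of_real t)" _ 0 s] by simp
  qed
  have vab': "((\<lambda>t. va (z + a * of_real s + b * of_real t)) has_real_derivative vab (z + a * of_real s + b * of_real t)) (at t)"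
    if "0 \<le> s" "s \<le> h" "0 \<le> t" "t \<le> h" for s t
  proof -
    have "((\<lambda>x. va (z + a * of_real s + b * of_real (x + t))) has_real_derivative vab (z + a * of_real s + b * of_real t)) (at 0)"
      using vab[OF S[OF that]] by (simp add: algebra_simps)
    then show ?thesis
      using DERIV_shift[of "\<lambda>t. va (z + a * of_real s + b * of_real t)" _ 0 t] by simp
  qed
  define p where "p s = v (z + a * of_real s + b * of_real h) - v (z + a * of_real s + b * of_real 0)" for s
  have "\<exists>s. s > 0 \<and> s < h \<and> p h - p 0 = (h - 0) * (va (z + a * of_real s + b * of_real h) - va (z + a * of_real s + b * of_real 0))"
    unfolding p_def using h by (intro MVT2 DERIV_diff va') auto
  then obtain s where s: "0 < s" "s < h" "p h - p 0 = h * (va (z + a * of_real s + b * of_real h) - va (z + a * of_real s + b * of_real 0))"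
    by auto
  have "\<exists>t. t > 0 \<and> t < h \<and> va (z + a * of_real s + b * of_real h) - va (z + a * of_real s + b * of_real 0)
      = (h - 0) * vab (z + a * of_real s + b * of_real t)"
    using h s by (intro MVT2 vab') auto
  then obtain t where t: "0 < t" "t < h" "va (z + a * of_real s + b * of_real h) - va (z + a * of_real s + b * of_real 0)
      = h * vab (z + a * of_real s + b * of_real t)"
    by auto
  have eq: "p h - p 0 = h\<^sup>2 * vab (z + a * of_real s + b * of_real t)"
    using s(3) unfolding t(3) by (simp add: power2_eq_square)
  have "0 < s \<and> s < h \<and> 0 < t \<and> t < h \<and>
    v (z + a * of_real h + b * of_real h) - v (z + a * of_real h) - v (z + b * of_real h) + v z
      = h\<^sup>2 * vab (z + a * of_real s + b * of_real t)"
    using s(1,2) t(1,2) eq[symmetric] by (simp add: p_def)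
  then show ?thesis
    by (rule exI[of _ s, OF exI[of _ t]])
qed

text \<open>
  The second mixed difference is symmetric in the two directions, so both mixed derivatives take a common
  value arbitrarily close to the point.
\<close>

lemma mixed_derivatives_equal:
  fixes v va vb vab vba :: "complex \<Rightarrow> real"
  assumes S: "open S" "z \<in> S" and ab: "norm a = 1" "norm b = 1"
    and va: "\<And>w. w \<in> S \<Longrightarrow> ((\<lambda>t. v (w + a * of_real t)) has_real_derivative va w) (at 0)"
    and vb: "\<And>w. w \<in> S \<Longrightarrow> ((\<lambda>t. v (w + b * of_real t)) has_real_derivative vb w) (at 0)"
    and vab: "\<And>w. w \<in> S \<Longrightarrow> ((\<lambda>t. va (w + b * of_real t)) has_real_derivative vab w) (at 0)"
    and vba: "\<And>w. w \<in> S \<Longrightarrow> ((\<lambda>t. vb (w + a * of_real t)) has_real_derivative vba w) (at 0)"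
    and cont: "isCont vab z" "isCont vba z"
  shows "vab z = vba z"
proof (rule ccontr)
  assume ne: "vab z \<noteq> vba z"
  define e where "e = \<bar>vab z - vba z\<bar> / 2"
  have e: "e > 0"
    using ne by (simp add: e_def)
  obtain d1 where d1: "d1 > 0" "\<And>w. dist w z < d1 \<Longrightarrow> dist (vab w) (vab z) < e"
    using cont(1) e unfolding continuous_at_eps_delta by blast
  obtain d2 where d2: "d2 > 0" "\<And>w. dist w z < d2 \<Longrightarrow> dist (vba w) (vba z) < e"
    using cont(2) e unfolding continuous_at_eps_delta by blast
  obtain d3 where d3: "d3 > 0" "\<And>w. dist w z < d3 \<Longrightarrow> w \<in> S"
    using S unfolding open_dist by blast
  \<comment> \<open>Both intermediate points lie within distance \<open>2 h\<close> of \<open>z\<close>.\<close>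
  define h where "h = min d1 (min d2 d3) / 3"
  have h: "h > 0" "2 * h < d1" "2 * h < d2" "2 * h < d3"
    using d1 d2 d3 by (auto simp: h_def)
  have near: "dist (z + c * of_real s + d * of_real t) z \<le> 2 * h"
    if "norm c = 1" "norm d = 1" "0 \<le> s" "s \<le> h" "0 \<le> t" "t \<le> h" for c d s t
  proof -
    have "dist (z + c * of_real s + d * of_real t) z = norm (c * of_real s + d * of_real t)"
      by (simp add: dist_norm)
    also have "\<dots> \<le> norm (c * of_real s) + norm (d * of_real t)"
      by (rule norm_triangle_ineq)
    also have "\<dots> \<le> 2 * h"
      using that by (simp add: norm_mult)
    finally show ?thesis .
  qed
  let ?D = "v (z + a * of_real h + b * of_real h) - v (z + a * of_real h) - v (z + b * of_real h) + v z"
  obtain s t where st: "0 < s" "s < h" "0 < t" "t < h" "?D = h\<^sup>2 * vab (z + a * of_real s + b * of_real t)"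
    using mixed_difference_mean_value[of h z a b S v va vab] near[OF ab] h d3(2) va vab
    by (smt (verit, ccfv_threshold))
  obtain s' t' where st': "0 < s'" "s' < h" "0 < t'" "t' < h"
    "v (z + b * of_real h + a * of_real h) - v (z + b * of_real h) - v (z + a * of_real h) + v z
       = h\<^sup>2 * vba (z + b * of_real s' + a * of_real t')"
    using mixed_difference_mean_value[of h z b a S v vb vba] near[OF ab(2,1)] h d3(2) vb vba
    by (smt (verit, ccfv_threshold))
  have swap: "z + b * of_real h + a * of_real h = z + a * of_real h + b * of_real h"
    by simp
  have "h\<^sup>2 * vab (z + a * of_real s + b * of_real t) = h\<^sup>2 * vba (z + b * of_real s' + a * of_real t')"
    using st(5) st'(5) unfolding swap by linarith
  moreover have "h\<^sup>2 \<noteq> 0"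
    using h(1) by simp
  ultimately have "vab (z + a * of_real s + b * of_real t) = vba (z + b * of_real s' + a * of_real t')"
    by (metis mult_cancel_left)
  moreover have "dist (vab (z + a * of_real s + b * of_real t)) (vab z) < e"
    using near[OF ab, of s t] st h by (intro d1(2)) auto
  moreover have "dist (vba (z + b * of_real s' + a * of_real t')) (vba z) < e"
    using near[OF ab(2,1), of s' t'] st' h by (intro d2(2)) auto
  ultimately have "\<bar>vab z - vba z\<bar> < 2 * e"
    by (auto simp: dist_real_def)
  then show False
    by (simp add: e_def)
qed

lemma local_max_second_derivative:
  fixes p p' :: "real \<Rightarrow> real"
  assumes d: "d > 0"
    and p: "\<And>t. \<bar>t\<bar> < d \<Longrightarrow> (p has_real_derivative p' t) (at t)"
    and p': "(p' has_real_derivative l) (at 0)"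
    and max: "\<And>t. \<bar>t\<bar> < d \<Longrightarrow> p t \<le> p 0"
  shows "p' 0 = 0" "l \<le> 0"
proof -
  show 0: "p' 0 = 0"
    by (rule DERIV_local_max[OF p d]) (use d max in auto)
  show "l \<le> 0"
  proof (rule ccontr)
    assume "\<not> l \<le> 0"
    then obtain e where e: "e > 0" "\<And>h. 0 < h \<Longrightarrow> h < e \<Longrightarrow> p' 0 < p' (0 + h)"
      using DERIV_pos_inc_right[OF p'] by auto
    define h where "h = min d e / 2"
    have h: "0 < h" "h < d" "h < e"
      using d e by (auto simp: h_def)
    have "\<exists>x. x > 0 \<and> x < h \<and> p h - p 0 = (h - 0) * p' x"
      using h by (intro MVT2 p) auto
    then obtain x where x: "0 < x" "x < h" "p h - p 0 = h * p' x"
      by auto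
    have "p' x > 0"
      using e(2)[of x] x h 0 by simp
    then have "p h > p 0"
      using x h by (metis diff_gt_0_iff_gt mult_pos_pos)
    then show False
      using max[of h] h by simp
  qed
qed

text \<open>
  The generalized Cauchy-Riemann system for \<open>g = u + i v\<close> with \<open>u\<close> even and \<open>v\<close> odd in \<open>y\<close>. On the real axis
  \<open>v\<close> vanishes, hence so do \<open>v\<^sub>x\<close> and \<open>u\<^sub>y\<close>, and \<open>v / y\<close> is replaced by \<open>v\<^sub>y\<close>.
\<close>

lemma symmetric_lambda_analytic_equations:
  assumes lam: "lam \<ge> 0" and la: "lambda_analytic lam g"
    and sym: "\<And>z. z \<in> unit_disk \<Longrightarrow> g (cnj z) = cnj (g z)"
    and z: "z \<in> unit_disk" and g': "(g has_derivative g') (at z)"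
  shows "Im (g' 1) = - Re (g' \<i>)"
    and "Im z \<noteq> 0 \<Longrightarrow> Re (g' 1) = Im (g' \<i>) + 2 * lam * (Im (g z) / Im z)"
    and "Im z = 0 \<Longrightarrow> Re (g' 1) = (1 + 2 * lam) * Im (g' \<i>)"
proof -
  have eq: "(g' 1 + \<i> * g' \<i>) / 2 = of_real lam * (if Im z = 0 then - \<i> * g' \<i> else (g z - g (cnj z)) / (z - cnj z))"
    using la z D_zbar_of_has_derivative[OF g', of lam] unfolding lambda_analytic_def by simp
  have off: "Re (g' 1) - Im (g' \<i>) = 2 * lam * (Im (g z) / Im z)" "Im (g' 1) + Re (g' \<i>) = 0" if "Im z \<noteq> 0"
  proof -
    have "(g z - g (cnj z)) / (z - cnj z) = of_real (Im (g z) / Im z)"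
    proof -
      have "g z - g (cnj z) = of_real (Im (g z)) * (2 * \<i>)" "z - cnj z = of_real (Im z) * (2 * \<i>)"
        unfolding sym[OF z] by (simp_all add: complex_eq_iff)
      then show ?thesis
        by simp
    qed
    then have "g' 1 + \<i> * g' \<i> = of_real (2 * lam * (Im (g z) / Im z))"
      using eq that by simp
    then show "Re (g' 1) - Im (g' \<i>) = 2 * lam * (Im (g z) / Im z)" "Im (g' 1) + Re (g' \<i>) = 0"
      unfolding complex_eq_iff by (simp_all del: of_real_mult of_real_divide)
  qed
  have on: "Re (g' 1) - Im (g' \<i>) = 2 * lam * Im (g' \<i>)" "Im (g' 1) + Re (g' \<i>) = - (2 * lam * Re (g' \<i>))" if "Im z = 0"
  proof -
    have "g' 1 + \<i> * g' \<i> = of_real (2 * lam) * (- \<i> * g' \<i>)"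
      using eq that by (simp add: field_simps)
    then show "Re (g' 1) - Im (g' \<i>) = 2 * lam * Im (g' \<i>)" "Im (g' 1) + Re (g' \<i>) = - (2 * lam * Re (g' \<i>))"
      unfolding complex_eq_iff by (simp_all del: of_real_mult)
  qed
  have on0: "Im (g' 1) = 0" if "Im z = 0"
  proof -
    have d: "((\<lambda>t. Im (g (z + 1 * of_real t))) has_real_derivative Im (g' 1)) (at 0)"
      by (rule has_real_derivative_along[OF g'])
    have "((\<lambda>t::real. z + 1 * of_real t) \<longlongrightarrow> z) (at 0)"
      by (rule tendsto_eq_intros refl | simp)+
    then have "\<forall>\<^sub>F t::real in at 0. z + 1 * of_real t \<in> unit_disk"
      using z by (intro topological_tendstoD) auto
    then have ev: "\<forall>\<^sub>F t in nhds 0. Im (g (z + 1 * of_real t)) = 0"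
    proof -
      have "\<forall>\<^sub>F t::real in nhds 0. z + 1 * of_real t \<in> unit_disk"
        using \<open>\<forall>\<^sub>F t::real in at 0. z + 1 * of_real t \<in> unit_disk\<close> z
        by (simp add: eventually_nhds_conv_at)
      then show ?thesis
      proof eventually_elim
        case (elim t)
        have "cnj (z + 1 * of_real t) = z + 1 * of_real t"
          using that by (simp add: complex_eq_iff)
        then have "g (z + 1 * of_real t) = cnj (g (z + 1 * of_real t))"
          using sym[OF elim] by simp
        then show ?case
          by (simp add: complex_eq_iff)
      qed
    qed
    have "((\<lambda>t. 0) has_real_derivative Im (g' 1)) (at 0)"
      using d DERIV_cong_ev[OF refl ev refl] by blast
    then show ?thesis
      by (rule DERIV_unique) (rule DERIV_const)
  qed
  show "Im (g' 1) = - Re (g' \<i>)"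
  proof (cases "Im z = 0")
    case True
    have "(1 + 2 * lam) * Re (g' \<i>) = 0"
      using on(2)[OF True] on0[OF True] by (simp add: algebra_simps)
    then show ?thesis
      using on0[OF True] lam by simp
  next
    case False
    then show ?thesis
      using off(2) by linarith
  qed
  show "Im z \<noteq> 0 \<Longrightarrow> Re (g' 1) = Im (g' \<i>) + 2 * lam * (Im (g z) / Im z)"
    using off(1) by linarith
  show "Im z = 0 \<Longrightarrow> Re (g' 1) = (1 + 2 * lam) * Im (g' \<i>)"
    using on(1) by (simp add: algebra_simps)
qed

lemma eventually_along:
  fixes z d :: complex
  assumes "open S" "z \<in> S"
  shows "\<forall>\<^sub>F t::real in nhds 0. z + d * of_real t \<in> S"
proof -
  have "continuous_on UNIV (\<lambda>t::real. z + d * of_real t)"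
    by (intro continuous_intros)
  then have "open ((\<lambda>t::real. z + d * of_real t) -` S)"
    by (rule open_vimage[OF assms(1)])
  then show ?thesis
    unfolding eventually_nhds using assms(2) by (intro exI[of _ "(\<lambda>t::real. z + d * of_real t) -` S"]) auto
qed

text \<open>
  Differentiating the system once more gives \<open>u\<^sub>x\<^sub>x + u\<^sub>y\<^sub>y + 2 \<lambda> u\<^sub>y / y = 0\<close> off the axis and
  \<open>u\<^sub>x\<^sub>x + (1 + 2 \<lambda>) u\<^sub>y\<^sub>y = 0\<close> on it. At a maximum of \<open>u + \<eta> |z|\<^sup>2\<close> one has \<open>u\<^sub>y = - 2 \<eta> y\<close> and
  \<open>u\<^sub>x\<^sub>x, u\<^sub>y\<^sub>y \<le> - 2 \<eta>\<close>, which contradicts either equation.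
\<close>

lemma no_interior_maximum:
  assumes lam: "lam \<ge> 0" and la: "lambda_analytic lam g"
    and sym: "\<And>z. z \<in> unit_disk \<Longrightarrow> g (cnj z) = cnj (g z)"
    and \<eta>: "\<eta> > 0" and z: "z \<in> unit_disk"
  shows "\<exists>w\<in>unit_disk. Re (g z) + \<eta> * (norm z)\<^sup>2 < Re (g w) + \<eta> * (norm w)\<^sup>2"
proof (rule ccontr)
  assume "\<not> ?thesis"
  then have max: "Re (g w) + \<eta> * (norm w)\<^sup>2 \<le> Re (g z) + \<eta> * (norm z)\<^sup>2" if "w \<in> unit_disk" for w
    using that by (meson not_le)
  obtain g' :: "complex \<Rightarrow> complex \<Rightarrow>\<^sub>L complex" and g'' where
    g': "\<And>z. z \<in> unit_disk \<Longrightarrow> (g has_derivative blinfun_apply (g' z)) (at z)"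
    and g'': "\<And>z. z \<in> unit_disk \<Longrightarrow> (g' has_derivative blinfun_apply (g'' z)) (at z)"
    and cont: "continuous_on unit_disk g''"
    using la unfolding lambda_analytic_def C2_on_def by blast
  have g'k: "((\<lambda>w. g' w k) has_derivative (\<lambda>h. g'' w h k)) (at w)" if "w \<in> unit_disk" for w k
    using bounded_linear.has_derivative[OF blinfun.bounded_linear_left g''[OF that]] .
  note d1 = has_real_derivative_along[OF g']
  note d2 = has_real_derivative_along[OF g'k]
  note eqs = symmetric_lambda_analytic_equations[OF lam la sym _ g']
  have isC: "isCont g'' z"
    using cont z by (simp add: continuous_on_eq_continuous_at)
  have mixed: "Im (g'' z \<i> 1) = Im (g'' z 1 \<i>)"
  proof (rule mixed_derivatives_equal[OF open_ball z, of 1 \<i> "\<lambda>w. Im (g w)" "\<lambda>w. Im (g' w 1)" "\<lambda>w. Im (g' w \<i>)"])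
    show "isCont (\<lambda>w. Im (g'' w \<i> 1)) z" "isCont (\<lambda>w. Im (g'' w 1 \<i>)) z"
      using isC unfolding isCont_def by (auto intro!: tendsto_intros)
    show "((\<lambda>t. Im (g (w + 1 * of_real t))) has_real_derivative Im (g' w 1)) (at 0)"
      "((\<lambda>t. Im (g (w + \<i> * of_real t))) has_real_derivative Im (g' w \<i>)) (at 0)"
      "((\<lambda>t. Im (g' (w + \<i> * of_real t) 1)) has_real_derivative Im (g'' w \<i> 1)) (at 0)"
      "((\<lambda>t. Im (g' (w + 1 * of_real t) \<i>)) has_real_derivative Im (g'' w 1 \<i>)) (at 0)"
      if "w \<in> unit_disk" for w
      by (intro d1(2) d2(2) that)+
  qed simp_all
  have uyy: "Re (g'' z \<i> \<i>) = - Im (g'' z \<i> 1)"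
  proof -
    have "\<forall>\<^sub>F t in nhds 0. Re (g' (z + \<i> * of_real t) \<i>) = - Im (g' (z + \<i> * of_real t) 1)"
      using eventually_along[OF open_ball z, of \<i>] by eventually_elim (use eqs(1) in simp)
    moreover have "((\<lambda>t. - Im (g' (z + \<i> * of_real t) 1)) has_real_derivative - Im (g'' z \<i> 1)) (at 0)"
      by (intro DERIV_minus d2 z)
    ultimately have "((\<lambda>t. Re (g' (z + \<i> * of_real t) \<i>)) has_real_derivative - Im (g'' z \<i> 1)) (at 0)"
      by (rule DERIV_transform_nhds)
    then show ?thesis
      using DERIV_unique[OF d2(1)[OF z]] by blast
  qed
  have line: "Re (g' z e) + 2 * \<eta> * (Re z * Re e + Im z * Im e) = 0 \<and> Re (g'' z e e) + 2 * \<eta> \<le> 0"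
    if e: "norm e = 1" for e
  proof -
    obtain d where d: "d > 0" "\<And>t::real. \<bar>t\<bar> < d \<Longrightarrow> z + e * of_real t \<in> unit_disk"
      using eventually_along[OF open_ball z, of e] unfolding eventually_nhds_metric by (auto simp: dist_real_def)
    define p where "p t = Re (g (z + e * of_real t)) + \<eta> * ((Re z + Re e * t)\<^sup>2 + (Im z + Im e * t)\<^sup>2)" for t
    define p' where "p' t = Re (g' (z + e * of_real t) e) + \<eta> * (2 * (Re z + Re e * t) * Re e + 2 * (Im z + Im e * t) * Im e)" for t
    have p_eq: "p t = Re (g (z + e * of_real t)) + \<eta> * (norm (z + e * of_real t))\<^sup>2" for t
      by (simp add: p_def cmod_power2)
    have ee: "(Re e)\<^sup>2 + (Im e)\<^sup>2 = 1"
      using e by (simp add: cmod_power2[symmetric])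
    have dp: "(p has_real_derivative p' t) (at t)" if t: "\<bar>t\<bar> < d" for t
    proof -
      have "((\<lambda>x. Re (g (z + e * of_real t + e * of_real x))) has_real_derivative Re (g' (z + e * of_real t) e)) (at 0)"
        by (intro d1 d(2) t)
      then have "((\<lambda>x. Re (g (z + e * of_real (x + t)))) has_real_derivative Re (g' (z + e * of_real t) e)) (at 0)"
        by (simp add: algebra_simps)
      then have "((\<lambda>x. Re (g (z + e * of_real x))) has_real_derivative Re (g' (z + e * of_real t) e)) (at t)"
        using DERIV_shift[of "\<lambda>x. Re (g (z + e * of_real x))" _ 0 t] by simp
      then show ?thesis
        unfolding p_def[abs_def] p'_def by (rule DERIV_add) (auto intro!: derivative_eq_intros simp: algebra_simps)
    qed
    have dp': "(p' has_real_derivative Re (g'' z e e) + 2 * \<eta>) (at 0)"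
    proof -
      have "(p' has_real_derivative Re (g'' z e e) + \<eta> * (2 * Re e * Re e + 2 * Im e * Im e)) (at 0)"
        unfolding p'_def[abs_def] by (rule DERIV_add[OF d2(1)[OF z]]) (auto intro!: derivative_eq_intros)
      moreover have "2 * Re e * Re e + 2 * Im e * Im e = 2"
        using ee by (simp add: power2_eq_square)
      ultimately show ?thesis
        by (simp only: mult.commute)
    qed
    have "p t \<le> p 0" if "\<bar>t\<bar> < d" for t
      using max[OF d(2)[OF that]] by (simp add: p_eq)
    from local_max_second_derivative[OF d(1) dp dp' this]
    show ?thesis
      by (simp add: p'_def algebra_simps)
  qed
  have x: "Re (g'' z 1 1) + 2 * \<eta> \<le> 0"
    using line[of 1] by simp
  have y: "Re (g' z \<i>) + 2 * \<eta> * Im z = 0" "Re (g'' z \<i> \<i>) + 2 * \<eta> \<le> 0"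
    using line[of \<i>] by simp_all
  show False
  proof (cases "Im z = 0")
    case True
    have "\<forall>\<^sub>F t in nhds 0. Re (g' (z + 1 * of_real t) 1) = (1 + 2 * lam) * Im (g' (z + 1 * of_real t) \<i>)"
      using eventually_along[OF open_ball z, of 1] by eventually_elim (use eqs(3) True in simp)
    moreover have "((\<lambda>t. (1 + 2 * lam) * Im (g' (z + 1 * of_real t) \<i>)) has_real_derivative (1 + 2 * lam) * Im (g'' z 1 \<i>)) (at 0)"
      by (intro DERIV_cmult d2 z)
    ultimately have "((\<lambda>t. Re (g' (z + 1 * of_real t) 1)) has_real_derivative (1 + 2 * lam) * Im (g'' z 1 \<i>)) (at 0)"
      by (rule DERIV_transform_nhds)
    then have "Re (g'' z 1 1) = (1 + 2 * lam) * Im (g'' z 1 \<i>)"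
      using DERIV_unique[OF d2(1)[OF z]] by blast
    also have "\<dots> = - ((1 + 2 * lam) * Re (g'' z \<i> \<i>))"
      using uyy mixed by simp
    finally have "Re (g'' z 1 1) + (1 + 2 * lam) * Re (g'' z \<i> \<i>) = 0"
      by simp
    moreover have "(1 + 2 * lam) * Re (g'' z \<i> \<i>) \<le> 0"
      using lam y(2) \<eta> by (intro mult_nonneg_nonpos) auto
    ultimately show False
      using x \<eta> by linarith
  next
    case False
    have "\<forall>\<^sub>F t in nhds 0. Re (g' (z + 1 * of_real t) 1) = Im (g' (z + 1 * of_real t) \<i>) + 2 * lam * (Im (g (z + 1 * of_real t)) / Im z)"
      using eventually_along[OF open_ball z, of 1] by eventually_elim (use eqs(2) False in simp)
    moreover have "((\<lambda>t. Im (g' (z + 1 * of_real t) \<i>) + 2 * lam * (Im (g (z + 1 * of_real t)) / Im z))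
       has_real_derivative Im (g'' z 1 \<i>) + 2 * lam * (Im (g' z 1) / Im z)) (at 0)"
      by (intro DERIV_add DERIV_cmult DERIV_cdivide d2 d1 z)
    ultimately have "((\<lambda>t. Re (g' (z + 1 * of_real t) 1)) has_real_derivative Im (g'' z 1 \<i>) + 2 * lam * (Im (g' z 1) / Im z)) (at 0)"
      by (rule DERIV_transform_nhds)
    then have "Re (g'' z 1 1) = Im (g'' z 1 \<i>) + 2 * lam * (Im (g' z 1) / Im z)"
      using DERIV_unique[OF d2(1)[OF z]] by blast
    moreover have "Im (g' z 1) = 2 * \<eta> * Im z"
      using eqs(1)[OF _ z z] y(1) by simp
    ultimately have "Re (g'' z 1 1) + Re (g'' z \<i> \<i>) = 2 * lam * (2 * \<eta>)"
      using uyy mixed False by simp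
    moreover have "2 * lam * (2 * \<eta>) \<ge> 0"
      using lam \<eta> by simp
    ultimately show False
      using x y(2) \<eta> by linarith
  qed
qed

lemma max_principle:
  assumes lam: "lam \<ge> 0" and la: "lambda_analytic lam g"
    and sym: "\<And>z. z \<in> unit_disk \<Longrightarrow> g (cnj z) = cnj (g z)"
    and cont: "continuous_on (cball 0 1) g"
    and bd: "\<And>z. norm z = 1 \<Longrightarrow> Re (g z) \<le> M" and z: "norm z \<le> 1"
  shows "Re (g z) \<le> M"
proof (rule ccontr)
  assume "\<not> Re (g z) \<le> M"
  \<comment> \<open>So small that the perturbation \<open>\<eta> |z|\<^sup>2\<close> cannot move the maximum to the boundary.\<close>
  define \<eta> where "\<eta> = (Re (g z) - M) / 2"
  have \<eta>: "\<eta> > 0"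
    using \<open>\<not> Re (g z) \<le> M\<close> by (simp add: \<eta>_def)
  let ?w = "\<lambda>z. Re (g z) + \<eta> * (norm z)\<^sup>2"
  have "continuous_on (cball 0 1) ?w"
    by (intro continuous_intros cont)
  then have "\<exists>x\<in>cball 0 1. \<forall>y\<in>cball 0 1. ?w y \<le> ?w x"
    by (intro continuous_attains_sup) auto
  then obtain x where x: "norm x \<le> 1" "\<And>y. norm y \<le> 1 \<Longrightarrow> ?w y \<le> ?w x"
    by auto
  have "x \<in> unit_disk"
  proof (rule ccontr)
    assume "x \<notin> unit_disk"
    then have "norm x = 1"
      using x(1) by simp
    then have "?w x \<le> M + \<eta>"
      using bd by simp
    moreover have "?w z \<ge> M + 2 * \<eta>"
    proof -
      have "M + 2 * \<eta> = Re (g z)"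
        by (simp add: \<eta>_def field_simps)
      moreover have "0 \<le> \<eta> * (norm z)\<^sup>2"
        using \<eta> by simp
      ultimately show ?thesis
        by linarith
    qed
    ultimately show False
      using x(2)[OF z] \<eta> by linarith
  qed
  then obtain y where "y \<in> unit_disk" "?w x < ?w y"
    using no_interior_maximum[OF lam la sym \<eta>] by blast
  then show False
    using x(2)[of y] by simp
qed

text \<open>
  If \<open>u = 0\<close>, the system leaves \<open>v\<^sub>y + 2 \<lambda> v / y = 0\<close>. Thus \<open>v\<close> times \<open>y\<close> to the power \<open>2 \<lambda>\<close> is constant on each
  vertical segment of the upper half disk; it is 0 since \<open>v\<close> tends to 0 at the real axis.
\<close>

lemma zero_real_part:
  assumes lam: "lam \<ge> 0" and la: "lambda_analytic lam h"
    and sym: "\<And>z. z \<in> unit_disk \<Longrightarrow> h (cnj z) = cnj (h z)"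
    and Re0: "\<And>z. z \<in> unit_disk \<Longrightarrow> Re (h z) = 0" and z: "z \<in> unit_disk"
  shows "h z = 0"
proof -
  obtain h' :: "complex \<Rightarrow> complex \<Rightarrow>\<^sub>L complex" where
    h': "\<And>z. z \<in> unit_disk \<Longrightarrow> (h has_derivative blinfun_apply (h' z)) (at z)"
    using la unfolding lambda_analytic_def C2_on_def by blast
  have hcont: "isCont h w" if "w \<in> unit_disk" for w
    using h'[OF that] has_derivative_continuous by blast
  have real_axis: "Im (h w) = 0" if "w \<in> unit_disk" "Im w = 0" for w
  proof -
    have "cnj w = w"
      using that by (simp add: complex_eq_iff)
    then have "h w = cnj (h w)"
      using sym[OF that(1)] by simp
    then show ?thesis
      by (simp add: complex_eq_iff)
  qed
  have upper: "Im (h w) = 0" if w: "w \<in> unit_disk" "Im w > 0" for w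
  proof -
    define x where "x = complex_of_real (Re w)"
    have w_eq: "w = x + \<i> * of_real (Im w)"
      by (simp add: x_def complex_eq_iff)
    have in_disk: "x + \<i> * of_real t \<in> unit_disk" if "0 \<le> t" "t \<le> Im w" for t
    proof -
      have "(norm (x + \<i> * of_real t))\<^sup>2 = (Re w)\<^sup>2 + t\<^sup>2"
        by (simp add: cmod_power2 x_def)
      also have "\<dots> \<le> (Re w)\<^sup>2 + (Im w)\<^sup>2"
        using that by (simp add: power_mono)
      also have "\<dots> = (norm w)\<^sup>2"
        by (simp add: cmod_power2)
      finally have "norm (x + \<i> * of_real t) \<le> norm w"
        by (rule power2_le_imp_le) simp
      then show ?thesis
        using w by simp
    qed
    define q where "q t = Im (h (x + \<i> * of_real t))" for t
    define Q where "Q t = t powr (2 * lam) * q t" for t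
    have dq: "(q has_real_derivative - (2 * lam * (q t / t))) (at t)" if t: "0 < t" "t \<le> Im w" for t
    proof -
      let ?z = "x + \<i> * of_real t"
      have zd: "?z \<in> unit_disk" and Im: "Im ?z = t"
        using in_disk[of t] t by (auto simp: x_def)
      have "((\<lambda>s. Im (h (?z + \<i> * of_real s))) has_real_derivative Im (h' ?z \<i>)) (at 0)"
        by (rule has_real_derivative_along(2)[OF h'[OF zd]])
      then have "((\<lambda>s. q (s + t)) has_real_derivative Im (h' ?z \<i>)) (at 0)"
        by (simp add: q_def algebra_simps)
      then have 1: "(q has_real_derivative Im (h' ?z \<i>)) (at t)"
        using DERIV_shift[of q _ 0 t] by simp
      have "Re (h' ?z 1) = 0"
      proof -
        have "\<forall>\<^sub>F s in nhds 0. 0 = Re (h (?z + 1 * of_real s))"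
          using eventually_along[OF open_ball zd, of 1] by eventually_elim (simp only: Re0)
        from this has_real_derivative_along(1)[OF h'[OF zd], of 1]
        have "((\<lambda>s. 0) has_real_derivative Re (h' ?z 1)) (at 0)"
          by (rule DERIV_transform_nhds)
        then show ?thesis
          by (rule DERIV_unique) (rule DERIV_const)
      qed
      then have "Im (h' ?z \<i>) = - (2 * lam * (q t / t))"
        using symmetric_lambda_analytic_equations(2)[OF lam la sym zd h'[OF zd]] Im t unfolding q_def by simp
      then show ?thesis
        using 1 by simp
    qed
    have dQ: "(Q has_real_derivative 0) (at t)" if t: "0 < t" "t \<le> Im w" for t
    proof -
      have "(Q has_real_derivative (2 * lam * t powr (2 * lam - 1)) * q t + - (2 * lam * (q t / t)) * t powr (2 * lam)) (at t)"
        unfolding Q_def[abs_def] using t by (intro DERIV_mult has_real_derivative_powr dq) auto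
      moreover have "t powr (2 * lam - 1) = t powr (2 * lam) / t"
        using t by (simp add: powr_diff)
      ultimately show ?thesis
        by simp
    qed
    have const: "Q s = Q (Im w)" if s: "0 < s" "s < Im w" for s
    proof -
      have "\<exists>t>s. t < Im w \<and> Q (Im w) - Q s = (Im w - s) * 0"
        using s by (intro MVT2 dQ) auto
      then show ?thesis
        by auto
    qed
    have lim: "((\<lambda>s. q s) \<longlongrightarrow> 0) (at_right 0)"
    proof -
      have "((\<lambda>s::real. x + \<i> * of_real s) \<longlongrightarrow> x + \<i> * of_real 0) (at_right 0)"
        by (intro tendsto_intros)
      moreover have xd: "x \<in> unit_disk"
        using in_disk[of 0] w by simp
      ultimately have "((\<lambda>s::real. Im (h (x + \<i> * of_real s))) \<longlongrightarrow> Im (h x)) (at_right 0)"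
        using isCont_tendsto_compose[OF hcont[OF xd]] by (intro tendsto_Im) simp
      then show ?thesis
        using real_axis[OF xd] by (simp add: q_def x_def)
    qed
    have "((\<lambda>s. Q (Im w)) \<longlongrightarrow> 0) (at_right (0::real))"
    proof (rule Lim_null_comparison[OF _ tendsto_norm_zero[OF lim]])
      have "\<forall>\<^sub>F s in at_right 0. s < min 1 (Im w)"
        using w by (intro order_tendstoD(2)[of _ 0] tendsto_ident_at) auto
      moreover have "\<forall>\<^sub>F s::real in at_right 0. 0 < s"
        by (rule eventually_at_right_less)
      ultimately show "\<forall>\<^sub>F s in at_right 0. norm (Q (Im w)) \<le> norm (q s)"
      proof eventually_elim
        case (elim s)
        have "Q (Im w) = s powr (2 * lam) * q s"
          using const[of s] elim by (simp add: Q_def)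
        moreover have "s powr (2 * lam) \<le> 1"
          using elim lam by (intro powr_le1) auto
        ultimately show ?case
          by (simp add: abs_mult mult_left_le_one_le)
      qed
    qed
    then have "Q (Im w) = 0"
      by (simp add: tendsto_const_iff)
    then have "q (Im w) = 0"
      using w by (simp add: Q_def)
    then show ?thesis
      using w_eq by (simp add: q_def)
  qed
  have "Im (h z) = 0"
  proof -
    consider "Im z = 0" | "Im z > 0" | "Im (cnj z) > 0"
      by fastforce
    then show ?thesis
    proof cases
      case 3
      then have "Im (h (cnj z)) = 0"
        using upper[of "cnj z"] z by simp
      then show ?thesis
        using sym[OF z] by simp
    qed (use real_axis upper z in auto)
  qed
  then show ?thesis
    using Re0[OF z] by (simp add: complex_eq_iff)
qed

section \<open>Boundary values on the unit circle\<close>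

definition circle_span :: "(nat \<Rightarrow> complex \<Rightarrow> real) \<Rightarrow> (complex \<Rightarrow> real) \<Rightarrow> bool" where
  "circle_span f h \<longleftrightarrow> (\<exists>N c. \<forall>z. norm z = 1 \<longrightarrow> h z = (\<Sum>n<N. c n * f n z))"

lemma sum_extend_zero:
  fixes c :: "nat \<Rightarrow> 'a::comm_ring_1"
  assumes "N \<le> M"
  shows "(\<Sum>n<M. (if n < N then c n else 0) * f n) = (\<Sum>n<N. c n * f n)"
proof -
  have "(\<Sum>n<M. (if n < N then c n else 0) * f n) = (\<Sum>n<N. (if n < N then c n else 0) * f n)"
    using assms by (intro sum.mono_neutral_right) auto
  then show ?thesis
    by simp
qed

lemma circle_span_add:
  assumes "circle_span f h" "circle_span f k"
  shows "circle_span f (\<lambda>z. h z + k z)"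
proof -
  obtain N c where h: "\<And>z. norm z = 1 \<Longrightarrow> h z = (\<Sum>n<N. c n * f n z)"
    using assms(1) unfolding circle_span_def by blast
  obtain M d where k: "\<And>z. norm z = 1 \<Longrightarrow> k z = (\<Sum>n<M. d n * f n z)"
    using assms(2) unfolding circle_span_def by blast
  define c' where "c' n = (if n < N then c n else 0)" for n
  define d' where "d' n = (if n < M then d n else 0)" for n
  have "h z + k z = (\<Sum>n<max N M. (c' n + d' n) * f n z)" if "norm z = 1" for z
    using h[OF that] k[OF that] sum_extend_zero[of N "max N M" c "\<lambda>n. f n z"] sum_extend_zero[of M "max N M" d "\<lambda>n. f n z"]
    by (simp add: c'_def d'_def distrib_right sum.distrib)
  then show ?thesis
    unfolding circle_span_def by (intro exI[of _ "max N M"] exI[of _ "\<lambda>n. c' n + d' n"]) blast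
qed

lemma circle_span_scale:
  assumes "circle_span f h"
  shows "circle_span f (\<lambda>z. a * h z)"
proof -
  obtain N c where h: "\<And>z. norm z = 1 \<Longrightarrow> h z = (\<Sum>n<N. c n * f n z)"
    using assms(1) unfolding circle_span_def by blast
  have "a * h z = (\<Sum>n<N. (a * c n) * f n z)" if "norm z = 1" for z
    using h[OF that] by (simp add: sum_distrib_left mult.assoc)
  then show ?thesis
    unfolding circle_span_def by (intro exI[of _ N] exI[of _ "\<lambda>n. a * c n"]) blast
qed

lemma circle_span_basis: "circle_span f (f k)"
  unfolding circle_span_def
proof (intro exI allI impI)
  fix z
  have "(\<Sum>n<Suc k. (if n = k then 1 else 0) * f n z) = (\<Sum>n<Suc k. if n = k then f n z else 0)"
    by (intro sum.cong) auto
  then show "f k z = (\<Sum>n<Suc k. (if n = k then 1 else 0) * f n z)"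
    by simp
qed

lemma circle_span_sum:
  "finite A \<Longrightarrow> (\<And>i. i \<in> A \<Longrightarrow> circle_span f (h i)) \<Longrightarrow> circle_span f (\<lambda>z. \<Sum>i\<in>A. h i z)"
proof (induction A rule: finite_induct)
  case empty
  show ?case
    using circle_span_scale[OF circle_span_basis[of f 0], of 0] by simp
next
  case (insert x F)
  then show ?case
    using circle_span_add[of f "h x" "\<lambda>z. \<Sum>i\<in>F. h i z"] by simp
qed

lemma circle_span_cong:
  "circle_span f h \<Longrightarrow> (\<And>z. norm z = 1 \<Longrightarrow> h z = k z) \<Longrightarrow> circle_span f k"
  unfolding circle_span_def by metis

lemma circle_span_trans:
  assumes "circle_span f h" "\<And>n. circle_span g (f n)"
  shows "circle_span g h"
proof -
  obtain N c where h: "\<And>z. norm z = 1 \<Longrightarrow> h z = (\<Sum>n<N. c n * f n z)"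
    using assms(1) unfolding circle_span_def by blast
  have "circle_span g (\<lambda>z. \<Sum>n<N. c n * f n z)"
    by (intro circle_span_sum circle_span_scale assms(2)) auto
  then show ?thesis
    by (rule circle_span_cong) (simp add: h)
qed

abbreviation trig_span :: "(complex \<Rightarrow> real) \<Rightarrow> bool" where
  "trig_span \<equiv> circle_span (\<lambda>n z. Re (z ^ n))"

abbreviation phat_re_span :: "real \<Rightarrow> (complex \<Rightarrow> real) \<Rightarrow> bool" where
  "phat_re_span lam \<equiv> circle_span (phat_re lam)"

lemma trig_span_basis: "trig_span (\<lambda>z. Re (z ^ n))"
  using circle_span_basis[of "\<lambda>n z. Re (z ^ n)" n] .

lemma unit_mult_cnj: "norm z = 1 \<Longrightarrow> z * cnj z = 1"
  by (simp add: complex_norm_square[symmetric])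

text \<open>
  On the unit circle \<open>2 Re z Re z\<^sup>n\<^sup>+\<^sup>1 = Re z\<^sup>n\<^sup>+\<^sup>2 + Re z\<^sup>n\<close>.
\<close>

lemma trig_span_Re_mult:
  assumes "trig_span h"
  shows "trig_span (\<lambda>z. Re z * h z)"
proof -
  obtain N c where h: "\<And>z. norm z = 1 \<Longrightarrow> h z = (\<Sum>n<N. c n * Re (z ^ n))"
    using assms unfolding circle_span_def by blast
  have basis: "trig_span (\<lambda>z. Re z * Re (z ^ n))" for n
  proof (cases n)
    case 0
    then show ?thesis
      using trig_span_basis[of 1] by simp
  next
    case (Suc k)
    have "1 / 2 * (Re (z ^ Suc (Suc k)) + Re (z ^ k)) = Re z * Re (z ^ n)" if "norm z = 1" for z
    proof -
      have "z ^ k = z ^ Suc k * cnj z"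
        using unit_mult_cnj[OF that] by (simp add: mult.assoc mult.left_commute)
      then have "z ^ Suc (Suc k) + z ^ k = (z + cnj z) * z ^ Suc k"
        by (simp add: algebra_simps)
      also have "\<dots> = of_real (2 * Re z) * z ^ Suc k"
        by (simp add: complex_add_cnj)
      finally have "Re (z ^ Suc (Suc k) + z ^ k) = 2 * Re z * Re (z ^ Suc k)"
        by (simp add: scaleR_conv_of_real[symmetric] del: of_real_mult)
      then show ?thesis
        by (simp add: Suc)
    qed
    moreover have "trig_span (\<lambda>z. 1 / 2 * (Re (z ^ Suc (Suc k)) + Re (z ^ k)))"
      by (intro circle_span_scale circle_span_add trig_span_basis)
    ultimately show ?thesis
      by (rule circle_span_cong[rotated])
  qed
  have "trig_span (\<lambda>z. \<Sum>n<N. c n * (Re z * Re (z ^ n)))"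
    by (intro circle_span_sum circle_span_scale basis) auto
  then show ?thesis
    by (rule circle_span_cong) (simp add: h sum_distrib_left mult.left_commute)
qed

lemma trig_span_power: "trig_span (\<lambda>z. Re z ^ n)"
proof (induction n)
  case 0
  show ?case
    using trig_span_basis[of 0] by simp
next
  case (Suc n)
  then show ?case
    using trig_span_Re_mult by simp
qed

lemma Re_mon_unit:
  assumes "norm z = 1"
  shows "Re (mon j k z) = Re (z ^ (if j \<le> k then k - j else j - k))"
proof (cases "j \<le> k")
  case True
  then have "mon j k z = (z * cnj z) ^ j * z ^ (k - j)"
    by (simp add: mon_def power_mult_distrib mult.assoc power_add[symmetric] mult.left_commute)
  then show ?thesis
    using True by (simp add: unit_mult_cnj[OF assms])
next
  case False
  then have "mon j k z = (z * cnj z) ^ k * cnj z ^ (j - k)"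
    by (simp add: mon_def power_mult_distrib mult.assoc power_add[symmetric] mult.left_commute mult.commute)
  then show ?thesis
    using False by (simp add: unit_mult_cnj[OF assms] flip: complex_cnj_power)
qed

text \<open>
  On the unit circle \<open>U\<^sub>n\<close> is a positive multiple of \<open>Re z\<^sup>n\<close>, from the two extreme terms \<open>j = 0\<close> and \<open>j = n\<close>,
  plus a combination of lower powers. So the triangular system can be solved for \<open>Re z\<^sup>n\<close>.
\<close>

lemma phat_re_span_Re_power:
  assumes lam: "lam \<ge> 0"
  shows "phat_re_span lam (\<lambda>z. Re (z ^ n))"
proof (induction n rule: less_induct)
  case (less n)
  show ?case
  proof (cases n)
    case 0
    then show ?thesis
      by (intro circle_span_cong[OF circle_span_basis[of "phat_re lam" 0]]) (simp add: phat_re_def)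
  next
    case (Suc m)
    define a where "a j = rising_coeff lam j * rising_coeff (lam + 1) (n - j)" for j
    have pos: "a 0 + a n > 0"
      using rising_coeff_pos[of "lam + 1" n] rising_coeff_nonneg[OF lam, of n] lam by (simp add: a_def add_pos_nonneg)
    have phat_re: "phat_re lam n z = (a 0 + a n) * Re (z ^ n) + (\<Sum>j\<in>{1..m}. a j * Re (mon j (n - j) z))" if "norm z = 1" for z
    proof -
      have "phat_re lam n z = (\<Sum>j\<le>Suc m. a j * Re (mon j (n - j) z))"
        by (simp add: phat_re_def phat_def a_def Suc)
      also have "\<dots> = (\<Sum>j\<le>m. a j * Re (mon j (n - j) z)) + a n * Re (mon n 0 z)"
        by (simp add: Suc)
      also have "(\<Sum>j\<le>m. a j * Re (mon j (n - j) z)) = a 0 * Re (mon 0 n z) + (\<Sum>j\<in>{1..m}. a j * Re (mon j (n - j) z))"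
        by (simp add: atMost_atLeast0 sum.atLeast_Suc_atMost)
      finally show ?thesis
        using Re_mon_unit[OF that, of 0 n] Re_mon_unit[OF that, of n 0] by (simp add: Suc distrib_right)
    qed
    have "phat_re_span lam (\<lambda>z. 1 / (a 0 + a n) * (phat_re lam n z + (-1) * (\<Sum>j\<in>{1..m}. a j * Re (z ^ (if j \<le> n - j then n - j - j else j - (n - j))))))"
    proof (intro circle_span_scale circle_span_add circle_span_basis circle_span_sum)
      fix j assume "j \<in> {1..m}"
      then show "phat_re_span lam (\<lambda>z. Re (z ^ (if j \<le> n - j then n - j - j else j - (n - j))))"
        by (intro less) (auto simp: Suc)
    qed simp
    then show ?thesis
    proof (rule circle_span_cong)
      fix z :: complex assume z: "norm z = 1"
      show "1 / (a 0 + a n) * (phat_re lam n z + (-1) * (\<Sum>j\<in>{1..m}. a j * Re (z ^ (if j \<le> n - j then n - j - j else j - (n - j))))) = Re (z ^ n)"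
        unfolding phat_re[OF z] Re_mon_unit[OF z] using pos by simp
    qed
  qed
qed

lemma phat_re_span_polynomial:
  assumes lam: "lam \<ge> 0"
  shows "phat_re_span lam (\<lambda>z. \<Sum>i\<le>n. a i * Re z ^ i)"
  by (intro circle_span_sum circle_span_scale circle_span_trans[OF trig_span_power] phat_re_span_Re_power lam) auto

text \<open>
  A function on the circle that is even in \<open>y\<close> is a function of \<open>x\<close>; Weierstrass' theorem applies to it.
\<close>

lemma boundary_approximation:
  fixes u :: "complex \<Rightarrow> real"
  assumes lam: "lam \<ge> 0" and cont: "continuous_on (sphere 0 1) u"
    and sym: "\<And>z. norm z = 1 \<Longrightarrow> u (cnj z) = u z" and e: "e > 0"
  shows "\<exists>N c. \<forall>z. norm z = 1 \<longrightarrow> \<bar>u z - (\<Sum>n<N. c n * phat_re lam n z)\<bar> < e"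
proof -
  define h where "h t = u (Complex t (sqrt (1 - t\<^sup>2)))" for t
  have "continuous_on {-1..1} h"
    unfolding h_def
  proof (rule continuous_on_compose2[OF cont])
    have "continuous_on {-1..1} (\<lambda>t::real. of_real t + \<i> * of_real (sqrt (1 - t\<^sup>2)))"
      by (intro continuous_intros)
    then show "continuous_on {-1..1} (\<lambda>t::real. Complex t (sqrt (1 - t\<^sup>2)))"
      by (simp add: Complex_eq)
    show "(\<lambda>t::real. Complex t (sqrt (1 - t\<^sup>2))) ` {-1..1} \<subseteq> sphere 0 1"
      by (auto simp: cmod_def abs_square_le_1 abs_le_iff)
  qed
  then obtain q where q: "real_polynomial_function q" "\<And>t. t \<in> {-1..1} \<Longrightarrow> \<bar>h t - q t\<bar> < e"
    using Stone_Weierstrass_real_polynomial_function[OF compact_Icc _ e] by blast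
  obtain a n where a: "q = (\<lambda>x. \<Sum>i\<le>n. a i * x ^ i)"
    using q(1) real_polynomial_function_iff_sum by blast
  obtain N c where c: "\<And>z. norm z = 1 \<Longrightarrow> (\<Sum>i\<le>n. a i * Re z ^ i) = (\<Sum>n<N. c n * phat_re lam n z)"
    using phat_re_span_polynomial[OF lam, of a n] unfolding circle_span_def by blast
  have "\<bar>u z - (\<Sum>n<N. c n * phat_re lam n z)\<bar> < e" if z: "norm z = 1" for z
  proof -
    have zz: "(Re z)\<^sup>2 + (Im z)\<^sup>2 = 1"
      using z by (simp add: cmod_power2[symmetric])
    then have s: "sqrt (1 - (Re z)\<^sup>2) = \<bar>Im z\<bar>"
      by (metis add_diff_cancel_left' real_sqrt_abs)
    have "u z = h (Re z)"
    proof (cases "Im z \<ge> 0")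
      case True
      then show ?thesis
        by (simp add: h_def s complex_surj)
    next
      case False
      then have "Complex (Re z) \<bar>Im z\<bar> = cnj z"
        by (simp add: complex_eq_iff)
      then show ?thesis
        using sym[OF z] by (simp add: h_def s)
    qed
    moreover have "Re z \<in> {-1..1}"
      using abs_Re_le_cmod[of z] z by (auto simp: abs_le_iff)
    ultimately show ?thesis
      using q(2)[of "Re z"] c[OF z] by (simp add: a)
  qed
  then show ?thesis
    by blast
qed

section \<open>Locally uniform approximation by \<open>\<lambda>\<close>-analytic polynomials\<close>

lemma abs_phat_re_le:
  assumes lam: "lam \<ge> 0" and z: "norm z \<le> 1"
  shows "\<bar>phat_re lam n z\<bar> \<le> rising_coeff (2 * lam + 1) n"
proof -
  have "\<bar>phat_re lam n z\<bar> \<le> norm (phat lam n z)"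
    unfolding phat_re_def by (rule abs_Re_le_cmod)
  also have "\<dots> \<le> rising_coeff (2 * lam + 1) n * norm z ^ n"
    by (rule norm_phat_le[OF lam])
  also have "\<dots> \<le> rising_coeff (2 * lam + 1) n * 1"
    using lam z by (intro mult_left_mono power_le_one) (auto simp: rising_coeff_nonneg)
  finally show ?thesis
    by simp
qed

text \<open>
  Integrate the combination against \<open>U\<^sub>n\<close> and use orthogonality. The factor 2 comes from \<open>ip_norm\<close>: the real part
  carries at least half of the squared norm.
\<close>

lemma phat_re_coefficient_le:
  assumes lam: "lam \<ge> 0" and bd: "\<And>z. norm z < 1 \<Longrightarrow> \<bar>\<Sum>m<M. a m * phat_re lam m z\<bar> \<le> \<delta>" and n: "n < M"
  shows "\<bar>a n\<bar> * rising_coeff (2 * lam + 1) n \<le> 2 * \<delta> * weight_bound lam n"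
proof -
  let ?B = "rising_coeff (2 * lam + 1) n"
  interpret finite_measure "sigma_lambda lam"
    by (rule finite_measure_sigma[OF lam])
  have B: "?B > 0"
    using lam by (simp add: rising_coeff_pos)
  have \<delta>: "\<delta> \<ge> 0"
    using bd[of 0] by force
  let ?S = "\<lambda>z. \<Sum>m<M. a m * (phat_re lam m z * phat_re lam n z)"
  have S_eq: "?S z = (\<Sum>m<M. a m * phat_re lam m z) * phat_re lam n z" for z
    by (simp add: sum_distrib_right mult.assoc)
  have int: "integrable (sigma_lambda lam) ?S"
    by (intro Bochner_Integration.integrable_sum integrable_mult_right integrable_phat_re_phat_im[OF lam])
  have "(\<integral>z. ?S z \<partial>sigma_lambda lam) = (\<Sum>m<M. a m * ip_re lam m n)"
    unfolding ip_re_def by (subst Bochner_Integration.integral_sum) (auto intro!: integrable_phat_re_phat_im[OF lam])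
  also have "\<dots> = (\<Sum>m<M. if m = n then a m * ip_re lam n n else 0)"
    using ip_orthogonal[OF lam] by (intro sum.cong) auto
  also have "\<dots> = a n * ip_re lam n n"
    using n by simp
  finally have eq: "a n * ip_re lam n n = (\<integral>z. ?S z \<partial>sigma_lambda lam)" ..
  have "\<bar>\<integral>z. ?S z \<partial>sigma_lambda lam\<bar> \<le> (\<integral>z. \<bar>?S z\<bar> \<partial>sigma_lambda lam)"
    by (rule integral_abs_bound)
  also have "\<dots> \<le> (\<integral>z. \<delta> * ?B \<partial>sigma_lambda lam)"
  proof (rule integral_mono)
    fix z assume "z \<in> space (sigma_lambda lam)"
    then have z: "norm z < 1"
      by simp
    show "\<bar>?S z\<bar> \<le> \<delta> * ?B"
      unfolding S_eq abs_mult using bd[OF z] abs_phat_re_le[OF lam, of z n] z \<delta> by (intro mult_mono) auto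
  qed (use int in auto)
  also have "\<dots> = \<delta> * ?B"
  proof -
    have "measure (sigma_lambda lam) (space (sigma_lambda lam)) = 1"
      unfolding measure_def emeasure_sigma_space[OF lam] by simp
    then show ?thesis
      by (simp only: lebesgue_integral_const) simp
  qed
  finally have "\<bar>a n\<bar> * ip_re lam n n \<le> \<delta> * ?B"
    unfolding eq[symmetric] abs_mult using ip_norm[OF lam, of n] B lam
    by (metis abs_le_iff abs_ge_self mult_left_mono abs_ge_zero order_trans)
  moreover have "\<bar>a n\<bar> * (phat_norm_sq lam n / 2) \<le> \<bar>a n\<bar> * ip_re lam n n"
    using ip_norm[OF lam, of n] by (intro mult_left_mono) auto
  ultimately have le: "\<bar>a n\<bar> * phat_norm_sq lam n \<le> 2 * \<delta> * ?B"
    by simp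
  let ?q = "(real n + lam + 1) / (lam + 1)"
  have q: "?q \<ge> 0" "phat_norm_sq lam n * ?q = ?B" "?B * ?q = weight_bound lam n"
    using lam by (simp_all add: phat_norm_sq_def weight_bound_def)
  have "\<bar>a n\<bar> * ?B = (\<bar>a n\<bar> * phat_norm_sq lam n) * ?q"
    unfolding mult.assoc q(2) ..
  also have "\<dots> \<le> (2 * \<delta> * ?B) * ?q"
    by (rule mult_right_mono[OF le q(1)])
  also have "\<dots> = 2 * \<delta> * weight_bound lam n"
    unfolding mult.assoc q(3) ..
  finally show ?thesis .
qed

lemma continuous_on_phat: "continuous_on S (phat lam n)"
  unfolding phat_def[abs_def] by (intro continuous_intros continuous_on_mon)

text \<open>
  The maximum principle controls only real parts of the approximating polynomials. Their coefficients are real,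
  so \<open>phat_re_coefficient_le\<close> turns this into control of the coefficients, and hence of the polynomials
  themselves.
\<close>

lemma symmetric_approximation:
  assumes lam: "lam \<ge> 0" and la: "lambda_analytic lam g"
    and sym: "\<And>z. norm z \<le> 1 \<Longrightarrow> g (cnj z) = cnj (g z)"
    and cont: "continuous_on (cball 0 1) g"
    and r: "0 < r" "r < 1" and e: "e > 0"
  shows "\<exists>N (c :: nat \<Rightarrow> complex). \<forall>z. norm z \<le> r \<longrightarrow> norm (g z - (\<Sum>n<N. c n * phat lam n z)) < e"
proof -
  have "\<exists>N c. \<forall>z. norm z = 1 \<longrightarrow> \<bar>Re (g z) - (\<Sum>n<N. c n * phat_re lam n z)\<bar> < 1 / (real k + 1)" for k
  proof (rule boundary_approximation[OF lam])
    show "continuous_on (sphere 0 1) (\<lambda>z. Re (g z))"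
      by (intro continuous_intros continuous_on_subset[OF cont]) auto
  qed (use sym in auto)
  then obtain N c0 where c0: "\<And>k z. norm z = 1 \<Longrightarrow> \<bar>Re (g z) - (\<Sum>n<N k. c0 k n * phat_re lam n z)\<bar> < 1 / (real k + 1)"
    by metis
  \<comment> \<open>Zero padding makes coefficients of different polynomials comparable.\<close>
  define c where "c k n = (if n < N k then c0 k n else 0)" for k n
  define P where "P k z = (\<Sum>n<N k. complex_of_real (c k n) * phat lam n z)" for k z
  have ReP: "Re (P k z) = (\<Sum>n<N k. c k n * phat_re lam n z)" for k z
    by (simp add: P_def phat_re_def)
  have Psym: "P k (cnj z) = cnj (P k z)" for k z
    by (simp add: P_def cnj_phat)
  have near: "\<bar>Re (g z) - Re (P k z)\<bar> \<le> 1 / (real k + 1)" if z: "norm z \<le> 1" for k z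
  proof -
    have bd: "\<bar>Re (g z) - Re (P k z)\<bar> \<le> 1 / (real k + 1)" if "norm z = 1" for z
      using c0[OF that, of k] by (simp add: ReP c_def)
    have laP: "lambda_analytic lam (P k)"
      unfolding P_def[abs_def] by (rule lambda_analytic_phat_sum[OF lam])
    have contP: "continuous_on (cball 0 1) (P k)"
      unfolding P_def[abs_def] by (intro continuous_intros continuous_on_phat)
    have "Re (g z - P k z) \<le> 1 / (real k + 1)"
    proof (rule max_principle[OF lam lambda_analytic_diff[OF la laP] _ _ _ z])
      show "Re (g z - P k z) \<le> 1 / (real k + 1)" if "norm z = 1" for z
        using bd[OF that] by simp
    qed (use sym Psym in \<open>auto intro!: continuous_intros cont contP\<close>)
    moreover have "Re (P k z - g z) \<le> 1 / (real k + 1)"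
    proof (rule max_principle[OF lam lambda_analytic_diff[OF laP la] _ _ _ z])
      show "Re (P k z - g z) \<le> 1 / (real k + 1)" if "norm z = 1" for z
        using bd[OF that] by simp
    qed (use sym Psym in \<open>auto intro!: continuous_intros cont contP\<close>)
    ultimately show ?thesis
      by simp
  qed
  have coeff: "\<bar>c k n - c l n\<bar> * rising_coeff (2 * lam + 1) n \<le> 2 * (1 / (real k + 1) + 1 / (real l + 1)) * weight_bound lam n" for k l n
  proof -
    define M where "M = max (max (N k) (N l)) (Suc n)"
    have ext: "(\<Sum>m<M. c i m * phat_re lam m z) = Re (P i z)" if "N i \<le> M" for i z
      unfolding ReP using that by (intro sum.mono_neutral_right) (auto simp: c_def)
    have "\<bar>\<Sum>m<M. (c k m - c l m) * phat_re lam m z\<bar> \<le> 1 / (real k + 1) + 1 / (real l + 1)" if "norm z < 1" for z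
    proof -
      have "(\<Sum>m<M. (c k m - c l m) * phat_re lam m z) = Re (P k z) - Re (P l z)"
        using ext[of k z] ext[of l z] by (simp add: M_def left_diff_distrib sum_subtractf)
      then show ?thesis
        using near[of z k] near[of z l] that by (simp add: abs_if split: if_splits)
    qed
    then show ?thesis
      by (rule phat_re_coefficient_le[OF lam]) (simp_all add: M_def)
  qed
  have "\<exists>F. lambda_analytic lam F \<and> (\<forall>r. 0 < r \<longrightarrow> r < 1 \<longrightarrow>
     uniform_limit (cball 0 r) (\<lambda>k z. \<Sum>n<N k. complex_of_real (c k n) * phat lam n z) F sequentially)"
  proof (rule phat_polynomials_limit[OF lam])
    fix e :: real assume e: "e > 0"
    obtain K :: nat where K: "K > 4 / e"
      using reals_Archimedean2 by blast
    have "norm (complex_of_real (c k n) - complex_of_real (c l n)) * rising_coeff (2 * lam + 1) n \<le> e * weight_bound lam n"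
      if kl: "k \<ge> K" "l \<ge> K" for k l n
    proof -
      have s: "1 / (real i + 1) \<le> e / 4" if "i \<ge> K" for i
      proof -
        have "4 / e \<le> real i + 1"
          using K that by linarith
        then have "4 \<le> e * (real i + 1)"
          using e by (simp add: pos_divide_le_eq mult.commute)
        then show ?thesis
          by (simp add: field_simps)
      qed
      have "norm (complex_of_real (c k n) - complex_of_real (c l n)) = \<bar>c k n - c l n\<bar>"
        by (metis norm_of_real of_real_diff)
      then have "norm (complex_of_real (c k n) - complex_of_real (c l n)) * rising_coeff (2 * lam + 1) n
          \<le> 2 * (1 / (real k + 1) + 1 / (real l + 1)) * weight_bound lam n"
        using coeff[of k n l] by simp
      also have "\<dots> \<le> e * weight_bound lam n"
        using s[OF kl(1)] s[OF kl(2)] weight_bound_pos[OF lam, of n] by (intro mult_right_mono) auto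
      finally show ?thesis .
    qed
    then show "\<exists>K. \<forall>k\<ge>K. \<forall>l\<ge>K. \<forall>n. norm (complex_of_real (c k n) - complex_of_real (c l n)) * rising_coeff (2 * lam + 1) n
        \<le> e * weight_bound lam n"
      by blast
  qed (simp add: c_def)
  then obtain F where F: "lambda_analytic lam F"
    "\<And>r. 0 < r \<Longrightarrow> r < 1 \<Longrightarrow> uniform_limit (cball 0 r) P F sequentially"
    unfolding P_def[abs_def] by blast
  have lim: "(\<lambda>k. P k z) \<longlonglongrightarrow> F z" if z: "z \<in> unit_disk" for z
  proof -
    obtain s where "0 < s" "s < 1" "norm z < s"
      using radius_between[OF z] by blast
    then show ?thesis
      by (intro tendsto_uniform_limitI[OF F(2)]) auto
  qed
  have Fsym: "F (cnj z) = cnj (F z)" if z: "z \<in> unit_disk" for z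
  proof -
    have "(\<lambda>k. P k (cnj z)) \<longlonglongrightarrow> F (cnj z)"
      using z by (intro lim) auto
    moreover have "(\<lambda>k. P k (cnj z)) \<longlonglongrightarrow> cnj (F z)"
      unfolding Psym by (intro tendsto_cnj lim z)
    ultimately show ?thesis
      by (rule LIMSEQ_unique)
  qed
  have ReF: "Re (F z) = Re (g z)" if z: "z \<in> unit_disk" for z
  proof -
    have "(\<lambda>k. Re (P k z)) \<longlonglongrightarrow> Re (F z)"
      by (intro tendsto_Re lim z)
    moreover have "(\<lambda>k. Re (P k z)) \<longlonglongrightarrow> Re (g z)"
    proof (rule LIM_zero_cancel, rule Lim_null_comparison)
      show "\<forall>\<^sub>F k in sequentially. norm (Re (P k z) - Re (g z)) \<le> 1 / (real k + 1)"
        using near[of z] z by (intro always_eventually allI) (simp add: abs_minus_commute)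
      show "(\<lambda>k. 1 / (real k + 1)) \<longlonglongrightarrow> 0"
        by real_asymp
    qed
    ultimately show ?thesis
      by (rule LIMSEQ_unique)
  qed
  have gF: "g z = F z" if z: "z \<in> unit_disk" for z
  proof -
    have "g z - F z = 0"
    proof (rule zero_real_part[OF lam lambda_analytic_diff[OF la F(1)] _ _ z])
      show "g (cnj w) - F (cnj w) = cnj (g w - F w)" if "w \<in> unit_disk" for w
        using sym[of w] Fsym[OF that] that by simp
      show "Re (g w - F w) = 0" if "w \<in> unit_disk" for w
        using ReF[OF that] by simp
    qed
    then show ?thesis
      by simp
  qed
  have "\<forall>\<^sub>F k in sequentially. \<forall>z\<in>cball 0 r. dist (P k z) (F z) < e"
    using F(2)[OF r] e unfolding uniform_limit_iff by blast
  then have "\<exists>k. \<forall>z\<in>cball 0 r. dist (P k z) (F z) < e"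
    by (rule eventually_happens'[OF sequentially_bot])
  then obtain k where k: "\<And>z. z \<in> cball 0 r \<Longrightarrow> dist (P k z) (F z) < e"
    by blast
  have "norm (g z - (\<Sum>n<N k. of_real (c k n) * phat lam n z)) < e" if z: "norm z \<le> r" for z
    using k[of z] gF[of z] z r by (simp add: dist_norm norm_minus_commute P_def)
  then show ?thesis
    by (intro exI[of _ "N k"] exI[of _ "\<lambda>n. of_real (c k n)"]) blast
qed

lemma phat_dilation: "phat lam n (of_real s * z) = of_real s ^ n * phat lam n z"
proof -
  have "mon j (n - j) (of_real s * z) = of_real s ^ n * mon j (n - j) z" if "j \<le> n" for j
  proof -
    have "mon j (n - j) (of_real s * z) = (of_real s ^ j * of_real s ^ (n - j)) * mon j (n - j) z"
      by (simp add: mon_def power_mult_distrib mult_ac)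
    also have "(of_real s :: complex) ^ j * of_real s ^ (n - j) = of_real s ^ n"
      using that by (simp add: power_add[symmetric])
    finally show ?thesis .
  qed
  then show ?thesis
    unfolding phat_def sum_distrib_left by (intro sum.cong refl) (simp add: mult.left_commute)
qed

text \<open>
  The combinations of \<open>f\<close> and its reflection with factors \<open>1/2\<close> and \<open>- i/2\<close> commute with conjugation.
\<close>

lemma polynomial_approximation:
  assumes lam: "lam \<ge> 0" and la: "lambda_analytic lam f" and r: "0 < r" "r < 1" and e: "e > 0"
  shows "\<exists>N (c :: nat \<Rightarrow> complex). \<forall>z\<in>unit_disk. norm (f (of_real r * z) - (\<Sum>n<N. c n * phat lam n z)) < e"
proof -
  \<comment> \<open>Pass to a radius between \<open>r\<close> and 1, so that the dilation by \<open>R\<close> is continuous on the closed disk.\<close>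
  define R where "R = (1 + r) / 2"
  have R: "0 < R" "R < 1" "r < R"
    using r by (auto simp: R_def)
  define s where "s = r / R"
  have s: "0 < s" "s < 1" "R * s = r"
    using r R by (auto simp: s_def)
  define g where "g z = f (of_real R * z)" for z
  define g1 where "g1 z = 1 / 2 * (g z + cnj (g (cnj z)))" for z
  define g2 where "g2 z = - \<i> / 2 * (g z - cnj (g (cnj z)))" for z
  have g: "g z = g1 z + \<i> * g2 z" for z
    by (simp add: g1_def g2_def algebra_simps)
  have lag: "lambda_analytic lam g"
    unfolding g_def[abs_def] using la R by (intro lambda_analytic_dilation) auto
  have la1: "lambda_analytic lam g1"
    unfolding g1_def[abs_def] by (intro lambda_analytic_cmult lambda_analytic_add lambda_analytic_reflect lag)
  have la2: "lambda_analytic lam g2"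
    unfolding g2_def[abs_def] by (intro lambda_analytic_cmult lambda_analytic_diff lambda_analytic_reflect lag)
  have contg: "continuous_on (cball 0 1) g"
    unfolding g_def[abs_def]
  proof (rule continuous_on_compose2[OF lambda_analytic_continuous_on[OF la]])
    show "(\<lambda>z. of_real R * z) ` cball 0 1 \<subseteq> unit_disk"
    proof safe
      fix z :: complex assume "z \<in> cball 0 1"
      then have "R * norm z \<le> R * 1"
        using R by (intro mult_left_mono) auto
      then have "R * norm z < 1"
        using R by linarith
      then show "of_real R * z \<in> unit_disk"
        using R by (simp add: norm_mult)
    qed
  qed (intro continuous_intros)
  have contg': "continuous_on (cball 0 1) (\<lambda>z. g (cnj z))"
    by (rule continuous_on_compose2[OF contg]) (auto intro!: continuous_intros)
  have "\<exists>N (c :: nat \<Rightarrow> complex). \<forall>z. norm z \<le> s \<longrightarrow> norm (g1 z - (\<Sum>n<N. c n * phat lam n z)) < e / 2"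
    using s e by (intro symmetric_approximation[OF lam la1])
      (auto simp: g1_def[abs_def] add.commute intro!: continuous_intros contg contg')
  then obtain N1 and c1 :: "nat \<Rightarrow> complex" where c1: "\<And>z. norm z \<le> s \<Longrightarrow> norm (g1 z - (\<Sum>n<N1. c1 n * phat lam n z)) < e / 2"
    by blast
  have "\<exists>N (c :: nat \<Rightarrow> complex). \<forall>z. norm z \<le> s \<longrightarrow> norm (g2 z - (\<Sum>n<N. c n * phat lam n z)) < e / 2"
    using s e by (intro symmetric_approximation[OF lam la2])
      (auto simp: g2_def[abs_def] algebra_simps intro!: continuous_intros contg contg')
  then obtain N2 and c2 :: "nat \<Rightarrow> complex" where c2: "\<And>z. norm z \<le> s \<Longrightarrow> norm (g2 z - (\<Sum>n<N2. c2 n * phat lam n z)) < e / 2"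
    by blast
  define d1 where "d1 n = (if n < N1 then c1 n else 0)" for n
  define d2 where "d2 n = (if n < N2 then c2 n else 0)" for n
  let ?N = "max N1 N2"
  let ?c = "\<lambda>n. (d1 n + \<i> * d2 n) * of_real s ^ n"
  have "norm (f (of_real r * z) - (\<Sum>n<?N. ?c n * phat lam n z)) < e" if z: "z \<in> unit_disk" for z
  proof -
    let ?w = "of_real s * z"
    have w: "norm ?w \<le> s"
    proof -
      have "s * norm z \<le> s * 1"
        using s z by (intro mult_left_mono) auto
      then show ?thesis
        using s by (simp add: norm_mult)
    qed
    have "f (of_real r * z) = g ?w"
      unfolding g_def s(3)[symmetric] by (simp add: mult.assoc)
    moreover have "(\<Sum>n<?N. ?c n * phat lam n z) = (\<Sum>n<N1. c1 n * phat lam n ?w) + \<i> * (\<Sum>n<N2. c2 n * phat lam n ?w)"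
    proof -
      have "(\<Sum>n<?N. ?c n * phat lam n z) = (\<Sum>n<?N. d1 n * phat lam n ?w) + \<i> * (\<Sum>n<?N. d2 n * phat lam n ?w)"
        unfolding sum_distrib_left sum.distrib[symmetric] phat_dilation by (intro sum.cong refl) (simp add: algebra_simps)
      then show ?thesis
        unfolding d1_def d2_def by (subst (asm) (1 2) sum_extend_zero) auto
    qed
    ultimately have "f (of_real r * z) - (\<Sum>n<?N. ?c n * phat lam n z) =
        (g1 ?w - (\<Sum>n<N1. c1 n * phat lam n ?w)) + \<i> * (g2 ?w - (\<Sum>n<N2. c2 n * phat lam n ?w))"
      by (simp add: g algebra_simps)
    then have "norm (f (of_real r * z) - (\<Sum>n<?N. ?c n * phat lam n z)) \<le>
        norm (g1 ?w - (\<Sum>n<N1. c1 n * phat lam n ?w)) + norm (\<i> * (g2 ?w - (\<Sum>n<N2. c2 n * phat lam n ?w)))"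
      by (simp only: norm_triangle_ineq)
    then show ?thesis
      using c1[OF w] c2[OF w] by (simp add: norm_mult)
  qed
  then show ?thesis
    by (intro exI[of _ ?N] exI[of _ ?c]) blast
qed

section \<open>Dilations and approximation in \<open>L\<^sup>p\<close>\<close>

text \<open>
  A substitute for the triangle inequality that holds for every exponent \<open>p > 0\<close>.
\<close>

lemma norm_diff_powr_le:
  fixes a b :: complex
  assumes p: "p > 0"
  shows "norm (a - b) powr p \<le> 2 powr p * (norm a powr p + norm b powr p)"
proof -
  let ?m = "max (norm a) (norm b)"
  have "norm (a - b) \<le> 2 * ?m"
    using norm_triangle_ineq4[of a b] by simp
  then have "norm (a - b) powr p \<le> (2 * ?m) powr p"
    using p by (intro powr_mono2) auto
  also have "\<dots> = 2 powr p * ?m powr p"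
    by (rule powr_mult)
  also have "?m powr p \<le> norm a powr p + norm b powr p"
    by (simp add: max_def)
  finally show ?thesis
    by simp
qed

definition Lp_fun :: "real \<Rightarrow> real \<Rightarrow> (complex \<Rightarrow> complex) \<Rightarrow> bool" where
  "Lp_fun lam p f \<longleftrightarrow> f \<in> borel_measurable (sigma_lambda lam) \<and>
     integrable (sigma_lambda lam) (\<lambda>z. norm (f z) powr p)"

definition p_integral :: "real \<Rightarrow> real \<Rightarrow> (complex \<Rightarrow> complex) \<Rightarrow> real" where
  "p_integral lam p f = (\<integral>z. norm (f z) powr p \<partial>sigma_lambda lam)"

lemma p_integral_nonneg: "p_integral lam p f \<ge> 0"
  unfolding p_integral_def by (intro Bochner_Integration.integral_nonneg) simp

lemma powr_norm_measurable:
  fixes f :: "complex \<Rightarrow> complex"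
  assumes "f \<in> borel_measurable M"
  shows "(\<lambda>z. norm (f z) powr p) \<in> borel_measurable M"
  using assms by measurable

lemma Lp_fun_diff:
  assumes p: "p > 0" and f: "Lp_fun lam p f" and g: "Lp_fun lam p g"
  shows "Lp_fun lam p (\<lambda>z. f z - g z)"
    and "p_integral lam p (\<lambda>z. f z - g z) \<le> 2 powr p * (p_integral lam p f + p_integral lam p g)"
proof -
  have int: "integrable (sigma_lambda lam) (\<lambda>z. 2 powr p * (norm (f z) powr p + norm (g z) powr p))"
    using f g unfolding Lp_fun_def by simp
  have m: "(\<lambda>z. f z - g z) \<in> borel_measurable (sigma_lambda lam)"
    using f g unfolding Lp_fun_def by (intro borel_measurable_diff) auto
  have int': "integrable (sigma_lambda lam) (\<lambda>z. norm (f z - g z) powr p)"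
    using norm_diff_powr_le[OF p]
    by (intro Bochner_Integration.integrable_bound[OF int powr_norm_measurable[OF m]] AE_I2) simp
  show "Lp_fun lam p (\<lambda>z. f z - g z)"
    using m int' unfolding Lp_fun_def by simp
  have "p_integral lam p (\<lambda>z. f z - g z) \<le> (\<integral>z. 2 powr p * (norm (f z) powr p + norm (g z) powr p) \<partial>sigma_lambda lam)"
    unfolding p_integral_def by (intro integral_mono int' int norm_diff_powr_le p)
  also have "\<dots> = 2 powr p * (p_integral lam p f + p_integral lam p g)"
    using f g unfolding p_integral_def Lp_fun_def by (simp add: Bochner_Integration.integral_add)
  finally show "p_integral lam p (\<lambda>z. f z - g z) \<le> 2 powr p * (p_integral lam p f + p_integral lam p g)" .
qed

lemma p_integral_minus_commute: "p_integral lam p (\<lambda>z. f z - g z) = p_integral lam p (\<lambda>z. g z - f z)"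
  by (simp add: p_integral_def norm_minus_commute)

lemma p_integral_triangle:
  assumes p: "p > 0" and f: "Lp_fun lam p f" and g: "Lp_fun lam p g" and h: "Lp_fun lam p h"
  shows "p_integral lam p (\<lambda>z. f z - h z) \<le>
    2 powr p * (p_integral lam p (\<lambda>z. f z - g z) + p_integral lam p (\<lambda>z. g z - h z))"
proof -
  have "p_integral lam p (\<lambda>z. f z - h z) = p_integral lam p (\<lambda>z. (f z - g z) - (h z - g z))"
    by simp
  also have "\<dots> \<le> 2 powr p * (p_integral lam p (\<lambda>z. f z - g z) + p_integral lam p (\<lambda>z. h z - g z))"
    by (intro Lp_fun_diff p f g h)
  finally show ?thesis
    using p_integral_minus_commute[of lam p h g] by simp
qed

lemma bergman_space_Lp:
  assumes "f \<in> bergman_space lam p"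
  shows "lambda_analytic lam f" "Lp_fun lam p f"
  using assms continuous_on_measurable_sigma[OF lambda_analytic_continuous_on]
  unfolding bergman_space_def Lp_fun_def by auto

lemma p_integral_le_bound:
  assumes lam: "lam \<ge> 0" and p: "p > 0" and f: "f \<in> borel_measurable (sigma_lambda lam)"
    and C: "\<And>z. z \<in> unit_disk \<Longrightarrow> norm (f z) \<le> C"
  shows "Lp_fun lam p f" "p_integral lam p f \<le> C powr p"
proof -
  interpret finite_measure "sigma_lambda lam"
    by (rule finite_measure_sigma[OF lam])
  have le: "norm (f z) powr p \<le> C powr p" if "z \<in> unit_disk" for z
    using C[OF that] p by (intro powr_mono2) auto
  have int: "integrable (sigma_lambda lam) (\<lambda>z. norm (f z) powr p)"
    using le by (intro integrable_const_bound[of _ "C powr p"] powr_norm_measurable f AE_I2) auto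
  then show "Lp_fun lam p f"
    using f unfolding Lp_fun_def by simp
  have "p_integral lam p f \<le> (\<integral>z. C powr p \<partial>sigma_lambda lam)"
    unfolding p_integral_def using le by (intro integral_mono int) auto
  also have "measure (sigma_lambda lam) (space (sigma_lambda lam)) = 1"
    unfolding measure_def emeasure_sigma_space[OF lam] by simp
  then have "(\<integral>z. C powr p \<partial>sigma_lambda lam) = C powr p"
    by (simp only: lebesgue_integral_const) simp
  finally show "p_integral lam p f \<le> C powr p" .
qed

lemma phat_sum_in_bergman:
  assumes lam: "lam \<ge> 0" and p: "p > 0"
  shows "(\<lambda>z. \<Sum>n<N. c n * phat lam n z) \<in> bergman_space lam p"
proof -
  let ?P = "\<lambda>z. \<Sum>n<N. c n * phat lam n z"
  have cont: "continuous_on S ?P" for S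
    by (intro continuous_intros continuous_on_phat)
  have "bounded (?P ` cball 0 1)"
    by (intro compact_imp_bounded compact_continuous_image cont) auto
  then obtain C where C: "\<And>z. z \<in> cball 0 1 \<Longrightarrow> norm (?P z) \<le> C"
    unfolding bounded_iff by blast
  have "Lp_fun lam p ?P"
    using C by (intro p_integral_le_bound(1)[OF lam p, of _ C] continuous_on_measurable_sigma cont) auto
  then show ?thesis
    using lambda_analytic_phat_sum[OF lam] unfolding bergman_space_def Lp_fun_def by blast
qed

lemma nn_integral_lborel_dilation:
  fixes h :: "complex \<Rightarrow> ennreal"
  assumes h: "h \<in> borel_measurable borel" and r: "r > 0"
  shows "(\<integral>\<^sup>+z. h z \<partial>lborel) = ennreal (r\<^sup>2) * (\<integral>\<^sup>+z. h (of_real r * z) \<partial>lborel)"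
proof -
  have T: "(\<lambda>x::complex. 0 + r *\<^sub>R x) \<in> borel_measurable borel"
    by simp
  have hT: "(\<lambda>z. h (0 + r *\<^sub>R z)) \<in> borel_measurable borel"
    using measurable_compose[OF T h] .
  have "(\<integral>\<^sup>+z. h z \<partial>lborel) = (\<integral>\<^sup>+z. h z \<partial>density (distr lborel borel (\<lambda>x. 0 + r *\<^sub>R x)) (\<lambda>_. ennreal (\<bar>r\<bar> ^ DIM(complex))))"
    using lborel_affine[of r "0::complex"] r by simp
  also have "\<dots> = (\<integral>\<^sup>+z. ennreal (r\<^sup>2) * h z \<partial>distr lborel borel (\<lambda>x. 0 + r *\<^sub>R x))"
    using h by (subst nn_integral_density) auto
  also have "\<dots> = (\<integral>\<^sup>+z. ennreal (r\<^sup>2) * h (0 + r *\<^sub>R z) \<partial>lborel)"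
    using h by (subst nn_integral_distr) auto
  also have "\<dots> = ennreal (r\<^sup>2) * (\<integral>\<^sup>+z. h (0 + r *\<^sub>R z) \<partial>lborel)"
    by (rule nn_integral_cmult) (use hT in simp)
  finally show ?thesis
    by (simp add: scaleR_conv_of_real)
qed

lemma dilation_in_disk: "z \<in> unit_disk \<Longrightarrow> 0 < r \<Longrightarrow> r < 1 \<Longrightarrow> complex_of_real r * z \<in> unit_disk"
proof -
  assume a: "z \<in> unit_disk" "0 < r" "r < 1"
  then have "r * norm z \<le> r * 1"
    by (intro mult_left_mono) auto
  then have "r * norm z < 1"
    using a by linarith
  then show ?thesis
    using a by (simp add: norm_mult)
qed

text \<open>
  Substituting \<open>w = r z\<close> produces the Jacobian \<open>r\<^sup>2\<close>, and the density contributes \<open>r\<close> to the power \<open>2 \<lambda>\<close>; the disk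
  of radius \<open>r\<close> lies in the unit disk.
\<close>

lemma dilation_Lp:
  assumes lam: "lam \<ge> 0" and p: "p > 0" and f: "f \<in> bergman_space lam p" and r: "0 < r" "r < 1"
  shows "Lp_fun lam p (\<lambda>z. f (of_real r * z))"
    and "p_integral lam p (\<lambda>z. f (of_real r * z)) \<le> inverse (r powr (2 * lam) * r\<^sup>2) * p_integral lam p f"
proof -
  let ?A = "\<lambda>z. norm (f z) powr p" and ?B = "\<lambda>z. norm (f (of_real r * z)) powr p"
  let ?K = "inverse (r powr (2 * lam) * r\<^sup>2)"
  have la: "lambda_analytic lam f"
    by (rule bergman_space_Lp[OF f])
  have fm: "f \<in> borel_measurable (sigma_lambda lam)" and intA: "integrable (sigma_lambda lam) ?A"
    using bergman_space_Lp(2)[OF f] unfolding Lp_fun_def by auto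
  have "lambda_analytic lam (\<lambda>z. f (of_real r * z))"
    using r by (intro lambda_analytic_dilation la) auto
  then have fr: "(\<lambda>z. f (of_real r * z)) \<in> borel_measurable (sigma_lambda lam)"
    by (intro continuous_on_measurable_sigma lambda_analytic_continuous_on)
  define h where "h z = ennreal (weight lam z) * ennreal (?A z) * indicator unit_disk z" for z
  have hm: "h \<in> borel_measurable borel"
  proof -
    have "(\<lambda>z. ennreal (?A z)) \<in> borel_measurable (restrict_space borel unit_disk)"
      using powr_norm_measurable[OF fm, of p] unfolding measurable_sigma_iff by measurable
    then have "(\<lambda>z. ennreal (?A z) * indicator unit_disk z) \<in> borel_measurable borel"
      by (subst (asm) borel_measurable_restrict_space_iff_ennreal) auto
    then have "(\<lambda>z. ennreal (weight lam z) * (ennreal (?A z) * indicator unit_disk z)) \<in> borel_measurable borel"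
      by measurable
    then show ?thesis
      unfolding h_def[abs_def] by (simp add: mult.assoc)
  qed
  have hrm: "(\<lambda>z. h (of_real r * z)) \<in> borel_measurable borel"
  proof -
    have "(\<lambda>z. complex_of_real r * z) \<in> borel_measurable borel"
      by measurable
    then show ?thesis
      using measurable_compose[OF _ hm] by blast
  qed
  have "(\<integral>\<^sup>+z. ?B z \<partial>sigma_lambda lam) = (\<integral>\<^sup>+z. ennreal (weight lam z) * ennreal (?B z) * indicator unit_disk z \<partial>lborel)"
    by (intro nn_integral_sigma measurable_compose[OF powr_norm_measurable[OF fr] measurable_ennreal])
  also have "\<dots> \<le> (\<integral>\<^sup>+z. ennreal (inverse (r powr (2 * lam))) * h (of_real r * z) \<partial>lborel)"
  proof (intro nn_integral_mono)
    fix z :: complex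
    show "ennreal (weight lam z) * ennreal (?B z) * indicator unit_disk z \<le> ennreal (inverse (r powr (2 * lam))) * h (of_real r * z)"
    proof (cases "z \<in> unit_disk")
      case True
      have "weight lam (of_real r * z) = r powr (2 * lam) * weight lam z"
        using r by (simp add: weight_def abs_mult powr_mult)
      then have "weight lam z = inverse (r powr (2 * lam)) * weight lam (of_real r * z)"
        using r by simp
      then have "ennreal (weight lam z) = ennreal (inverse (r powr (2 * lam))) * ennreal (weight lam (of_real r * z))"
        by (simp add: ennreal_mult')
      then show ?thesis
        using True dilation_in_disk[OF True r] by (simp add: h_def mult.assoc)
    qed simp
  qed
  also have "\<dots> = ennreal (inverse (r powr (2 * lam))) * (\<integral>\<^sup>+z. h (of_real r * z) \<partial>lborel)"
    by (rule nn_integral_cmult) (use hrm in simp)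
  also have "(\<integral>\<^sup>+z. h (of_real r * z) \<partial>lborel) = ennreal (inverse (r\<^sup>2)) * (ennreal (r\<^sup>2) * (\<integral>\<^sup>+z. h (of_real r * z) \<partial>lborel))"
    using r by (simp add: mult.assoc[symmetric] ennreal_mult'[symmetric])
  also have "ennreal (r\<^sup>2) * (\<integral>\<^sup>+z. h (of_real r * z) \<partial>lborel) = (\<integral>\<^sup>+z. h z \<partial>lborel)"
    by (rule nn_integral_lborel_dilation[OF hm r(1), symmetric])
  also have "(\<integral>\<^sup>+z. h z \<partial>lborel) = (\<integral>\<^sup>+z. ?A z \<partial>sigma_lambda lam)"
    unfolding h_def by (intro nn_integral_sigma[symmetric] measurable_compose[OF powr_norm_measurable[OF fm] measurable_ennreal])
  also have "\<dots> = ennreal (p_integral lam p f)"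
    unfolding p_integral_def by (intro nn_integral_eq_integral intA) simp
  also have "ennreal (inverse (r powr (2 * lam))) * (ennreal (inverse (r\<^sup>2)) * ennreal (p_integral lam p f)) = ennreal (?K * p_integral lam p f)"
    using r by (simp add: ennreal_mult'[symmetric] mult.assoc)
  finally have le: "(\<integral>\<^sup>+z. ?B z \<partial>sigma_lambda lam) \<le> ennreal (?K * p_integral lam p f)" .
  have intB: "integrable (sigma_lambda lam) ?B"
  proof (rule integrableI_bounded[OF powr_norm_measurable[OF fr]])
    have "(\<integral>\<^sup>+z. ennreal (norm (?B z)) \<partial>sigma_lambda lam) \<le> ennreal (?K * p_integral lam p f)"
      using le by simp
    then show "(\<integral>\<^sup>+z. ennreal (norm (?B z)) \<partial>sigma_lambda lam) < \<infinity>"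
      using ennreal_less_top le_less_trans unfolding infinity_ennreal_def by blast
  qed
  then show "Lp_fun lam p (\<lambda>z. f (of_real r * z))"
    using fr unfolding Lp_fun_def by simp
  have "ennreal (p_integral lam p (\<lambda>z. f (of_real r * z))) = (\<integral>\<^sup>+z. ?B z \<partial>sigma_lambda lam)"
    unfolding p_integral_def by (intro nn_integral_eq_integral[symmetric] intB) simp
  then have "ennreal (p_integral lam p (\<lambda>z. f (of_real r * z))) \<le> ennreal (?K * p_integral lam p f)"
    using le by simp
  then show "p_integral lam p (\<lambda>z. f (of_real r * z)) \<le> ?K * p_integral lam p f"
    using r p_integral_nonneg by (subst (asm) ennreal_le_iff) auto
qed

text \<open>
  Suppose the distances stay at least \<open>e\<close>. The functions \<open>X k\<close> are nonnegative, tend pointwise to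
  \<open>2 \<cdot> 2\<^sup>p |f|\<^sup>p\<close>, and their integrals are at most \<open>b k\<close>, with limit \<open>2 \<cdot> 2\<^sup>p\<close> times the integral of \<open>|f|\<^sup>p\<close>, minus
  \<open>e\<close>. This contradicts Fatou's lemma.
\<close>

lemma dilation_approximates:
  assumes lam: "lam \<ge> 0" and p: "p > 0" and f: "f \<in> bergman_space lam p" and e: "e > 0"
  shows "\<exists>r. 0 < r \<and> r < 1 \<and> p_integral lam p (\<lambda>z. f (of_real r * z) - f z) < e"
proof (rule ccontr)
  assume "\<not> ?thesis"
  then have far: "p_integral lam p (\<lambda>z. f (of_real r * z) - f z) \<ge> e" if "0 < r" "r < 1" for r
    using that by (meson not_le)
  define s where "s k = 1 - 1 / (real k + 2)" for k :: nat
  have s: "0 < s k" "s k < 1" for k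
    by (auto simp: s_def field_simps)
  have s_lim: "s \<longlonglongrightarrow> 1"
    unfolding s_def by real_asymp
  define fk where "fk k z = f (of_real (s k) * z)" for k z
  let ?I = "p_integral lam p f"
  have L: "Lp_fun lam p f" and la: "lambda_analytic lam f"
    using bergman_space_Lp[OF f] by auto
  have Lk: "Lp_fun lam p (fk k)" for k
    unfolding fk_def[abs_def] by (rule dilation_Lp(1)[OF lam p f s])
  have Ld: "Lp_fun lam p (\<lambda>z. fk k z - f z)" for k
    by (intro Lp_fun_diff p Lk L)
  define X where "X k z = 2 powr p * (norm (fk k z) powr p + norm (f z) powr p) - norm (fk k z - f z) powr p" for k z
  have X0: "X k z \<ge> 0" for k z
    using norm_diff_powr_le[OF p, of "fk k z" "f z"] by (simp add: X_def)
  have Xint: "integrable (sigma_lambda lam) (X k)" for k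
    using Lk[of k] L Ld[of k] unfolding X_def[abs_def] Lp_fun_def by simp
  have Xval: "(\<integral>z. X k z \<partial>sigma_lambda lam) = 2 powr p * (p_integral lam p (fk k) + ?I) - p_integral lam p (\<lambda>z. fk k z - f z)" for k
    using Lk[of k] L Ld[of k] unfolding X_def Lp_fun_def p_integral_def
    by (simp add: Bochner_Integration.integral_diff Bochner_Integration.integral_add)
  define b where "b k = 2 powr p * (inverse (s k powr (2 * lam) * (s k)\<^sup>2) * ?I + ?I) - e" for k
  have Xle: "(\<integral>z. X k z \<partial>sigma_lambda lam) \<le> b k" for k
  proof -
    have "p_integral lam p (fk k) \<le> inverse (s k powr (2 * lam) * (s k)\<^sup>2) * ?I"
      unfolding fk_def[abs_def] by (rule dilation_Lp(2)[OF lam p f s])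
    then have "2 powr p * (p_integral lam p (fk k) + ?I) \<le> 2 powr p * (inverse (s k powr (2 * lam) * (s k)\<^sup>2) * ?I + ?I)"
      by (intro mult_left_mono) auto
    moreover have "p_integral lam p (\<lambda>z. fk k z - f z) \<ge> e"
      unfolding fk_def by (rule far[OF s])
    ultimately show ?thesis
      unfolding Xval b_def by linarith
  qed
  have b_lim: "b \<longlonglongrightarrow> 2 powr p * (?I + ?I) - e"
  proof -
    have "(\<lambda>k. s k powr (2 * lam) * (s k)\<^sup>2) \<longlonglongrightarrow> 1 powr (2 * lam) * 1\<^sup>2"
      by (intro tendsto_intros s_lim) auto
    then have "(\<lambda>k. inverse (s k powr (2 * lam) * (s k)\<^sup>2)) \<longlonglongrightarrow> 1"
      using tendsto_inverse by fastforce
    then have "b \<longlonglongrightarrow> 2 powr p * (1 * ?I + ?I) - e"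
      unfolding b_def by (intro tendsto_intros)
    then show ?thesis
      by simp
  qed
  have b0: "0 \<le> b k" for k
    using Xle[of k] X0 by (meson Bochner_Integration.integral_nonneg order_trans)
  have lim0: "0 \<le> 2 powr p * (?I + ?I) - e"
    using b_lim b0 by (intro LIMSEQ_le_const[OF b_lim]) auto
  have X_lim: "(\<lambda>k. X k z) \<longlonglongrightarrow> 2 * 2 powr p * norm (f z) powr p" if z: "z \<in> unit_disk" for z
  proof -
    have "(\<lambda>k. complex_of_real (s k) * z) \<longlonglongrightarrow> of_real 1 * z"
      by (intro tendsto_intros s_lim)
    moreover have "isCont f z"
      using lambda_analytic_continuous_on[OF la] z by (simp add: continuous_on_eq_continuous_at)
    ultimately have fk: "(\<lambda>k. fk k z) \<longlonglongrightarrow> f z"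
      unfolding fk_def using isCont_tendsto_compose[of z f] by simp
    have t1: "(\<lambda>k. norm (fk k z) powr p) \<longlonglongrightarrow> norm (f z) powr p"
      using p by (intro tendsto_powr2 tendsto_norm fk tendsto_const) auto
    have t2: "(\<lambda>k. norm (fk k z - f z) powr p) \<longlonglongrightarrow> norm (f z - f z) powr p"
      using p by (intro tendsto_powr2 tendsto_intros fk) auto
    have "(\<lambda>k. X k z) \<longlonglongrightarrow> 2 powr p * (norm (f z) powr p + norm (f z) powr p) - norm (f z - f z) powr p"
      unfolding X_def by (rule tendsto_diff[OF tendsto_mult_left[OF tendsto_add[OF t1 tendsto_const]] t2])
    then show ?thesis
      by (simp add: mult_ac)
  qed
  have "ennreal (2 powr p * (?I + ?I)) = (\<integral>\<^sup>+z. ennreal (2 * 2 powr p * norm (f z) powr p) \<partial>sigma_lambda lam)"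
  proof -
    have "integrable (sigma_lambda lam) (\<lambda>z. 2 * 2 powr p * norm (f z) powr p)"
      using L unfolding Lp_fun_def by simp
    then have "(\<integral>\<^sup>+z. ennreal (2 * 2 powr p * norm (f z) powr p) \<partial>sigma_lambda lam)
       = ennreal (\<integral>z. 2 * 2 powr p * norm (f z) powr p \<partial>sigma_lambda lam)"
      by (intro nn_integral_eq_integral) auto
    then show ?thesis
      by (simp add: p_integral_def)
  qed
  also have "\<dots> = (\<integral>\<^sup>+z. liminf (\<lambda>k. ennreal (X k z)) \<partial>sigma_lambda lam)"
  proof (intro nn_integral_cong)
    fix z assume "z \<in> space (sigma_lambda lam)"
    then have "(\<lambda>k. ennreal (X k z)) \<longlonglongrightarrow> ennreal (2 * 2 powr p * norm (f z) powr p)"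
      by (intro tendsto_ennrealI X_lim) simp
    then show "ennreal (2 * 2 powr p * norm (f z) powr p) = liminf (\<lambda>k. ennreal (X k z))"
      by (metis lim_imp_Liminf trivial_limit_sequentially)
  qed
  also have "\<dots> \<le> liminf (\<lambda>k. \<integral>\<^sup>+z. ennreal (X k z) \<partial>sigma_lambda lam)"
    using Xint by (intro nn_integral_liminf) auto
  also have "\<dots> \<le> liminf (\<lambda>k. ennreal (b k))"
  proof (intro Liminf_mono always_eventually allI)
    fix k
    have "(\<integral>\<^sup>+z. ennreal (X k z) \<partial>sigma_lambda lam) = ennreal (\<integral>z. X k z \<partial>sigma_lambda lam)"
      using X0 by (intro nn_integral_eq_integral Xint) auto
    then show "(\<integral>\<^sup>+z. ennreal (X k z) \<partial>sigma_lambda lam) \<le> ennreal (b k)"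
      using Xle[of k] by (simp add: ennreal_leI)
  qed
  also have "\<dots> = ennreal (2 powr p * (?I + ?I) - e)"
    by (intro lim_imp_Liminf tendsto_ennrealI b_lim) simp
  finally have "2 powr p * (?I + ?I) \<le> 2 powr p * (?I + ?I) - e"
    using lim0 by (subst (asm) ennreal_le_iff) auto
  then show False
    using e by simp
qed

lemma polynomial_approximation_Lp:
  assumes lam: "lam \<ge> 0" and p: "p > 0" and f: "f \<in> bergman_space lam p" and e: "e > 0"
  shows "\<exists>N (c :: nat \<Rightarrow> complex). p_integral lam p (\<lambda>z. f z - (\<Sum>n<N. c n * phat lam n z)) < e"
proof -
  \<comment> \<open>Both errors below are at most \<open>d\<close>, and \<open>norm_diff_powr_le\<close> costs the factor \<open>2 powr p\<close>.\<close>
  define d where "d = e / (2 * 2 powr p)"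
  have d: "d > 0"
    using e by (simp add: d_def)
  obtain r where r: "0 < r" "r < 1" "p_integral lam p (\<lambda>z. f (of_real r * z) - f z) < d"
    using dilation_approximates[OF lam p f d] by blast
  have "d powr (1 / p) > 0"
    using d by simp
  then obtain N and c :: "nat \<Rightarrow> complex" where
    c: "\<And>z. z \<in> unit_disk \<Longrightarrow> norm (f (of_real r * z) - (\<Sum>n<N. c n * phat lam n z)) < d powr (1 / p)"
    using polynomial_approximation[OF lam bergman_space_Lp(1)[OF f] r(1,2)] by blast
  let ?P = "\<lambda>z. \<Sum>n<N. c n * phat lam n z"
  have Lr: "Lp_fun lam p (\<lambda>z. f (of_real r * z))"
    by (rule dilation_Lp(1)[OF lam p f r(1,2)])
  have LP: "Lp_fun lam p ?P"
    by (rule bergman_space_Lp(2)[OF phat_sum_in_bergman[OF lam p]])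
  have "p_integral lam p (\<lambda>z. f (of_real r * z) - ?P z) \<le> (d powr (1 / p)) powr p"
    using c less_imp_le Lp_fun_diff(1)[OF p Lr LP] unfolding Lp_fun_def
    by (intro p_integral_le_bound(2)[OF lam p]) auto
  also have "\<dots> = d"
    using p d by (simp add: powr_powr)
  finally have "2 powr p * (p_integral lam p (\<lambda>z. f z - f (of_real r * z)) + p_integral lam p (\<lambda>z. f (of_real r * z) - ?P z)) < 2 powr p * (d + d)"
    using r(3) p_integral_minus_commute[of lam p f "\<lambda>z. f (of_real r * z)"] by (intro mult_strict_left_mono) auto
  also have "\<dots> = e"
    by (simp add: d_def)
  finally have "p_integral lam p (\<lambda>z. f z - ?P z) < e"
    using p_integral_triangle[OF p bergman_space_Lp(2)[OF f] Lr LP] by linarith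
  then show ?thesis
    by blast
qed

section \<open>Density, the orthonormal basis, and completeness\<close>

lemma bergman_dist_eq:
  "bergman_dist lam p f g = (if p \<ge> 1 then p_integral lam p (\<lambda>z. f z - g z) powr (1 / p)
     else (p_integral lam p (\<lambda>z. f z - g z) powr (1 / p)) powr p)"
  by (simp add: bergman_dist_def bergman_norm_def p_integral_def)

lemma bergman_dist_less:
  assumes p: "p > 0" and e: "e > 0"
    and le: "p_integral lam p (\<lambda>z. f z - g z) < (if p \<ge> 1 then e powr p else e)"
  shows "bergman_dist lam p f g < e"
proof (cases "p \<ge> 1")
  case True
  have "p_integral lam p (\<lambda>z. f z - g z) powr (1 / p) < (e powr p) powr (1 / p)"
    using True le p_integral_nonneg by (intro powr_less_mono2) auto
  then show ?thesis
    using True e by (simp add: bergman_dist_eq powr_powr)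
next
  case False
  then show ?thesis
    using p le p_integral_nonneg[of lam p "\<lambda>z. f z - g z"] by (simp add: bergman_dist_eq powr_powr)
qed

lemma linear_combinations_scaled:
  assumes e: "\<And>n z. e n z = of_real (a n) * phat lam n z" and a: "\<And>n. a n \<noteq> 0"
  shows "linear_combinations e = {\<lambda>z. \<Sum>n<N. c n * phat lam n z | (N :: nat) (c :: nat \<Rightarrow> complex). True}"
proof safe
  fix f assume "f \<in> linear_combinations e"
  then obtain N c where "f = (\<lambda>z. \<Sum>n<N. c n * e n z)"
    unfolding linear_combinations_def by blast
  then have "f = (\<lambda>z. \<Sum>n<N. (c n * of_real (a n)) * phat lam n z)"
    by (simp add: e mult.assoc)
  then show "\<exists>N c. f = (\<lambda>z. \<Sum>n<N. c n * phat lam n z) \<and> True"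
    by (intro exI[of _ N] exI[of _ "\<lambda>n. c n * of_real (a n)"]) simp
next
  fix N and c :: "nat \<Rightarrow> complex"
  have "(\<lambda>z. \<Sum>n<N. c n * phat lam n z) = (\<lambda>z. \<Sum>n<N. (c n / of_real (a n)) * e n z)"
    using a by (simp add: e)
  then show "(\<lambda>z. \<Sum>n<N. c n * phat lam n z) \<in> linear_combinations e"
    unfolding linear_combinations_def mem_Collect_eq
    by (intro exI[of _ N] exI[of _ "\<lambda>n. c n / of_real (a n)"]) simp
qed

text \<open>
  Rescaling the polynomials does not change their span, so this serves both for the \<open>\<phi>\<^sub>n\<close> and for the
  orthonormal system.
\<close>

lemma dense_linear_combinations:
  assumes lam: "lam \<ge> 0" and p: "p > 0"
    and e: "\<And>n z. e n z = of_real (a n) * phat lam n z" and a: "\<And>n. a n \<noteq> 0"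
  shows "dense_in_bergman lam p (linear_combinations e)"
  unfolding dense_in_bergman_def linear_combinations_scaled[OF e a]
proof (intro conjI ballI allI impI)
  show "{\<lambda>z. \<Sum>n<N. c n * phat lam n z | (N :: nat) (c :: nat \<Rightarrow> complex). True} \<subseteq> bergman_space lam p"
    using phat_sum_in_bergman[OF lam p] by blast
  fix f and \<epsilon> :: real
  assume f: "f \<in> bergman_space lam p" and \<epsilon>: "\<epsilon> > 0"
  have "(if p \<ge> 1 then \<epsilon> powr p else \<epsilon>) > 0"
    using \<epsilon> by simp
  then obtain N and c :: "nat \<Rightarrow> complex" where
    "p_integral lam p (\<lambda>z. f z - (\<Sum>n<N. c n * phat lam n z)) < (if p \<ge> 1 then \<epsilon> powr p else \<epsilon>)"
    using polynomial_approximation_Lp[OF lam p f] by blast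
  then have "bergman_dist lam p f (\<lambda>z. \<Sum>n<N. c n * phat lam n z) < \<epsilon>"
    by (rule bergman_dist_less[OF p \<epsilon>])
  then show "\<exists>g\<in>{\<lambda>z. \<Sum>n<N. c n * phat lam n z | (N :: nat) (c :: nat \<Rightarrow> complex). True}. bergman_dist lam p f g < \<epsilon>"
    by blast
qed

lemma eps_lambda_eq: "eps_lambda lam n = sqrt (inverse (rising_coeff (2 * lam + 1) n))"
  by (simp add: eps_lambda_def rising_coeff_def)

lemma phat_norm_sq_pos: "lam \<ge> 0 \<Longrightarrow> phat_norm_sq lam n > 0"
  using rising_coeff_pos[of "2 * lam + 1" n] by (simp add: phat_norm_sq_def)

text \<open>
  The normalizing factors combine to the reciprocal of the \<open>L\<^sup>2\<close> norm.
\<close>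

lemma basis_eq_phat:
  assumes lam: "lam \<ge> 0"
  shows "of_real (((real n + lam + 1) / (lam + 1)) powr (1 / 2)) * phi lam n z
     = of_real (sqrt (inverse (phat_norm_sq lam n))) * phat lam n z"
proof -
  have "((real n + lam + 1) / (lam + 1)) powr (1 / 2) * eps_lambda lam n = sqrt (inverse (phat_norm_sq lam n))"
  proof -
    have "(real n + lam + 1) / (lam + 1) * inverse (rising_coeff (2 * lam + 1) n) = inverse (phat_norm_sq lam n)"
      by (simp add: phat_norm_sq_def field_simps)
    moreover have "((real n + lam + 1) / (lam + 1)) powr (1 / 2) = sqrt ((real n + lam + 1) / (lam + 1))"
      using lam by (simp add: powr_half_sqrt)
    ultimately show ?thesis
      by (simp only: eps_lambda_eq real_sqrt_mult[symmetric])
  qed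
  then show ?thesis
    unfolding phi_eq_phat by (metis mult.assoc of_real_mult)
qed

lemma orthonormal_basis:
  assumes lam: "lam \<ge> 0" and e: "\<And>n z. e n z = of_real (sqrt (inverse (phat_norm_sq lam n))) * phat lam n z"
  shows "bergman_orthonormal_basis lam e"
  unfolding bergman_orthonormal_basis_def
proof (intro conjI allI)
  have a: "sqrt (inverse (phat_norm_sq lam n)) \<noteq> 0" for n
    using phat_norm_sq_pos[OF lam, of n] by simp
  show "dense_in_bergman lam 2 (linear_combinations e)"
    by (rule dense_linear_combinations[OF lam _ e a]) simp
  fix n
  have "e n = (\<lambda>z. \<Sum>m<Suc n. (if m = n then of_real (sqrt (inverse (phat_norm_sq lam n))) else 0) * phat lam m z)"
  proof
    fix z
    have "(\<Sum>m<Suc n. (if m = n then of_real (sqrt (inverse (phat_norm_sq lam n))) else 0) * phat lam m z)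
       = (\<Sum>m<Suc n. if m = n then of_real (sqrt (inverse (phat_norm_sq lam n))) * phat lam m z else 0)"
      by (intro sum.cong) auto
    then show "e n z = (\<Sum>m<Suc n. (if m = n then of_real (sqrt (inverse (phat_norm_sq lam n))) else 0) * phat lam m z)"
      by (simp add: e)
  qed
  then show "e n \<in> bergman_space lam 2"
    by (simp only:) (rule phat_sum_in_bergman[OF lam], simp)
  fix m
  have "bergman_inner lam (e m) (e n) = (\<integral>z. of_real (sqrt (inverse (phat_norm_sq lam m)) * sqrt (inverse (phat_norm_sq lam n)))
      * (phat lam m z * cnj (phat lam n z)) \<partial>sigma_lambda lam)"
    unfolding bergman_inner_def e by (simp add: mult_ac)
  also have "\<dots> = of_real (sqrt (inverse (phat_norm_sq lam m)) * sqrt (inverse (phat_norm_sq lam n)))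
     * of_real (if m = n then phat_norm_sq lam n else 0)"
    by (subst Bochner_Integration.integral_mult_right[OF integral_phat_product(1)[OF lam]]) (simp add: integral_phat_product(2)[OF lam])
  also have "\<dots> = (if m = n then 1 else 0)"
  proof -
    have "sqrt (inverse (phat_norm_sq lam n)) * sqrt (inverse (phat_norm_sq lam n)) * phat_norm_sq lam n = 1"
      using phat_norm_sq_pos[OF lam, of n] by simp
    then show ?thesis
      by (auto simp flip: of_real_mult)
  qed
  finally show "bergman_inner lam (e m) (e n) = (if m = n then 1 else 0)" .
qed

lemma p_integral_phat_sum:
  assumes lam: "lam \<ge> 0"
  shows "p_integral lam 2 (\<lambda>z. \<Sum>n<M. a n * phat lam n z) = (\<Sum>n<M. (norm (a n))\<^sup>2 * phat_norm_sq lam n)"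
proof -
  let ?S = "\<lambda>z. \<Sum>n<M. a n * phat lam n z"
  have sq: "complex_of_real (norm (?S z) powr 2) = (\<Sum>m<M. \<Sum>n<M. (a m * cnj (a n)) * (phat lam m z * cnj (phat lam n z)))" for z
  proof -
    have "norm w powr 2 = (norm w)\<^sup>2" for w :: complex
      by simp
    then have "complex_of_real (norm (?S z) powr 2) = ?S z * cnj (?S z)"
      by (simp only: complex_norm_square)
    also have "\<dots> = (\<Sum>m<M. \<Sum>n<M. (a m * cnj (a n)) * (phat lam m z * cnj (phat lam n z)))"
      by (simp add: sum_product mult_ac)
    finally show ?thesis .
  qed
  have "complex_of_real (p_integral lam 2 ?S) = (\<integral>z. complex_of_real (norm (?S z) powr 2) \<partial>sigma_lambda lam)"
    unfolding p_integral_def by (rule integral_complex_of_real[symmetric])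
  also have "\<dots> = (\<Sum>m<M. \<Sum>n<M. (a m * cnj (a n)) * of_real (if m = n then phat_norm_sq lam n else 0))"
    unfolding sq using integral_phat_product[OF lam]
    by (subst Bochner_Integration.integral_sum; (intro Bochner_Integration.integrable_sum)?; simp)
  also have "\<dots> = (\<Sum>m<M. \<Sum>n<M. if m = n then of_real ((norm (a m))\<^sup>2 * phat_norm_sq lam m) else 0)"
  proof (intro sum.cong refl)
    fix m n
    have "(a m * cnj (a m)) * of_real (phat_norm_sq lam m) = complex_of_real ((norm (a m))\<^sup>2 * phat_norm_sq lam m)"
      by (simp only: of_real_mult complex_norm_square)
    then show "(a m * cnj (a n)) * of_real (if m = n then phat_norm_sq lam n else 0)
        = (if m = n then of_real ((norm (a m))\<^sup>2 * phat_norm_sq lam m) else 0)"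
      by (cases "m = n") simp_all
  qed
  also have "\<dots> = of_real (\<Sum>m<M. (norm (a m))\<^sup>2 * phat_norm_sq lam m)"
    by simp
  finally show ?thesis
    using of_real_eq_iff by blast
qed

lemma one_le_rising_coeff: "a \<ge> 1 \<Longrightarrow> rising_coeff a n \<ge> 1"
proof (induction n)
  case (Suc n)
  have "real (Suc n) * 1 \<le> (a + real n) * rising_coeff a n"
    using Suc by (intro mult_mono) auto
  then show ?case
    unfolding rising_coeff_Suc[symmetric] by simp
qed simp

lemma one_le_weight_bound:
  assumes "lam \<ge> 0"
  shows "weight_bound lam n \<ge> 1"
proof -
  have "1 * 1 \<le> rising_coeff (2 * lam + 1) n * ((real n + lam + 1) / (lam + 1))"
    using assms by (intro mult_mono one_le_rising_coeff) (auto simp: rising_coeff_nonneg)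
  then show ?thesis
    by (simp add: weight_bound_def)
qed

text \<open>
  Bessel's inequality for one coefficient. It bounds \<open>(|a\<^sub>n| B\<^sub>n)\<^sup>2\<close> by \<open>e\<^sup>2 weight_bound lam n\<close>, and the weight is at
  least 1.
\<close>

lemma phat_coefficient_le:
  assumes lam: "lam \<ge> 0" and n: "n < M" and e: "e \<ge> 0"
    and le: "p_integral lam 2 (\<lambda>z. \<Sum>n<M. a n * phat lam n z) \<le> e\<^sup>2"
  shows "norm (a n) * rising_coeff (2 * lam + 1) n \<le> e * weight_bound lam n"
proof (rule power2_le_imp_le)
  let ?B = "rising_coeff (2 * lam + 1) n" and ?w = "weight_bound lam n" and ?N = "phat_norm_sq lam n"
  have N: "?N > 0" and B: "?B > 0" and w: "?w \<ge> 1"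
    using phat_norm_sq_pos[OF lam] lam one_le_weight_bound[OF lam] by (auto simp: rising_coeff_pos)
  have nonneg: "0 \<le> (norm (a i))\<^sup>2 * phat_norm_sq lam i" for i
    using phat_norm_sq_pos[OF lam, of i] by simp
  have "(norm (a n))\<^sup>2 * ?N \<le> (\<Sum>n<M. (norm (a n))\<^sup>2 * phat_norm_sq lam n)"
    by (rule member_le_sum[where f = "\<lambda>n. (norm (a n))\<^sup>2 * phat_norm_sq lam n"]) (use n nonneg in auto)
  then have "(norm (a n))\<^sup>2 * ?N \<le> e\<^sup>2"
    using le unfolding p_integral_phat_sum[OF lam] by linarith
  then have "(norm (a n))\<^sup>2 * ?N * ?w \<le> e\<^sup>2 * ?w"
    using w by (intro mult_right_mono) auto
  moreover have "?N * ?w = ?B\<^sup>2"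
    using lam by (simp add: phat_norm_sq_def weight_bound_def power2_eq_square)
  ultimately have "(norm (a n) * ?B)\<^sup>2 \<le> e\<^sup>2 * ?w"
    by (simp add: power_mult_distrib mult.assoc)
  also have "\<dots> \<le> e\<^sup>2 * ?w\<^sup>2"
    using w by (intro mult_left_mono) (auto simp: power2_eq_square)
  finally show "(norm (a n) * ?B)\<^sup>2 \<le> (e * ?w)\<^sup>2"
    by (simp add: power_mult_distrib)
  show "0 \<le> e * ?w"
    using e w by simp
qed

lemma bergman_dist_2: "bergman_dist lam 2 f g = sqrt (p_integral lam 2 (\<lambda>z. f z - g z))"
  by (simp add: bergman_dist_eq powr_half_sqrt p_integral_nonneg)

lemma p_integral_Fatou:
  assumes p: "p > 0" and L: "\<And>l. Lp_fun lam p (v l)" and F: "F \<in> borel_measurable (sigma_lambda lam)"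
    and lim: "\<And>z. z \<in> unit_disk \<Longrightarrow> (\<lambda>l. v l z) \<longlonglongrightarrow> F z"
    and le: "\<And>l. l \<ge> K \<Longrightarrow> p_integral lam p (v l) \<le> C" and C: "C \<ge> 0"
  shows "Lp_fun lam p F" "p_integral lam p F \<le> C"
proof -
  have "(\<integral>\<^sup>+z. ennreal (norm (F z) powr p) \<partial>sigma_lambda lam) = (\<integral>\<^sup>+z. liminf (\<lambda>l. ennreal (norm (v l z) powr p)) \<partial>sigma_lambda lam)"
  proof (intro nn_integral_cong)
    fix z assume "z \<in> space (sigma_lambda lam)"
    then have "(\<lambda>l. v l z) \<longlonglongrightarrow> F z"
      by (intro lim) simp
    then have "(\<lambda>l. ennreal (norm (v l z) powr p)) \<longlonglongrightarrow> ennreal (norm (F z) powr p)"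
      using p by (intro tendsto_ennrealI tendsto_powr2 tendsto_norm tendsto_const) auto
    then show "ennreal (norm (F z) powr p) = liminf (\<lambda>l. ennreal (norm (v l z) powr p))"
      by (metis lim_imp_Liminf trivial_limit_sequentially)
  qed
  also have "\<dots> \<le> liminf (\<lambda>l. \<integral>\<^sup>+z. ennreal (norm (v l z) powr p) \<partial>sigma_lambda lam)"
    using L unfolding Lp_fun_def
    by (intro nn_integral_liminf measurable_compose[OF powr_norm_measurable measurable_ennreal]) auto
  also have "\<dots> \<le> liminf (\<lambda>l. ennreal C)"
  proof (intro Liminf_mono)
    have "(\<integral>\<^sup>+z. ennreal (norm (v l z) powr p) \<partial>sigma_lambda lam) \<le> ennreal C" if "l \<ge> K" for l
    proof -
      have "(\<integral>\<^sup>+z. ennreal (norm (v l z) powr p) \<partial>sigma_lambda lam) = ennreal (p_integral lam p (v l))"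
        using L[of l] unfolding p_integral_def Lp_fun_def by (intro nn_integral_eq_integral) auto
      then show ?thesis
        using le[OF that] by (simp add: ennreal_leI)
    qed
    then show "\<forall>\<^sub>F l in sequentially. (\<integral>\<^sup>+z. ennreal (norm (v l z) powr p) \<partial>sigma_lambda lam) \<le> ennreal C"
      unfolding eventually_sequentially by blast
  qed
  also have "\<dots> = ennreal C"
    by (simp add: Liminf_const)
  finally have main: "(\<integral>\<^sup>+z. ennreal (norm (F z) powr p) \<partial>sigma_lambda lam) \<le> ennreal C" .
  have int: "integrable (sigma_lambda lam) (\<lambda>z. norm (F z) powr p)"
  proof (rule integrableI_bounded[OF powr_norm_measurable[OF F]])
    show "(\<integral>\<^sup>+z. ennreal (norm (norm (F z) powr p)) \<partial>sigma_lambda lam) < \<infinity>"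
      using le_less_trans[OF main ennreal_less_top] by simp
  qed
  then show "Lp_fun lam p F"
    using F unfolding Lp_fun_def by simp
  have "ennreal (p_integral lam p F) = (\<integral>\<^sup>+z. ennreal (norm (F z) powr p) \<partial>sigma_lambda lam)"
    unfolding p_integral_def by (intro nn_integral_eq_integral[symmetric] int) simp
  then have "ennreal (p_integral lam p F) \<le> ennreal C"
    using main by (simp only:)
  then show "p_integral lam p F \<le> C"
    using ennreal_le_iff[OF C] by blast
qed

text \<open>
  The argument passes through polynomials \<open>P k\<close> close to the given sequence: for them Cauchy in norm means Cauchy
  in the coefficients, which yields the limit \<open>F\<close> by \<open>phat_polynomials_limit\<close>.
\<close>

lemma complete_bergman_2:
  assumes lam: "lam \<ge> 0"
  shows "complete_bergman lam 2"
  unfolding complete_bergman_def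
proof (intro allI impI)
  fix u :: "nat \<Rightarrow> complex \<Rightarrow> complex"
  assume "(\<forall>k. u k \<in> bergman_space lam 2) \<and>
    (\<forall>e>0. \<exists>K. \<forall>k\<ge>K. \<forall>l\<ge>K. bergman_dist lam 2 (u k) (u l) < e)"
  then have u: "\<And>k. u k \<in> bergman_space lam 2"
    and cauchy: "\<And>e. e > 0 \<Longrightarrow> \<exists>K. \<forall>k\<ge>K. \<forall>l\<ge>K. bergman_dist lam 2 (u k) (u l) < e"
    by auto
  let ?d = "\<lambda>f g. p_integral lam 2 (\<lambda>z. f z - g z)"
  have "\<exists>N (c :: nat \<Rightarrow> complex). ?d (u k) (\<lambda>z. \<Sum>n<N. c n * phat lam n z) < 1 / (real k + 1)" for k
    by (rule polynomial_approximation_Lp[OF lam _ u]) auto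
  then obtain N and c0 :: "nat \<Rightarrow> nat \<Rightarrow> complex" where
    c0: "\<And>k. ?d (u k) (\<lambda>z. \<Sum>n<N k. c0 k n * phat lam n z) < 1 / (real k + 1)"
    by metis
  define c where "c k n = (if n < N k then c0 k n else 0)" for k n
  define P where "P k z = (\<Sum>n<N k. c k n * phat lam n z)" for k z
  have uP: "?d (u k) (P k) < 1 / (real k + 1)" for k
    using c0[of k] by (simp add: P_def c_def)
  have Lu: "Lp_fun lam 2 (u k)" for k
    by (rule bergman_space_Lp(2)[OF u])
  have LP: "Lp_fun lam 2 (P k)" for k
    unfolding P_def[abs_def] by (rule bergman_space_Lp(2)[OF phat_sum_in_bergman[OF lam]]) simp
  have tri: "?d f h \<le> 4 * (?d f g + ?d g h)" if "Lp_fun lam 2 f" "Lp_fun lam 2 g" "Lp_fun lam 2 h" for f g h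
    using p_integral_triangle[OF _ that] by simp
  have small: "\<exists>K. \<forall>k\<ge>K. 1 / (real k + 1) < e" if pos: "e > 0" for e
  proof -
    obtain K :: nat where K: "inverse (real (Suc K)) < e"
      using reals_Archimedean[OF pos] by blast
    have "1 / (real k + 1) < e" if "k \<ge> K" for k
    proof -
      have "1 / (real k + 1) \<le> 1 / (real K + 1)"
        using that by (intro divide_left_mono) auto
      also have "\<dots> < e"
        using K by (simp add: inverse_eq_divide add.commute)
      finally show ?thesis .
    qed
    then show ?thesis
      by blast
  qed
  have PP: "\<exists>K. \<forall>k\<ge>K. \<forall>l\<ge>K. ?d (P k) (P l) \<le> e" if e: "e > 0" for e
  proof -
    \<comment> \<open>Two uses of the inequality with constant 4 cost \<open>4 (1 + 4 (1 + 1)) = 36\<close>.\<close>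
    define \<delta> where "\<delta> = e / 36"
    have \<delta>: "\<delta> > 0"
      using e by (simp add: \<delta>_def)
    obtain K1 where K1: "\<And>k l. k \<ge> K1 \<Longrightarrow> l \<ge> K1 \<Longrightarrow> bergman_dist lam 2 (u k) (u l) < sqrt \<delta>"
      using cauchy[of "sqrt \<delta>"] \<delta> by auto
    obtain K2 where K2: "\<And>k. k \<ge> K2 \<Longrightarrow> 1 / (real k + 1) < \<delta>"
      using small[OF \<delta>] by blast
    have "?d (P k) (P l) \<le> e" if kl: "k \<ge> max K1 K2" "l \<ge> max K1 K2" for k l
    proof -
      have 1: "?d (u k) (u l) < \<delta>"
        using K1[of k l] kl unfolding bergman_dist_2 by simp
      have 2: "?d (P k) (u k) < \<delta>"
        using uP[of k] K2[of k] kl p_integral_minus_commute[of lam 2 "P k" "u k"] by simp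
      have 3: "?d (u l) (P l) < \<delta>"
        using uP[of l] K2[of l] kl by simp
      have "?d (P k) (P l) \<le> 4 * (?d (P k) (u k) + ?d (u k) (P l))"
        by (intro tri LP Lu)
      moreover have "?d (u k) (P l) \<le> 4 * (?d (u k) (u l) + ?d (u l) (P l))"
        by (intro tri LP Lu)
      ultimately have "?d (P k) (P l) \<le> 36 * \<delta>"
        using 1 2 3 unfolding distrib_left by linarith
      then show ?thesis
        by (simp add: \<delta>_def)
    qed
    then show ?thesis
      by blast
  qed
  have "\<exists>F. lambda_analytic lam F \<and> (\<forall>r. 0 < r \<longrightarrow> r < 1 \<longrightarrow>
     uniform_limit (cball 0 r) (\<lambda>k z. \<Sum>n<N k. c k n * phat lam n z) F sequentially)"
  proof (rule phat_polynomials_limit[OF lam])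
    fix e :: real assume e: "e > 0"
    obtain K where K: "\<And>k l. k \<ge> K \<Longrightarrow> l \<ge> K \<Longrightarrow> ?d (P k) (P l) \<le> e\<^sup>2"
      using PP[of "e\<^sup>2"] e by auto
    have "norm (c k n - c l n) * rising_coeff (2 * lam + 1) n \<le> e * weight_bound lam n"
      if kl: "k \<ge> K" "l \<ge> K" for k l n
    proof -
      define M where "M = max (max (N k) (N l)) (Suc n)"
      have ext: "P i z = (\<Sum>m<M. c i m * phat lam m z)" if "N i \<le> M" for i z
        unfolding P_def using that by (intro sum.mono_neutral_left) (auto simp: c_def)
      have "(\<lambda>z. P k z - P l z) = (\<lambda>z. \<Sum>m<M. (c k m - c l m) * phat lam m z)"
        using ext[of k] ext[of l] by (simp add: M_def left_diff_distrib sum_subtractf)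
      then have "p_integral lam 2 (\<lambda>z. \<Sum>m<M. (c k m - c l m) * phat lam m z) \<le> e\<^sup>2"
        using K[OF kl] by simp
      then show ?thesis
        using e by (intro phat_coefficient_le[OF lam, of n M]) (auto simp: M_def)
    qed
    then show "\<exists>K. \<forall>k\<ge>K. \<forall>l\<ge>K. \<forall>n. norm (c k n - c l n) * rising_coeff (2 * lam + 1) n \<le> e * weight_bound lam n"
      by blast
  qed (simp add: c_def)
  then obtain F where F: "lambda_analytic lam F"
    "\<And>r. 0 < r \<Longrightarrow> r < 1 \<Longrightarrow> uniform_limit (cball 0 r) P F sequentially"
    unfolding P_def[abs_def] by blast
  have lim: "(\<lambda>k. P k z) \<longlonglongrightarrow> F z" if z: "z \<in> unit_disk" for z
  proof -
    obtain s where "0 < s" "s < 1" "norm z < s"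
      using radius_between[OF z] by blast
    then show ?thesis
      by (intro tendsto_uniform_limitI[OF F(2)]) auto
  qed
  have Fm: "F \<in> borel_measurable (sigma_lambda lam)"
    by (rule continuous_on_measurable_sigma[OF lambda_analytic_continuous_on[OF F(1)]])
  have PF: "\<exists>K. \<forall>k\<ge>K. Lp_fun lam 2 (\<lambda>z. P k z - F z) \<and> ?d (P k) F \<le> e" if e: "e > 0" for e
  proof -
    obtain K where K: "\<And>k l. k \<ge> K \<Longrightarrow> l \<ge> K \<Longrightarrow> ?d (P k) (P l) \<le> e"
      using PP[OF e] by auto
    have "Lp_fun lam 2 (\<lambda>z. P k z - F z) \<and> ?d (P k) F \<le> e" if k: "k \<ge> K" for k
    proof -
      have m: "(\<lambda>z. P k z - F z) \<in> borel_measurable (sigma_lambda lam)"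
        using LP[of k] Fm unfolding Lp_fun_def by (intro borel_measurable_diff) auto
      have L: "Lp_fun lam 2 (\<lambda>z. P k z - P l z)" for l
        by (rule Lp_fun_diff(1)[OF _ LP LP]) simp
      have t: "(\<lambda>l. P k z - P l z) \<longlonglongrightarrow> P k z - F z" if "z \<in> unit_disk" for z
        by (intro tendsto_intros lim that)
      show ?thesis
        using p_integral_Fatou[OF _ L m t K[OF k]] e by simp
    qed
    then show ?thesis
      by blast
  qed
  have LF: "Lp_fun lam 2 F"
  proof -
    obtain k where "Lp_fun lam 2 (\<lambda>z. P k z - F z)"
      using PF[of 1] by auto
    then have "Lp_fun lam 2 (\<lambda>z. P k z - (P k z - F z))"
      by (rule Lp_fun_diff(1)[OF zero_less_numeral LP])
    then show ?thesis
      by simp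
  qed
  have "F \<in> bergman_space lam 2"
    using F(1) LF unfolding bergman_space_def Lp_fun_def by simp
  moreover have "(\<lambda>k. bergman_dist lam 2 (u k) F) \<longlonglongrightarrow> 0"
  proof -
    have "(\<lambda>k. ?d (u k) F) \<longlonglongrightarrow> 0"
    proof (rule LIMSEQ_I)
      fix e :: real assume e: "e > 0"
      then have e8: "e / 9 > 0"
        by simp
      obtain K1 where K1: "\<And>k. k \<ge> K1 \<Longrightarrow> ?d (P k) F \<le> e / 9"
        using PF[OF e8] by blast
      obtain K2 where K2: "\<And>k. k \<ge> K2 \<Longrightarrow> 1 / (real k + 1) < e / 9"
        using small[OF e8] by blast
      have "norm (?d (u k) F - 0) < e" if k: "k \<ge> max K1 K2" for k
      proof -
        have "?d (u k) F \<le> 4 * (?d (u k) (P k) + ?d (P k) F)"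
          by (intro tri LP Lu LF)
        also have "\<dots> < e"
          using uP[of k] K1[of k] K2[of k] k e by simp
        finally show ?thesis
          using p_integral_nonneg[of lam 2 "\<lambda>z. u k z - F z"] by simp
      qed
      then show "\<exists>no. \<forall>k\<ge>no. norm (?d (u k) F - 0) < e"
        by blast
    qed
    then have "(\<lambda>k. sqrt (?d (u k) F)) \<longlonglongrightarrow> sqrt 0"
      by (rule tendsto_real_sqrt)
    then show ?thesis
      unfolding bergman_dist_2 by simp
  qed
  ultimately show "\<exists>f\<in>bergman_space lam 2. (\<lambda>k. bergman_dist lam 2 (u k) f) \<longlonglongrightarrow> 0"
    by blast
qed

theorem theorem5p3:
  fixes lam :: real
  assumes "lam \<ge> 0"
  shows "(\<forall>p :: real. 2 * lam / (2 * lam + 1) < p \<longrightarrow>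
            dense_in_bergman lam p (lambda_polynomials lam)) \<and>
         complete_bergman lam 2 \<and>
         bergman_orthonormal_basis lam
           (\<lambda>n z. of_real (((real n + lam + 1) / (lam + 1)) powr (1/2)) * phi lam n z)"
proof (intro conjI allI impI)
  show "complete_bergman lam 2"
    by (rule complete_bergman_2[OF assms])
  show "bergman_orthonormal_basis lam
      (\<lambda>n z. of_real (((real n + lam + 1) / (lam + 1)) powr (1/2)) * phi lam n z)"
    by (rule orthonormal_basis[OF assms basis_eq_phat[OF assms]])
  fix p :: real
  assume "2 * lam / (2 * lam + 1) < p"
  moreover have "0 \<le> 2 * lam / (2 * lam + 1)"
    using assms by simp
  ultimately have p: "p > 0"
    by linarith
  have "eps_lambda lam n \<noteq> 0" for n
    using rising_coeff_pos[of "2 * lam + 1" n] assms by (simp add: eps_lambda_eq)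
  then show "dense_in_bergman lam p (lambda_polynomials lam)"
    unfolding lambda_polynomials_def by (intro dense_linear_combinations[OF assms p phi_eq_phat])
qed

end
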